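(* For every integer $k\ge 1$ there exist constants $\alpha_3>0$ and $\beta_3>0$ depending only on $k$ such that for every $\epsilon>0$ and all sufficiently large integers $n$, $$\beta_3 n^{-k+1/2} \;\leq\; \left(\frac{\mathrm{Vol}\, \widetilde{Lf}}{\mathrm{Vol}\, B_M}\right)^{1/D_M} \;\leq\; \alpha_3 n^{-k+1/2+\epsilon},$$ where $\widetilde{Lf}=\widetilde{Lf}_{n,2k}$ is the translated section of the cone of sums of $2k$-th powers of linear forms in $n$ variables, and $B_M$, $D_M$ are the $L^2$ unit ball and the dimension of the space $M_{n,2k}$ of forms of integral zero on the sphere.
   Context: $P_{n,m}$ is the real vector space of real homogeneous polynomials (forms) of degree $m$ in $n$ variables. $S^{n-1}$ is the unit sphere in $\mathbb{R}^n$ and $\sigma$ is the rotation invariant probability measure on it. $P_{n,2k}$ carries the inner product $\langle f,g\rangle=\int_{S^{n-1}} fg\,d\sigma$. $M=M_{n,2k}=\{f\in P_{n,2k} : \int_{S^{n-1}} f\,d\sigma=0\}$, $D_M=\dim M_{n,2k}$, and $B_M$ is the unit ball of $M_{n,2k}$ in the inner product $\langle\,,\rangle$; $\mathrm{Vol}$ is Lebesgue measure on $M_{n,2k}$ for this inner product. Let $r^{2k}=(x_1^2+\dots+x_n^2)^k$. The cone of sums of $2k$-th powers of linear forms is $Lf=\{f\in P_{n,2k} : f=\sum_i l_i^{2k} \text{ for some (finitely many) linear forms } l_i\in P_{n,1}\}$, and $\widetilde{Lf}=\{f\in M_{n,2k} : f+r^{2k}\in Lf\}$. *)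

theory Defs
  imports "HOL-Probability.Probability" "HOL-Analysis.Finite_Function_Topology"
begin

text \<open>
  The number \<open>n\<close> of variables is a term-level natural number: points of \<open>\<real>\<^sup>n\<close> are extensional
  functions on \<open>{..<n}\<close>, and polynomials in \<open>x\<^sub>0, x\<^sub>1, \<dots>\<close> are finitely supported maps from
  monomials (themselves finitely supported exponent vectors) to coefficients.
\<close>

type_synonym rpoly = "(nat \<Rightarrow>\<^sub>0 nat) \<Rightarrow>\<^sub>0 real"

definition poly_var :: "nat \<Rightarrow> rpoly" where
  "poly_var i = Poly_Mapping.single (Poly_Mapping.single i 1) 1"

definition poly_eval :: "rpoly \<Rightarrow> (nat \<Rightarrow> real) \<Rightarrow> real" where
  "poly_eval f x = (\<Sum>a\<in>Poly_Mapping.keys f. Poly_Mapping.lookup f a *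
     (\<Prod>i\<in>Poly_Mapping.keys a. x i ^ Poly_Mapping.lookup a i))"

definition forms :: "nat \<Rightarrow> nat \<Rightarrow> rpoly set" where
  "forms n m = {f. \<forall>a\<in>Poly_Mapping.keys f. Poly_Mapping.keys a \<subseteq> {..<n} \<and>
     (\<Sum>i\<in>Poly_Mapping.keys a. Poly_Mapping.lookup a i) = m}"

definition Leb :: "nat \<Rightarrow> (nat \<Rightarrow> real) measure" where
  "Leb n = (\<Pi>\<^sub>M i\<in>{..<n}. lborel)"

definition sqnorm :: "nat \<Rightarrow> (nat \<Rightarrow> real) \<Rightarrow> real" where
  "sqnorm n x = (\<Sum>i<n. (x i)\<^sup>2)"

definition unit_sphere :: "nat \<Rightarrow> (nat \<Rightarrow> real) set" where
  "unit_sphere n = {x \<in> {..<n} \<rightarrow>\<^sub>E UNIV. sqnorm n x = 1}"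

definition punctured_ball :: "nat \<Rightarrow> (nat \<Rightarrow> real) set" where
  "punctured_ball n = {x \<in> {..<n} \<rightarrow>\<^sub>E UNIV. 0 < sqnorm n x \<and> sqnorm n x \<le> 1}"

text \<open>
  The rotation invariant probability measure on the sphere, constructed as the image of the
  uniform distribution on the (punctured) unit ball under \<open>x \<mapsto> x / \<bar>x\<bar>\<close>. That it is a probability
  measure and invariant under the orthogonal group is proved below
  (\<open>prob_space_sphere_measure\<close>, \<open>sphere_measure_orthogonal_invariant\<close>).
\<close>

definition sphere_measure :: "nat \<Rightarrow> (nat \<Rightarrow> real) measure" where
  "sphere_measure n =
     distr (restrict_space (uniform_measure (Leb n) (punctured_ball n)) (punctured_ball n))
       (restrict_space (Leb n) (unit_sphere n))
       (\<lambda>x. \<lambda>i\<in>{..<n}. x i / sqrt (sqnorm n x))"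

definition sphere_integral :: "nat \<Rightarrow> rpoly \<Rightarrow> real" where
  "sphere_integral n f = (LINT x|sphere_measure n. poly_eval f x)"

definition form_inner :: "nat \<Rightarrow> rpoly \<Rightarrow> rpoly \<Rightarrow> real" where
  "form_inner n f g = (LINT x|sphere_measure n. poly_eval f x * poly_eval g x)"

definition M_space :: "nat \<Rightarrow> nat \<Rightarrow> rpoly set" where
  "M_space n k = {f \<in> forms n (2 * k). sphere_integral n f = 0}"

definition D_M :: "nat \<Rightarrow> nat \<Rightarrow> nat" where
  "D_M n k = dim (M_space n k)"

definition B_M :: "nat \<Rightarrow> nat \<Rightarrow> rpoly set" where
  "B_M n k = {f \<in> M_space n k. form_inner n f f \<le> 1}"

definition orthonormal_basis_M :: "nat \<Rightarrow> nat \<Rightarrow> (nat \<Rightarrow> rpoly) \<Rightarrow> bool" where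
  "orthonormal_basis_M n k b \<longleftrightarrow>
     b ` {..<D_M n k} \<subseteq> M_space n k \<and> span (b ` {..<D_M n k}) = M_space n k \<and>
     (\<forall>i<D_M n k. \<forall>j<D_M n k. form_inner n (b i) (b j) = (if i = j then 1 else 0))"

text \<open>
  Lebesgue measure on \<open>M_space n k\<close> for the inner product \<open>form_inner\<close>: Lebesgue measure of the set of
  coordinate vectors with respect to an orthonormal basis; by orthogonal invariance of Lebesgue
  measure (\<open>Leb_orthogonal_invariant\<close> below) the choice of the basis does not matter.
\<close>

definition Vol_M :: "nat \<Rightarrow> nat \<Rightarrow> rpoly set \<Rightarrow> real" where
  "Vol_M n k S = (let b = (SOME b. orthonormal_basis_M n k b) in
     measure (completion (Leb (D_M n k)))
       {c \<in> {..<D_M n k} \<rightarrow>\<^sub>E UNIV. (\<Sum>i<D_M n k. c i *\<^sub>R b i) \<in> S})"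

definition r_pow :: "nat \<Rightarrow> nat \<Rightarrow> rpoly" where
  "r_pow n k = (\<Sum>i<n. (poly_var i)\<^sup>2) ^ k"

definition Lf :: "nat \<Rightarrow> nat \<Rightarrow> rpoly set" where
  "Lf n k = {f \<in> forms n (2 * k). \<exists>ls. set ls \<subseteq> forms n 1 \<and> f = (\<Sum>l\<leftarrow>ls. l ^ (2 * k))}"

definition Lf_tilde :: "nat \<Rightarrow> nat \<Rightarrow> rpoly set" where
  "Lf_tilde n k = {f \<in> M_space n k. f + r_pow n k \<in> Lf n k}"

definition orthogonal_mat :: "nat \<Rightarrow> (nat \<Rightarrow> nat \<Rightarrow> real) \<Rightarrow> bool" where
  "orthogonal_mat n A \<longleftrightarrow>
     (\<forall>i<n. \<forall>j<n. (\<Sum>l<n. A l i * A l j) = (if i = j then 1 else 0)) \<and>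
     (\<forall>i<n. \<forall>j<n. (\<Sum>l<n. A i l * A j l) = (if i = j then 1 else 0))"

definition mat_app :: "nat \<Rightarrow> (nat \<Rightarrow> nat \<Rightarrow> real) \<Rightarrow> (nat \<Rightarrow> real) \<Rightarrow> nat \<Rightarrow> real" where
  "mat_app n A x = (\<lambda>i\<in>{..<n}. \<Sum>j<n. A i j * x j)"

lemma space_Leb: "space (Leb n) = {..<n} \<rightarrow>\<^sub>E UNIV"
  by (simp add: Leb_def space_PiM)

lemma sigma_finite_Leb: "sigma_finite_measure (Leb n)"
proof -
  interpret product_sigma_finite "\<lambda>_::nat. lborel :: real measure" by standard
  show ?thesis unfolding Leb_def by (rule sigma_finite) simp
qed

lemma component_measurable_Leb [measurable]:
  "i < n \<Longrightarrow> (\<lambda>x. x i) \<in> borel_measurable (Leb n)"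
  unfolding Leb_def
  using measurable_component_singleton[of i "{..<n}" "\<lambda>_. lborel :: real measure"] by simp

lemma restrict_measurable_Leb:
  assumes "\<And>i. i < n \<Longrightarrow> (\<lambda>x. f x i) \<in> borel_measurable N"
  shows "(\<lambda>x. \<lambda>i\<in>{..<n}. f x i) \<in> N \<rightarrow>\<^sub>M Leb n"
  unfolding Leb_def using assms by (intro measurable_restrict) auto

lemma sqnorm_measurable [measurable]: "sqnorm n \<in> borel_measurable (Leb n)"
  unfolding sqnorm_def[abs_def] by measurable

lemma mat_app_measurable [measurable]: "mat_app n A \<in> Leb n \<rightarrow>\<^sub>M Leb n"
  unfolding mat_app_def[abs_def]
  by (intro restrict_measurable_Leb borel_measurable_sum borel_measurable_times
        borel_measurable_const component_measurable_Leb) auto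

lemma sets_unit_sphere [measurable]: "unit_sphere n \<in> sets (Leb n)"
proof -
  have "unit_sphere n = {x \<in> space (Leb n). sqnorm n x = 1}"
    by (simp add: unit_sphere_def space_Leb)
  then show ?thesis by simp
qed

lemma sets_punctured_ball [measurable]: "punctured_ball n \<in> sets (Leb n)"
proof -
  have "punctured_ball n = {x \<in> space (Leb n). 0 < sqnorm n x \<and> sqnorm n x \<le> 1}"
    by (simp add: punctured_ball_def space_Leb)
  then show ?thesis by simp
qed

lemma emeasure_Leb_box:
  assumes "\<And>i. i < n \<Longrightarrow> B i \<in> sets borel"
  shows "emeasure (Leb n) (Pi\<^sub>E {..<n} B) = (\<Prod>i<n. emeasure lborel (B i))"
proof -
  interpret product_sigma_finite "\<lambda>_::nat. lborel :: real measure" by standard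
  show ?thesis unfolding Leb_def using assms by (subst emeasure_PiM) auto
qed

lemma emeasure_punctured_ball_finite: "emeasure (Leb n) (punctured_ball n) < \<infinity>"
proof -
  have "punctured_ball n \<subseteq> Pi\<^sub>E {..<n} (\<lambda>_. {-1..1})"
  proof
    fix x assume x: "x \<in> punctured_ball n"
    have "x i \<in> {-1..1}" if "i < n" for i
    proof -
      have "(x i)\<^sup>2 \<le> sqnorm n x"
        unfolding sqnorm_def using that by (intro member_le_sum) auto
      also have "\<dots> \<le> 1" using x by (simp add: punctured_ball_def)
      finally have "\<bar>x i\<bar> \<le> 1" by (simp add: abs_square_le_1)
      then show ?thesis by auto
    qed
    then show "x \<in> Pi\<^sub>E {..<n} (\<lambda>_. {-1..1})"
      using x by (auto simp: punctured_ball_def PiE_iff)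
  qed
  moreover have "Pi\<^sub>E {..<n} (\<lambda>_. {-1..1::real}) \<in> sets (Leb n)"
    unfolding Leb_def by (intro sets_PiM_I_finite) auto
  ultimately have "emeasure (Leb n) (punctured_ball n) \<le> emeasure (Leb n) (Pi\<^sub>E {..<n} (\<lambda>_. {-1..1}))"
    by (intro emeasure_mono)
  also have "\<dots> = (\<Prod>i<n. ennreal 2)" by (subst emeasure_Leb_box) auto
  also have "\<dots> < \<infinity>" by (simp add: ennreal_power power_less_top_ennreal)
  finally show ?thesis .
qed

lemma emeasure_punctured_ball_pos:
  assumes "n \<ge> 1"
  shows "0 < emeasure (Leb n) (punctured_ball n)"
proof -
  define I where "I = {1 / (2 * real n)..1 / real n}"
  have "Pi\<^sub>E {..<n} (\<lambda>_. I) \<subseteq> punctured_ball n"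
  proof
    fix x assume x: "x \<in> Pi\<^sub>E {..<n} (\<lambda>_. I)"
    then have I: "1 / (2 * real n) \<le> x i" "x i \<le> 1 / real n" if "i < n" for i
      using that by (auto simp: I_def PiE_iff)
    have pos: "0 < x i" if "i < n" for i
      using I(1)[OF that] assms by (smt (verit) divide_pos_pos of_nat_0_less_iff less_le_trans less_one)
    have "0 < sqnorm n x" unfolding sqnorm_def
      using assms pos by (intro sum_pos) (auto simp: less_imp_neq lessThan_empty_iff dest: pos)
    moreover have "sqnorm n x \<le> (\<Sum>i<n. (1 / real n)\<^sup>2)"
      unfolding sqnorm_def using I pos by (intro sum_mono power_mono) (auto simp: less_imp_le)
    moreover have "(\<Sum>i<n. (1 / real n)\<^sup>2) \<le> 1"
      using assms by (simp add: power2_eq_square field_simps)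
    ultimately show "x \<in> punctured_ball n"
      using x by (auto simp: punctured_ball_def PiE_iff)
  qed
  then have "emeasure (Leb n) (Pi\<^sub>E {..<n} (\<lambda>_. I)) \<le> emeasure (Leb n) (punctured_ball n)"
    by (intro emeasure_mono) auto
  moreover have "emeasure (Leb n) (Pi\<^sub>E {..<n} (\<lambda>_. I)) = (\<Prod>i<n. ennreal (1 / (2 * real n)))"
    using assms by (subst emeasure_Leb_box) (auto simp: I_def field_simps intro!: prod.cong)
  moreover have "0 < (\<Prod>i<n. ennreal (1 / (2 * real n)))"
    using assms by (simp add: ennreal_power)
  ultimately show ?thesis by simp
qed

definition normalize_vec :: "nat \<Rightarrow> (nat \<Rightarrow> real) \<Rightarrow> nat \<Rightarrow> real" where
  "normalize_vec n x = (\<lambda>i\<in>{..<n}. x i / sqrt (sqnorm n x))"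

lemma normalize_vec_in_sphere:
  assumes "x \<in> punctured_ball n"
  shows "normalize_vec n x \<in> unit_sphere n"
proof -
  have "sqnorm n (normalize_vec n x) = (\<Sum>i<n. (x i)\<^sup>2 / sqnorm n x)"
    using assms
    by (auto simp: sqnorm_def normalize_vec_def power_divide punctured_ball_def sum_nonneg intro!: sum.cong)
  also have "\<dots> = 1"
    using assms by (simp add: punctured_ball_def sqnorm_def flip: sum_divide_distrib)
  finally show ?thesis by (simp add: unit_sphere_def normalize_vec_def)
qed

abbreviation unif_ball :: "nat \<Rightarrow> (nat \<Rightarrow> real) measure" where
  "unif_ball n \<equiv> restrict_space (uniform_measure (Leb n) (punctured_ball n)) (punctured_ball n)"

lemma space_unif_ball: "space (unif_ball n) = punctured_ball n"
  using sets.sets_into_space[OF sets_punctured_ball, of n] by (auto simp: space_restrict_space)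

lemma prob_space_unif_ball:
  assumes "n \<ge> 1"
  shows "prob_space (unif_ball n)"
proof
  have "emeasure (unif_ball n) (space (unif_ball n)) = 
      emeasure (uniform_measure (Leb n) (punctured_ball n)) (punctured_ball n)"
    unfolding space_unif_ball
    by (subst emeasure_restrict_space) auto
  also have "\<dots> = 1"
    using emeasure_punctured_ball_pos[OF assms] emeasure_punctured_ball_finite[of n]
    by (subst emeasure_uniform_measure) auto
  finally show "emeasure (unif_ball n) (space (unif_ball n)) = 1" .
qed

lemma normalize_vec_measurable:
  "normalize_vec n \<in> unif_ball n \<rightarrow>\<^sub>M restrict_space (Leb n) (unit_sphere n)"
proof (rule measurable_restrict_space2)
  show "normalize_vec n \<in> space (unif_ball n) \<rightarrow> unit_sphere n"
    unfolding space_unif_ball using normalize_vec_in_sphere by blast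
  have "normalize_vec n \<in> Leb n \<rightarrow>\<^sub>M Leb n"
    unfolding normalize_vec_def[abs_def]
    by (intro restrict_measurable_Leb borel_measurable_divide component_measurable_Leb
        measurable_compose[OF sqnorm_measurable]) auto
  then have "normalize_vec n \<in> uniform_measure (Leb n) (punctured_ball n) \<rightarrow>\<^sub>M Leb n"
    by (simp cong: measurable_cong_sets)
  then show "normalize_vec n \<in> unif_ball n \<rightarrow>\<^sub>M Leb n"
    by (rule measurable_restrict_space1)
qed

lemma sphere_measure_alt:
  "sphere_measure n = distr (unif_ball n) (restrict_space (Leb n) (unit_sphere n)) (normalize_vec n)"
  unfolding sphere_measure_def normalize_vec_def[abs_def] ..

theorem prob_space_sphere_measure:
  assumes "n \<ge> 1"
  shows "prob_space (sphere_measure n)"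
  unfolding sphere_measure_alt
  by (rule prob_space.prob_space_distr[OF prob_space_unif_ball[OF assms] normalize_vec_measurable])

lemma distr_Leb_componentwise:
  assumes [measurable]: "\<And>i. i < n \<Longrightarrow> \<phi> i \<in> borel_measurable borel"
    and inv: "\<And>i. i < n \<Longrightarrow> distr lborel lborel (\<phi> i) = lborel"
  shows "distr (Leb n) (Leb n) (\<lambda>x. \<lambda>i\<in>{..<n}. \<phi> i (x i)) = Leb n"
proof -
  interpret product_sigma_finite "\<lambda>_::nat. lborel :: real measure" by standard
  have meas: "(\<lambda>x. \<lambda>i\<in>{..<n}. \<phi> i (x i)) \<in> Leb n \<rightarrow>\<^sub>M Leb n"
    by (intro restrict_measurable_Leb measurable_compose[OF component_measurable_Leb]) auto
  have "distr (Leb n) (Leb n) (\<lambda>x. \<lambda>i\<in>{..<n}. \<phi> i (x i)) = Pi\<^sub>M {..<n} (\<lambda>_. lborel)"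
  proof (rule PiM_eqI)
    fix A :: "nat \<Rightarrow> real set"
    assume A: "\<And>i. i \<in> {..<n} \<Longrightarrow> A i \<in> sets lborel"
    have "Pi\<^sub>E {..<n} A \<in> sets (Leb n)"
      unfolding Leb_def using A by (intro sets_PiM_I_finite) auto
    then have "emeasure (distr (Leb n) (Leb n) (\<lambda>x. \<lambda>i\<in>{..<n}. \<phi> i (x i))) (Pi\<^sub>E {..<n} A)
      = emeasure (Leb n) ((\<lambda>x. \<lambda>i\<in>{..<n}. \<phi> i (x i)) -` Pi\<^sub>E {..<n} A \<inter> space (Leb n))"
      using meas by (simp add: emeasure_distr)
    also have "(\<lambda>x. \<lambda>i\<in>{..<n}. \<phi> i (x i)) -` Pi\<^sub>E {..<n} A \<inter> space (Leb n) = Pi\<^sub>E {..<n} (\<lambda>i. \<phi> i -` A i)"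
      by (auto simp: space_Leb PiE_iff)
    also have "emeasure (Leb n) \<dots> = (\<Prod>i<n. emeasure lborel (\<phi> i -` A i))"
    proof (rule emeasure_Leb_box)
      fix i assume "i < n"
      then have "\<phi> i -` A i \<inter> space borel \<in> sets borel"
        using A by (intro measurable_sets[OF assms(1)]) auto
      then show "\<phi> i -` A i \<in> sets borel" by simp
    qed
    also have "\<dots> = (\<Prod>i<n. emeasure lborel (A i))"
    proof (rule prod.cong[OF refl])
      fix i assume i: "i \<in> {..<n}"
      have "emeasure lborel (A i) = emeasure (distr lborel lborel (\<phi> i)) (A i)"
        using inv i by simp
      also have "\<dots> = emeasure lborel (\<phi> i -` A i)"
        using i A by (subst emeasure_distr) auto
      finally show "emeasure lborel (\<phi> i -` A i) = emeasure lborel (A i)" by simp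
    qed
    finally show "emeasure (distr (Leb n) (Leb n) (\<lambda>x. \<lambda>i\<in>{..<n}. \<phi> i (x i))) (Pi\<^sub>E {..<n} A) =
      (\<Prod>i\<in>{..<n}. emeasure lborel (A i))" .
  qed (auto simp: Leb_def)
  then show ?thesis by (simp add: Leb_def)
qed

definition vec_add :: "nat \<Rightarrow> (nat \<Rightarrow> real) \<Rightarrow> (nat \<Rightarrow> real) \<Rightarrow> nat \<Rightarrow> real" where
  "vec_add n x y = (\<lambda>i\<in>{..<n}. x i + y i)"

definition vec_diff :: "nat \<Rightarrow> (nat \<Rightarrow> real) \<Rightarrow> (nat \<Rightarrow> real) \<Rightarrow> nat \<Rightarrow> real" where
  "vec_diff n x y = (\<lambda>i\<in>{..<n}. x i - y i)"

lemma vec_measurable [measurable]: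
  assumes [measurable]: "f \<in> N \<rightarrow>\<^sub>M Leb n" "g \<in> N \<rightarrow>\<^sub>M Leb n"
  shows "(\<lambda>z. vec_add n (f z) (g z)) \<in> N \<rightarrow>\<^sub>M Leb n"
    and "(\<lambda>z. vec_diff n (f z) (g z)) \<in> N \<rightarrow>\<^sub>M Leb n"
proof -
  have [measurable]: "(\<lambda>z. f z i) \<in> borel_measurable N" "(\<lambda>z. g z i) \<in> borel_measurable N" if "i < n" for i
    using measurable_compose[OF assms(1) component_measurable_Leb[OF that]]
      measurable_compose[OF assms(2) component_measurable_Leb[OF that]] by auto
  show "(\<lambda>z. vec_add n (f z) (g z)) \<in> N \<rightarrow>\<^sub>M Leb n"
    unfolding vec_add_def by (intro restrict_measurable_Leb) measurable
  show "(\<lambda>z. vec_diff n (f z) (g z)) \<in> N \<rightarrow>\<^sub>M Leb n"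
    unfolding vec_diff_def by (intro restrict_measurable_Leb) measurable
qed

lemma distr_Leb_vec:
  shows "distr (Leb n) (Leb n) (vec_add n a) = Leb n"
    and "distr (Leb n) (Leb n) (vec_diff n a) = Leb n"
    and "distr (Leb n) (Leb n) (\<lambda>x. vec_diff n x a) = Leb n"
proof -
  have 1: "distr lborel lborel (\<lambda>x. c + x) = lborel" for c :: real
    using lborel_real_affine[of 1 c] by (simp add: density_1 distr_cong[OF refl sets_lborel])
  have 2: "distr lborel lborel (\<lambda>x. c - x) = lborel" for c :: real
    using lborel_real_affine[of "-1" c] by (simp add: density_1 distr_cong[OF refl sets_lborel])
  have 3: "distr lborel lborel (\<lambda>x. x - c) = lborel" for c :: real
    using 1[of "-c"] by (simp add: add.commute)
  show "distr (Leb n) (Leb n) (vec_add n a) = Leb n"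
    unfolding vec_add_def[abs_def] by (intro distr_Leb_componentwise 1) auto
  show "distr (Leb n) (Leb n) (vec_diff n a) = Leb n"
    unfolding vec_diff_def[abs_def] by (intro distr_Leb_componentwise 2) auto
  show "distr (Leb n) (Leb n) (\<lambda>x. vec_diff n x a) = Leb n"
    unfolding vec_diff_def[abs_def] by (intro distr_Leb_componentwise 3) auto
qed

lemma nn_integral_Leb_vec:
  assumes [measurable]: "h \<in> borel_measurable (Leb n)"
  shows "(\<integral>\<^sup>+y. h (vec_add n a y) \<partial>Leb n) = integral\<^sup>N (Leb n) h"
    and "(\<integral>\<^sup>+y. h (vec_diff n a y) \<partial>Leb n) = integral\<^sup>N (Leb n) h"
    and "(\<integral>\<^sup>+y. h (vec_diff n y a) \<partial>Leb n) = integral\<^sup>N (Leb n) h"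
proof -
  have m: "vec_add n a \<in> Leb n \<rightarrow>\<^sub>M Leb n" "vec_diff n a \<in> Leb n \<rightarrow>\<^sub>M Leb n"
     "(\<lambda>x. vec_diff n x a) \<in> Leb n \<rightarrow>\<^sub>M Leb n"
    unfolding vec_add_def vec_diff_def
    by (intro restrict_measurable_Leb borel_measurable_add borel_measurable_diff
        borel_measurable_const component_measurable_Leb; assumption)+
  show "(\<integral>\<^sup>+y. h (vec_add n a y) \<partial>Leb n) = integral\<^sup>N (Leb n) h"
    using nn_integral_distr[OF m(1), of h] by (simp add: distr_Leb_vec)
  show "(\<integral>\<^sup>+y. h (vec_diff n a y) \<partial>Leb n) = integral\<^sup>N (Leb n) h"
    using nn_integral_distr[OF m(2), of h] by (simp add: distr_Leb_vec)
  show "(\<integral>\<^sup>+y. h (vec_diff n y a) \<partial>Leb n) = integral\<^sup>N (Leb n) h"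
    using nn_integral_distr[OF m(3), of h] by (simp add: distr_Leb_vec)
qed

lemma orthogonal_mat_transpose: "orthogonal_mat n A \<Longrightarrow> orthogonal_mat n (\<lambda>i j. A j i)"
  by (simp add: orthogonal_mat_def)

lemma mat_app_transpose_mat_app:
  assumes "orthogonal_mat n A" "x \<in> space (Leb n)"
  shows "mat_app n A (mat_app n (\<lambda>i j. A j i) x) = x"
proof
  fix i
  show "mat_app n A (mat_app n (\<lambda>i j. A j i) x) i = x i"
  proof (cases "i < n")
    case True
    have "mat_app n A (mat_app n (\<lambda>i j. A j i) x) i = (\<Sum>j<n. A i j * (\<Sum>l<n. A l j * x l))"
      using True by (simp add: mat_app_def)
    also have "\<dots> = (\<Sum>j<n. \<Sum>l<n. A i j * A l j * x l)"
      by (simp add: sum_distrib_left mult.assoc)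
    also have "\<dots> = (\<Sum>l<n. (\<Sum>j<n. A i j * A l j) * x l)"
      by (subst sum.swap) (simp add: sum_distrib_right)
    also have "\<dots> = (\<Sum>l<n. (if i = l then 1 else 0) * x l)"
      using assms(1) True unfolding orthogonal_mat_def by (intro sum.cong) auto
    also have "\<dots> = x i" using True by (simp add: if_distrib[of "\<lambda>t. t * _"] cong: if_cong)
    finally show ?thesis .
  next
    case False
    then show ?thesis using assms(2) by (auto simp: mat_app_def space_Leb PiE_iff extensional_def)
  qed
qed

lemma sqnorm_mat_app:
  assumes "orthogonal_mat n A"
  shows "sqnorm n (mat_app n A x) = sqnorm n x"
proof -
  have "sqnorm n (mat_app n A x) = (\<Sum>i<n. (\<Sum>j<n. A i j * x j) * (\<Sum>l<n. A i l * x l))"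
    by (simp add: sqnorm_def mat_app_def power2_eq_square)
  also have "\<dots> = (\<Sum>i<n. \<Sum>j<n. \<Sum>l<n. (A i j * A i l) * (x j * x l))"
    by (simp add: sum_product mult_ac)
  also have "\<dots> = (\<Sum>j<n. \<Sum>l<n. \<Sum>i<n. (A i j * A i l) * (x j * x l))"
    by (subst sum.swap) (intro sum.cong refl sum.swap)
  also have "\<dots> = (\<Sum>j<n. \<Sum>l<n. (\<Sum>i<n. A i j * A i l) * (x j * x l))"
    by (simp add: sum_distrib_right)
  also have "\<dots> = (\<Sum>j<n. \<Sum>l<n. (if j = l then 1 else 0) * (x j * x l))"
    using assms unfolding orthogonal_mat_def by (intro sum.cong refl) auto
  also have "\<dots> = (\<Sum>j<n. x j * x j)"
    by (intro sum.cong refl) (simp add: if_distrib[of "\<lambda>t. t * _"] cong: if_cong)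
  finally show ?thesis by (simp add: sqnorm_def power2_eq_square)
qed

lemma mat_app_vec:
  assumes "orthogonal_mat n A" "x \<in> space (Leb n)" "y \<in> space (Leb n)"
  shows "mat_app n A (vec_diff n x (mat_app n (\<lambda>i j. A j i) y)) = vec_diff n (mat_app n A x) y"
proof -
  have "mat_app n A (vec_diff n x (mat_app n (\<lambda>i j. A j i) y)) =
      vec_diff n (mat_app n A x) (mat_app n A (mat_app n (\<lambda>i j. A j i) y))"
    by (auto simp: fun_eq_iff vec_diff_def mat_app_def[of n A] right_diff_distrib sum_subtractf)
  then show ?thesis using mat_app_transpose_mat_app[OF assms(1,3)] by simp
qed

lemma mat_app_in_space: "mat_app n A x \<in> space (Leb n)"
  by (simp add: space_Leb mat_app_def)

lemma mat_app_in_punctured_ball: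
  assumes "orthogonal_mat n A"
  shows "mat_app n A x \<in> punctured_ball n \<longleftrightarrow> sqnorm n x > 0 \<and> sqnorm n x \<le> 1"
  using mat_app_in_space[of n A x]
  by (simp add: punctured_ball_def sqnorm_mat_app[OF assms] space_Leb)

theorem Leb_orthogonal_invariant:
  assumes A: "orthogonal_mat n A"
  shows "distr (Leb n) (Leb n) (mat_app n A) = Leb n"
proof (cases "n = 0")
  case True
  have "mat_app n A x = x" if "x \<in> space (Leb n)" for x
    using that True by (auto simp: space_Leb mat_app_def)
  then have "distr (Leb n) (Leb n) (mat_app n A) = distr (Leb n) (Leb n) (\<lambda>x. x)"
    by (intro distr_cong) auto
  then show ?thesis by simp
next
  case False
  define P where "P = punctured_ball n"
  have [measurable]: "P \<in> sets (Leb n)" by (simp add: P_def)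
  interpret L: sigma_finite_measure "Leb n" by (rule sigma_finite_Leb)
  interpret LL: pair_sigma_finite "Leb n" "Leb n" ..
  define T where "T = mat_app n A"
  define T' where "T' = mat_app n (\<lambda>i j. A j i)"
  have [measurable]: "T \<in> Leb n \<rightarrow>\<^sub>M Leb n" "T' \<in> Leb n \<rightarrow>\<^sub>M Leb n" by (auto simp: T_def T'_def)
  define c where "c = emeasure (Leb n) P"
  have c: "c \<noteq> 0" "c \<noteq> \<infinity>"
    using emeasure_punctured_ball_pos[of n] emeasure_punctured_ball_finite[of n] False
    by (auto simp: c_def P_def)
  let ?g = "indicator P :: _ \<Rightarrow> ennreal"
  have gT: "?g (T x) = ?g x" if "x \<in> space (Leb n)" for x
    using that mat_app_in_punctured_ball[OF A, of x]
    by (auto simp: T_def P_def indicator_def punctured_ball_def space_Leb)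
  have main: "(\<integral>\<^sup>+x. h (T x) \<partial>Leb n) = integral\<^sup>N (Leb n) h"
    if [measurable]: "h \<in> borel_measurable (Leb n)" for h :: "_ \<Rightarrow> ennreal"
  proof -
    have "integral\<^sup>N (Leb n) h * c = (\<integral>\<^sup>+x. ?g (T x) * integral\<^sup>N (Leb n) h \<partial>Leb n)"
    proof -
      have "(\<integral>\<^sup>+x. ?g (T x) * integral\<^sup>N (Leb n) h \<partial>Leb n) = (\<integral>\<^sup>+x. ?g x * integral\<^sup>N (Leb n) h \<partial>Leb n)"
        by (intro nn_integral_cong) (simp add: gT)
      also have "\<dots> = c * integral\<^sup>N (Leb n) h"
        by (subst nn_integral_multc) (auto simp: c_def)
      finally show ?thesis by (simp add: mult.commute)
    qed
    also have "\<dots> = (\<integral>\<^sup>+x. \<integral>\<^sup>+y. ?g (T x) * h (vec_add n (T x) y) \<partial>Leb n \<partial>Leb n)"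
    proof (rule nn_integral_cong)
      fix x assume x: "x \<in> space (Leb n)"
      have Tx: "T x \<in> space (Leb n)" by (simp add: T_def mat_app_in_space)
      have [measurable]: "(\<lambda>y. T x) \<in> Leb n \<rightarrow>\<^sub>M Leb n" using Tx by simp
      show "?g (T x) * integral\<^sup>N (Leb n) h = (\<integral>\<^sup>+y. ?g (T x) * h (vec_add n (T x) y) \<partial>Leb n)"
        by (subst nn_integral_cmult) (auto simp: nn_integral_Leb_vec)
    qed
    also have "\<dots> = (\<integral>\<^sup>+y. \<integral>\<^sup>+x. ?g (T x) * h (vec_add n (T x) y) \<partial>Leb n \<partial>Leb n)"
      by (rule LL.Fubini') measurable
    also have "\<dots> = (\<integral>\<^sup>+y. \<integral>\<^sup>+x. ?g (vec_diff n (T x) y) * h (T x) \<partial>Leb n \<partial>Leb n)"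
    proof (rule nn_integral_cong)
      fix y assume y: "y \<in> space (Leb n)"
      have [measurable]: "(\<lambda>x. y) \<in> Leb n \<rightarrow>\<^sub>M Leb n" using y by simp
      have "(\<integral>\<^sup>+x. ?g (T x) * h (vec_add n (T x) y) \<partial>Leb n)
          = (\<integral>\<^sup>+x. ?g (T (vec_diff n x (T' y))) * h (vec_add n (T (vec_diff n x (T' y))) y) \<partial>Leb n)"
        by (subst nn_integral_Leb_vec(3)[where h = "\<lambda>x. ?g (T x) * h (vec_add n (T x) y)"]) auto
      also have "\<dots> = (\<integral>\<^sup>+x. ?g (vec_diff n (T x) y) * h (T x) \<partial>Leb n)"
      proof (rule nn_integral_cong)
        fix x assume x: "x \<in> space (Leb n)"
        have 1: "T (vec_diff n x (T' y)) = vec_diff n (T x) y"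
          unfolding T_def T'_def by (rule mat_app_vec[OF A x y])
        have 2: "vec_add n (vec_diff n (T x) y) y = T x"
          by (auto simp: fun_eq_iff vec_add_def vec_diff_def T_def mat_app_def)
        show "?g (T (vec_diff n x (T' y))) * h (vec_add n (T (vec_diff n x (T' y))) y)
          = ?g (vec_diff n (T x) y) * h (T x)" by (simp add: 1 2)
      qed
      finally show "(\<integral>\<^sup>+x. ?g (T x) * h (vec_add n (T x) y) \<partial>Leb n)
        = (\<integral>\<^sup>+x. ?g (vec_diff n (T x) y) * h (T x) \<partial>Leb n)" .
    qed
    also have "\<dots> = (\<integral>\<^sup>+x. \<integral>\<^sup>+y. ?g (vec_diff n (T x) y) * h (T x) \<partial>Leb n \<partial>Leb n)"
      by (rule LL.Fubini'[symmetric]) measurable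
    also have "\<dots> = (\<integral>\<^sup>+x. c * h (T x) \<partial>Leb n)"
    proof (rule nn_integral_cong)
      fix x assume x: "x \<in> space (Leb n)"
      have Tx: "T x \<in> space (Leb n)" by (simp add: T_def mat_app_in_space)
      have [measurable]: "(\<lambda>y. T x) \<in> Leb n \<rightarrow>\<^sub>M Leb n" using Tx by simp
      show "(\<integral>\<^sup>+y. ?g (vec_diff n (T x) y) * h (T x) \<partial>Leb n) = c * h (T x)"
        by (subst nn_integral_multc)
          (auto simp: nn_integral_Leb_vec(2)[where h = ?g] c_def)
    qed
    also have "\<dots> = c * (\<integral>\<^sup>+x. h (T x) \<partial>Leb n)"
      by (rule nn_integral_cmult) measurable
    finally show ?thesis
      using c by (simp add: mult.commute[of _ c] ennreal_mult_cancel_left)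
  qed
  show ?thesis
  proof (rule measure_eqI)
    fix B assume "B \<in> sets (distr (Leb n) (Leb n) (mat_app n A))"
    then have [measurable]: "B \<in> sets (Leb n)" by simp
    have "emeasure (distr (Leb n) (Leb n) (mat_app n A)) B = (\<integral>\<^sup>+x. indicator B (T x) \<partial>Leb n)"
      using nn_integral_distr[OF mat_app_measurable, of "indicator B" n A] by (simp add: T_def)
    also have "\<dots> = emeasure (Leb n) B" by (subst main) auto
    finally show "emeasure (distr (Leb n) (Leb n) (mat_app n A)) B = emeasure (Leb n) B" .
  qed simp
qed

lemma normalize_vec_mat_app:
  assumes "orthogonal_mat n A"
  shows "normalize_vec n (mat_app n A x) = mat_app n A (normalize_vec n x)"
  unfolding normalize_vec_def sqnorm_mat_app[OF assms]
  by (simp add: fun_eq_iff mat_app_def sum_divide_distrib)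

theorem sphere_measure_orthogonal_invariant:
  assumes A: "orthogonal_mat n A"
  shows "distr (sphere_measure n) (sphere_measure n) (mat_app n A) = sphere_measure n"
proof -
  let ?S = "restrict_space (Leb n) (unit_sphere n)"
  let ?P = "punctured_ball n"
  let ?T = "mat_app n A"
  have PS: "?P \<subseteq> space (Leb n)" using sets.sets_into_space[OF sets_punctured_ball] .
  have T_ball: "?T \<in> unif_ball n \<rightarrow>\<^sub>M unif_ball n"
  proof (rule measurable_restrict_space2)
    show "?T \<in> space (unif_ball n) \<rightarrow> ?P"
      unfolding space_unif_ball using mat_app_in_punctured_ball[OF A] by (auto simp: punctured_ball_def)
    show "?T \<in> unif_ball n \<rightarrow>\<^sub>M uniform_measure (Leb n) ?P"
      by (intro measurable_restrict_space1) (simp cong: measurable_cong_sets)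
  qed
  have T_sphere: "?T \<in> ?S \<rightarrow>\<^sub>M ?S"
  proof (rule measurable_restrict_space2)
    show "?T \<in> space ?S \<rightarrow> unit_sphere n"
      using mat_app_in_space[of n A]
      by (auto simp: space_restrict_space unit_sphere_def sqnorm_mat_app[OF A] space_Leb)
    show "?T \<in> ?S \<rightarrow>\<^sub>M Leb n"
      by (intro measurable_restrict_space1) simp
  qed
  have inv_ball: "distr (unif_ball n) (unif_ball n) ?T = unif_ball n"
  proof (rule measure_eqI)
    fix B assume "B \<in> sets (distr (unif_ball n) (unif_ball n) ?T)"
    then have "B \<in> sets (unif_ball n)" by simp
    then have B: "B \<in> sets (Leb n)" "B \<subseteq> ?P"
      using sets_restrict_space_iff[of ?P "uniform_measure (Leb n) ?P" B] PS
      by (auto simp: Int_absorb2)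
    have pre: "?T -` B \<inter> space (Leb n) \<in> sets (Leb n)"
      using B(1) by (rule measurable_sets[OF mat_app_measurable])
    have sub: "?T -` B \<inter> space (Leb n) \<subseteq> ?P"
      using B(2) mat_app_in_punctured_ball[OF A]
      by (auto simp: punctured_ball_def[of n] sqnorm_mat_app[OF A] space_Leb)
    have eq: "?T -` B \<inter> ?P = ?T -` B \<inter> space (Leb n)" using sub PS by blast
    have em: "emeasure (unif_ball n) C = emeasure (Leb n) C / emeasure (Leb n) ?P"
      if "C \<in> sets (Leb n)" "C \<subseteq> ?P" for C
      using that PS by (simp add: emeasure_restrict_space Int_absorb1 Int_absorb2)
    have "emeasure (distr (unif_ball n) (unif_ball n) ?T) B = emeasure (unif_ball n) (?T -` B \<inter> ?P)"
      using T_ball \<open>B \<in> sets (unif_ball n)\<close> by (simp add: emeasure_distr space_unif_ball)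
    also have "\<dots> = emeasure (Leb n) (?T -` B \<inter> space (Leb n)) / emeasure (Leb n) ?P"
      unfolding eq by (rule em[OF pre sub])
    also have "emeasure (Leb n) (?T -` B \<inter> space (Leb n)) = emeasure (distr (Leb n) (Leb n) ?T) B"
      using B(1) by (simp add: emeasure_distr)
    also have "\<dots> = emeasure (Leb n) B" by (simp add: Leb_orthogonal_invariant[OF A])
    also have "emeasure (Leb n) B / emeasure (Leb n) ?P = emeasure (unif_ball n) B"
      by (rule em[OF B, symmetric])
    finally show "emeasure (distr (unif_ball n) (unif_ball n) ?T) B = emeasure (unif_ball n) B" .
  qed simp
  have "distr (sphere_measure n) (sphere_measure n) ?T = distr (distr (unif_ball n) ?S (normalize_vec n)) ?S ?T"
    unfolding sphere_measure_alt by (rule distr_cong) auto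
  also have "\<dots> = distr (unif_ball n) ?S (?T \<circ> normalize_vec n)"
    by (rule distr_distr[OF T_sphere normalize_vec_measurable])
  also have "?T \<circ> normalize_vec n = normalize_vec n \<circ> ?T"
    by (simp add: fun_eq_iff normalize_vec_mat_app[OF A])
  also have "distr (unif_ball n) ?S (normalize_vec n \<circ> ?T) =
      distr (distr (unif_ball n) (unif_ball n) ?T) ?S (normalize_vec n)"
    by (rule distr_distr[OF normalize_vec_measurable T_ball, symmetric])
  also have "\<dots> = sphere_measure n" by (simp add: inv_ball sphere_measure_alt)
  finally show ?thesis .
qed

end

theory Submission
  imports Defs "HOL-Computational_Algebra.Polynomial"
begin

text \<open>
  Write \<open>K\<close> for \<open>Lf_tilde n k\<close>. A translate of \<open>K\<close> is the convex hull of the powers \<open>l\<^sup>2\<^sup>k\<close>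
  of linear forms, normalised to have mean one on the sphere.

  Upper bound: these powers have bounded norm, so by Maurey's lemma every point of \<open>K\<close> is within
  \<open>O(1 / sqrt m)\<close> of an average of \<open>m\<close> of them, and \<open>n\<^sup>O\<^sup>(\<^sup>n\<^sup>)\<close> linear forms suffice up to a small
  error. Hence \<open>K\<close> is covered by \<open>exp (O(m n ln n))\<close> balls of radius \<open>O(1 / sqrt m)\<close>; since the
  dimension is of order \<open>n\<^sup>2\<^sup>k\<close>, take \<open>m\<close> slightly below \<open>n\<^sup>2\<^sup>k\<^sup>-\<^sup>1\<close>.

  Lower bound: \<open>K - K\<close> contains a ball of radius of order \<open>n\<^sup>-\<^sup>k\<^sup>+\<^sup>1\<^sup>/\<^sup>2\<close>. Collecting the monomials of a
  form \<open>f\<close> after removing one variable gives \<open>f = (\<Sum>b. l\<^sub>b b)\<close> with at most \<open>n\<^sup>2\<^sup>k\<^sup>-\<^sup>1\<close> monomials \<open>b\<close> of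
  degree \<open>2k - 1\<close> and linear forms \<open>l\<^sub>b\<close>. By polarisation \<open>l\<^sub>b b\<close> is a difference of two elements of
  the cone with mean \<open>O(n\<^sup>-\<^sup>k \<bar>l\<^sub>b\<bar>)\<close>, and the coefficients of \<open>f\<close> are controlled by its norm through
  Bessel's inequality for Hermite polynomials and the comparison of the sphere with the Gaussian
  measure. Finally the volume of a convex body is at least \<open>4\<^sup>-\<^sup>D\<close> times that of its difference body.
\<close>

section \<open>Polynomials and their evaluation\<close>

text \<open>Removing only one variable is what produces the summand 1/2 in the exponent. Treating f
  monomial by monomial would cost about sqrt(n^(2k)) times its norm; since a whole linear factor is
  as cheap as a single variable of the same norm, only n^(2k-1) groups enter the Cauchy-Schwarz
  inequality. The n^k by which coefficients can exceed the sphere norm cancels the n^(-k) that every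
  power gains. The argument presents f as a difference of two points of K, never as a point of K,
  hence the detour through the difference body; its price is a constant after the D-th root.

  In the upper bound the loss of \<epsilon> pays for the factor ln n in the logarithm of the number
  of balls.

  Sphere moments are not computed: Gaussian moments are bounded above by exponential moments and
  below by tangent lines, which is enough because constants may depend on k.

  K is not shown to be Borel. For the lower bound it is squeezed between two measurable sets of
  equal volume; for the upper bound a non-measurable set has \<open>measure\<close> 0.\<close>

abbreviation (input) keys where "keys \<equiv> Poly_Mapping.keys"
abbreviation (input) lookup where "lookup \<equiv> Poly_Mapping.lookup"
abbreviation (input) single where "single \<equiv> Poly_Mapping.single"

definition mon :: "(nat \<Rightarrow>\<^sub>0 nat) \<Rightarrow> (nat \<Rightarrow> real) \<Rightarrow> real" where
  "mon a x = (\<Prod>i\<in>keys a. x i ^ lookup a i)"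

definition mdeg :: "(nat \<Rightarrow>\<^sub>0 nat) \<Rightarrow> nat" where
  "mdeg a = (\<Sum>i\<in>keys a. lookup a i)"

lemma mon_superset:
  assumes "finite A" "keys a \<subseteq> A"
  shows "mon a x = (\<Prod>i\<in>A. x i ^ lookup a i)"
  unfolding mon_def using assms by (intro prod.mono_neutral_left) (auto simp: in_keys_iff)

lemma mdeg_superset:
  assumes "finite A" "keys a \<subseteq> A"
  shows "mdeg a = (\<Sum>i\<in>A. lookup a i)"
  unfolding mdeg_def using assms by (intro sum.mono_neutral_left) (auto simp: in_keys_iff)

lemma keys_add_nat: "keys (a + b) = keys a \<union> keys (b :: 'a \<Rightarrow>\<^sub>0 nat)"
  by (auto simp: in_keys_iff lookup_add)

lemma mon_add: "mon (a + b) x = mon a x * mon b x"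
proof -
  let ?A = "keys a \<union> keys b"
  show ?thesis
    using mon_superset[of ?A "a + b" x] mon_superset[of ?A a x] mon_superset[of ?A b x]
    by (simp add: keys_add_nat lookup_add power_add prod.distrib)
qed

lemma mdeg_add: "mdeg (a + b) = mdeg a + mdeg b"
proof -
  let ?A = "keys a \<union> keys b"
  show ?thesis
    using mdeg_superset[of ?A "a + b"] mdeg_superset[of ?A a] mdeg_superset[of ?A b]
    by (simp add: keys_add_nat lookup_add sum.distrib)
qed

lemma mon_zero [simp]: "mon 0 x = 1" and mdeg_zero [simp]: "mdeg 0 = 0"
  by (simp_all add: mon_def mdeg_def)

lemma mon_single: "mon (single i m) x = x i ^ m"
  by (simp add: mon_def)

lemma mdeg_single: "mdeg (single i m) = m"
  by (simp add: mdeg_def)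

lemma mdeg_sum: "finite A \<Longrightarrow> mdeg (\<Sum>i\<in>A. f i) = (\<Sum>i\<in>A. mdeg (f i))"
  by (induction A rule: finite_induct) (auto simp: mdeg_add)

lemma poly_eval_alt: "poly_eval f x = (\<Sum>a\<in>keys f. lookup f a * mon a x)"
  by (simp add: poly_eval_def mon_def)

lemma poly_eval_superset:
  assumes "finite A" "keys f \<subseteq> A"
  shows "poly_eval f x = (\<Sum>a\<in>A. lookup f a * mon a x)"
  unfolding poly_eval_alt using assms by (intro sum.mono_neutral_left) (auto simp: in_keys_iff)

lemma lookup_scaleR: "lookup (c *\<^sub>R f) a = c * lookup (f :: 'a \<Rightarrow>\<^sub>0 real) a"
proof -
  have "finite {i. c * lookup f i \<noteq> 0}"
    by (rule finite_subset[OF _ finite_lookup[of f]]) auto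
  then show ?thesis by (simp add: scaleR_poly_mapping_def)
qed

lemma keys_scaleR: "keys (c *\<^sub>R f) \<subseteq> keys (f :: 'a \<Rightarrow>\<^sub>0 real)"
  by (auto simp: in_keys_iff lookup_scaleR)

lemma poly_eval_zero [simp]: "poly_eval 0 x = 0"
  by (simp add: poly_eval_def)

lemma poly_eval_add: "poly_eval (f + g) x = poly_eval f x + poly_eval g x"
proof -
  let ?A = "keys f \<union> keys g"
  have "poly_eval (f + g) x = (\<Sum>a\<in>?A. lookup (f + g) a * mon a x)"
    by (rule poly_eval_superset) (auto intro!: keys_add)
  then show ?thesis
    using poly_eval_superset[of ?A f x] poly_eval_superset[of ?A g x]
    by (simp add: lookup_add sum.distrib distrib_right)
qed

lemma poly_eval_scaleR: "poly_eval (c *\<^sub>R f) x = c * poly_eval f x"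
  using poly_eval_superset[OF _ keys_scaleR, of f c x]
  by (simp add: poly_eval_alt lookup_scaleR sum_distrib_left mult.assoc)

lemma poly_eval_diff: "poly_eval (f - g) x = poly_eval f x - poly_eval g x"
  using poly_eval_add[of "f - g" g x] by simp

lemma poly_eval_sum: "poly_eval (\<Sum>i\<in>A. f i) x = (\<Sum>i\<in>A. poly_eval (f i) x)"
  by (induction A rule: infinite_finite_induct) (auto simp: poly_eval_add)

lemma poly_eval_single: "poly_eval (single a c) x = c * mon a x"
  by (cases "c = 0") (simp_all add: poly_eval_alt)

lemma poly_eval_one [simp]: "poly_eval 1 x = 1"
  using poly_eval_single[of 0 1 x] by simp

lemma poly_sum_singles: "(\<Sum>a\<in>keys f. single a (lookup f a)) = f"
  by (rule poly_mapping_eqI) (auto simp: lookup_sum lookup_single when_def in_keys_iff)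

text \<open>Expanding both factors into \<open>single\<close> terms turns the convolution product
  into a double sum, so supports, degrees and evaluation of products reduce to those of
  monomials.\<close>

lemma mult_as_sum:
  fixes f g :: rpoly
  shows "f * g = (\<Sum>a\<in>keys f. \<Sum>b\<in>keys g.
    single (a + b) (lookup f a * lookup g b))"
proof -
  have "f * g = (\<Sum>a\<in>keys f. single a (lookup f a)) *
      (\<Sum>b\<in>keys g. single b (lookup g b))"
    by (simp add: poly_sum_singles)
  then show ?thesis by (simp add: sum_product mult_single)
qed

lemma poly_eval_mult: "poly_eval (f * g) x = poly_eval f x * poly_eval g x"
  by (simp add: mult_as_sum poly_eval_sum poly_eval_single mon_add)
    (simp add: poly_eval_alt sum_product mult_ac)

lemma poly_eval_power: "poly_eval (f ^ m) x = poly_eval f x ^ m"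
  by (induction m) (simp_all add: poly_eval_mult)

text \<open>With scaling seen as multiplication by a constant polynomial, its compatibility with
  products is commutativity and associativity of the ring.\<close>

lemma scaleR_rpoly_eq: "c *\<^sub>R (f :: rpoly) = single 0 c * f"
proof -
  have "single 0 c * f = (\<Sum>b\<in>keys f. single b (c * lookup f b))"
    by (cases "c = 0", simp, subst mult_as_sum, simp)
  also have "\<dots> = c *\<^sub>R f"
    by (rule poly_mapping_eqI) (auto simp: lookup_sum lookup_single when_def in_keys_iff lookup_scaleR)
  finally show ?thesis by simp
qed

lemma scaleR_mult_left: "(c *\<^sub>R f) * g = c *\<^sub>R (f * (g :: rpoly))"
  and scaleR_mult_right: "f * (c *\<^sub>R g) = c *\<^sub>R (f * (g :: rpoly))"
  by (simp_all add: scaleR_rpoly_eq mult_ac)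

lemma scaleR_power: "(c *\<^sub>R f) ^ m = c ^ m *\<^sub>R ((f :: rpoly) ^ m)"
  by (induction m) (simp_all add: scaleR_mult_left scaleR_mult_right)

section \<open>Forms\<close>

lemma forms_iff: "f \<in> forms n m \<longleftrightarrow> (\<forall>a\<in>keys f. keys a \<subseteq> {..<n} \<and> mdeg a = m)"
  by (simp add: forms_def mdeg_def)

lemma zero_in_forms [simp]: "0 \<in> forms n m"
  by (simp add: forms_iff)

lemma forms_add: "f \<in> forms n m \<Longrightarrow> g \<in> forms n m \<Longrightarrow> f + g \<in> forms n m"
  using keys_add[of f g] by (auto simp: forms_iff)

lemma forms_scaleR: "f \<in> forms n m \<Longrightarrow> c *\<^sub>R f \<in> forms n m"
  using keys_scaleR[of c f] by (auto simp: forms_iff)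

lemma subspace_forms: "subspace (forms n m)"
  by (simp add: subspace_def forms_add forms_scaleR)

lemmas forms_diff = subspace_diff[OF subspace_forms]
lemmas forms_sum = subspace_sum[OF subspace_forms]

lemma forms_single:
  "keys a \<subseteq> {..<n} \<Longrightarrow> mdeg a = m \<Longrightarrow> single a c \<in> forms n m"
  by (cases "c = 0") (auto simp: forms_iff)

lemma forms_mult: "f \<in> forms n m \<Longrightarrow> g \<in> forms n p \<Longrightarrow> f * g \<in> forms n (m + p)"
  unfolding mult_as_sum
  by (intro forms_sum forms_single) (auto simp: forms_iff keys_add_nat mdeg_add)

lemma forms_one: "1 \<in> forms n 0"
  using forms_single[of 0 n 0 1] by simp

lemma forms_power: "f \<in> forms n m \<Longrightarrow> f ^ p \<in> forms n (p * m)"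
  by (induction p) (auto simp: forms_one intro: forms_mult)

lemma forms_prod:
  "finite A \<Longrightarrow> (\<And>i. i \<in> A \<Longrightarrow> f i \<in> forms n (d i)) \<Longrightarrow> (\<Prod>i\<in>A. f i) \<in> forms n (\<Sum>i\<in>A. d i)"
  by (induction A rule: finite_induct) (auto simp: forms_one intro: forms_mult)

lemma forms_poly_var: "i < n \<Longrightarrow> poly_var i \<in> forms n 1"
  unfolding poly_var_def by (intro forms_single) (auto simp: mdeg_single)

lemma poly_eval_poly_var: "poly_eval (poly_var i) x = x i"
  by (simp add: poly_var_def poly_eval_single mon_single)

lemma mon_scale: "mon a (\<lambda>i. t * x i) = t ^ mdeg a * mon a x"
  by (simp add: mon_def mdeg_def power_mult_distrib prod.distrib power_sum)

lemma poly_eval_homogeneous: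
  "f \<in> forms n m \<Longrightarrow> poly_eval f (\<lambda>i. t * x i) = t ^ m * poly_eval f x"
  by (simp add: poly_eval_alt forms_iff mon_scale sum_distrib_left mult_ac)

lemma poly_eval_cong:
  assumes "f \<in> forms n m" "\<And>i. i < n \<Longrightarrow> x i = y i"
  shows "poly_eval f x = poly_eval f y"
proof -
  have "mon a x = mon a y" if "a \<in> keys f" for a
    using that assms unfolding mon_def forms_iff by (intro prod.cong) (auto simp: subset_iff)
  then show ?thesis by (simp add: poly_eval_alt)
qed

section \<open>Linear forms and the cone generated by their powers\<close>

definition lin :: "nat \<Rightarrow> (nat \<Rightarrow> real) \<Rightarrow> rpoly" where
  "lin n u = (\<Sum>i<n. u i *\<^sub>R poly_var i)"

lemma lin_in_forms: "lin n u \<in> forms n 1"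
  unfolding lin_def by (intro forms_sum forms_scaleR forms_poly_var) auto

lemma lin_power_in_forms: "lin n u ^ m \<in> forms n m"
  using forms_power[OF lin_in_forms, of n u m] by simp

lemma poly_eval_lin: "poly_eval (lin n u) x = (\<Sum>i<n. u i * x i)"
  by (simp add: lin_def poly_eval_sum poly_eval_scaleR poly_eval_poly_var)

lemma lin_scale: "lin n (\<lambda>i. c * u i) = c *\<^sub>R lin n u"
  by (simp add: lin_def scaleR_sum_right)

lemma single_nat_eq_iff: "single i (Suc 0) = single j (Suc 0) \<longleftrightarrow> i = j"
  by (metis lookup_single_eq lookup_single_not_eq nat.distinct(1))

lemma lookup_lin: "lookup (lin n u) (single i 1) = (if i < n then u i else 0)"
proof -
  have "lookup (lin n u) (single i 1) = (\<Sum>j<n. if j = i then u j else 0)"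
    unfolding lin_def lookup_sum lookup_scaleR
    by (intro sum.cong) (auto simp: poly_var_def lookup_single when_def single_nat_eq_iff)
  then show ?thesis by simp
qed

lemma mdeg_1D: "mdeg a = 1 \<Longrightarrow> \<exists>i. a = single i 1"
proof -
  assume a: "mdeg a = 1"
  then obtain i where i: "i \<in> keys a" by (fastforce simp: mdeg_def)
  have "mdeg a = lookup a i + (\<Sum>j\<in>keys a - {i}. lookup a j)"
    unfolding mdeg_def by (intro sum.remove) (auto simp: i)
  with a i have l: "lookup a i = 1" "(\<Sum>j\<in>keys a - {i}. lookup a j) = 0"
    by (auto simp: in_keys_iff simp del: sum_eq_0_iff)
  have "lookup a j = 0" if "j \<noteq> i" for j
    using l(2) that by (cases "j \<in> keys a") (auto simp: in_keys_iff dest: spec[of _ j])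
  with l(1) have "a = single i 1"
    by (intro poly_mapping_eqI) (auto simp: lookup_single when_def)
  then show ?thesis by blast
qed

text \<open>This lets elements of the cone be handled through coefficient vectors instead of
  abstract linear forms.\<close>

lemma forms_1_eq_lin:
  assumes "f \<in> forms n 1"
  shows "f = lin n (\<lambda>i. lookup f (single i 1))"
proof (rule poly_mapping_eqI)
  fix a
  let ?g = "lin n (\<lambda>i. lookup f (single i 1))"
  consider i where "a = single i 1" | "mdeg a \<noteq> 1"
    using mdeg_1D by blast
  then show "lookup f a = lookup ?g a"
  proof cases
    case 1
    have "lookup f a = 0" if "\<not> i < n"
    proof (rule ccontr)
      assume "lookup f a \<noteq> 0"
      then have "keys a \<subseteq> {..<n}" using assms by (simp add: forms_iff in_keys_iff)
      then show False using 1 that by simp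
    qed
    then show ?thesis using 1 lookup_lin[of n _ i] by simp
  next
    case 2
    have "lookup g a = 0" if "g \<in> forms n 1" for g
      using that 2 by (auto simp: forms_iff in_keys_iff)
    then show ?thesis using assms lin_in_forms by simp
  qed
qed

lemma Lf_zero: "0 \<in> Lf n k"
  unfolding Lf_def by (auto intro!: exI[of _ "[]"])

lemma Lf_add: "f \<in> Lf n k \<Longrightarrow> g \<in> Lf n k \<Longrightarrow> f + g \<in> Lf n k"
proof -
  assume "f \<in> Lf n k" "g \<in> Lf n k"
  then obtain l1 l2 where "set l1 \<subseteq> forms n 1" "f = (\<Sum>l\<leftarrow>l1. l ^ (2 * k))" "f \<in> forms n (2 * k)"
    "set l2 \<subseteq> forms n 1" "g = (\<Sum>l\<leftarrow>l2. l ^ (2 * k))" "g \<in> forms n (2 * k)"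
    unfolding Lf_def by auto
  then show ?thesis
    unfolding Lf_def by (auto simp: forms_add intro!: exI[of _ "l1 @ l2"])
qed

lemma Lf_sum: "(\<And>i. i \<in> A \<Longrightarrow> f i \<in> Lf n k) \<Longrightarrow> (\<Sum>i\<in>A. f i) \<in> Lf n k"
  by (induction A rule: infinite_finite_induct) (auto simp: Lf_zero Lf_add)

lemma Lf_subset_forms: "f \<in> Lf n k \<Longrightarrow> f \<in> forms n (2 * k)"
  by (simp add: Lf_def)

lemma Lf_lin_power: "lin n u ^ (2 * k) \<in> Lf n k"
  using lin_in_forms[of n u] lin_power_in_forms[of n u "2 * k"]
  unfolding Lf_def by (auto intro!: exI[of _ "[lin n u]"])

text \<open>The factor is absorbed into the linear form through its 2k-th root; closure of the cone
  under nonnegative scaling rests on this.\<close>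

lemma Lf_scale_lin_power:
  assumes "c \<ge> 0" "k \<ge> 1"
  shows "c *\<^sub>R lin n u ^ (2 * k) \<in> Lf n k"
proof -
  have "c *\<^sub>R lin n u ^ (2 * k) = lin n (\<lambda>i. root (2 * k) c * u i) ^ (2 * k)"
    using assms by (simp add: lin_scale scaleR_power)
  then show ?thesis by (simp only: Lf_lin_power)
qed

lemma Lf_decomp:
  assumes "f \<in> Lf n k"
  obtains N u where "f = (\<Sum>j<(N::nat). lin n (u j) ^ (2 * k))"
proof -
  from assms obtain ls where ls: "set ls \<subseteq> forms n 1" "f = (\<Sum>l\<leftarrow>ls. l ^ (2 * k))"
    unfolding Lf_def by auto
  define u where "u = (\<lambda>j i. lookup (ls ! j) (single i 1))"
  have u: "lin n (u j) = ls ! j" if "j < length ls" for j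
    using forms_1_eq_lin[of "ls ! j" n] ls(1) that by (simp add: u_def subset_iff)
  have "f = (\<Sum>j<length ls. (ls ! j) ^ (2 * k))"
    using ls(2) by (simp add: sum_list_sum_nth atLeast0LessThan)
  also have "\<dots> = (\<Sum>j<length ls. lin n (u j) ^ (2 * k))"
    by (intro sum.cong) (auto simp: u)
  finally show ?thesis using that by blast
qed

lemma Lf_scaleR:
  assumes "f \<in> Lf n k" "c \<ge> 0" "k \<ge> 1"
  shows "c *\<^sub>R f \<in> Lf n k"
proof -
  obtain N u where "f = (\<Sum>j<(N::nat). lin n (u j) ^ (2 * k))" using Lf_decomp[OF assms(1)] .
  then show ?thesis using assms(2,3) by (auto simp: scaleR_sum_right intro!: Lf_sum Lf_scale_lin_power)
qed

lemma r_pow_in_forms: "r_pow n k \<in> forms n (2 * k)"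
proof -
  have "(\<Sum>i<n. (poly_var i)\<^sup>2) \<in> forms n 2"
    using forms_power[OF forms_poly_var, of _ n 2] by (intro forms_sum) auto
  then show ?thesis unfolding r_pow_def using forms_power[of _ n 2 k] by (simp add: mult.commute)
qed

lemma poly_eval_r_pow: "poly_eval (r_pow n k) x = sqnorm n x ^ k"
  by (simp add: r_pow_def poly_eval_power poly_eval_sum poly_eval_poly_var sqnorm_def)

section \<open>Lebesgue measure and convex sets in coordinate space\<close>

definition aff :: "nat \<Rightarrow> real \<Rightarrow> (nat \<Rightarrow> real) \<Rightarrow> (nat \<Rightarrow> real) \<Rightarrow> nat \<Rightarrow> real" where
  "aff n t v x = (\<lambda>i\<in>{..<n}. v i + t * x i)"

lemma aff_measurable [measurable]: "aff n t v \<in> Leb n \<rightarrow>\<^sub>M Leb n"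
  unfolding aff_def[abs_def]
  by (intro restrict_measurable_Leb borel_measurable_add borel_measurable_times
        borel_measurable_const component_measurable_Leb) auto

lemma aff_in_space: "aff n t v x \<in> space (Leb n)"
  by (simp add: space_Leb aff_def)

text \<open>The one-dimensional change of variables in each coordinate gives equality on boxes, and
  boxes determine a product measure. As an identity of measures it serves volumes and integrals
  alike.\<close>

lemma Leb_eq_scale_distr_aff:
  assumes "t > 0"
  shows "Leb n = scale_measure (ennreal (t ^ n)) (distr (Leb n) (Leb n) (aff n t v))" (is "_ = ?M")
proof -
  interpret product_sigma_finite "\<lambda>_::nat. lborel :: real measure" by standard
  have "?M = Pi\<^sub>M {..<n} (\<lambda>_. lborel)"
  proof (rule PiM_eqI)
    fix A :: "nat \<Rightarrow> real set"
    assume A: "\<And>i. i \<in> {..<n} \<Longrightarrow> A i \<in> sets lborel"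
    have PA: "Pi\<^sub>E {..<n} A \<in> sets (Leb n)"
      unfolding Leb_def using A by (intro sets_PiM_I_finite) auto
    have pre: "(\<lambda>x. v i + t * x) -` A i \<in> sets borel" if "i < n" for i
    proof -
      have "(\<lambda>x. v i + t * x) -` A i \<inter> space borel \<in> sets borel"
        using A[of i] that by (intro measurable_sets[of _ borel borel]) auto
      then show ?thesis by simp
    qed
    have one: "emeasure lborel (A i) = ennreal t * emeasure lborel ((\<lambda>x. v i + t * x) -` A i)" if "i < n" for i
    proof -
      have "emeasure lborel (A i) = emeasure (density (distr lborel borel (\<lambda>x. v i + t * x)) (\<lambda>_. ennreal \<bar>t\<bar>)) (A i)"
        using lborel_real_affine[of t "v i"] assms by simp
      also have "\<dots> = ennreal t * emeasure lborel ((\<lambda>x. v i + t * x) -` A i)"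
        using A[of i] that assms pre[OF that]
        by (subst emeasure_density_const) (auto simp: emeasure_distr)
      finally show ?thesis .
    qed
    have "emeasure ?M (Pi\<^sub>E {..<n} A) = ennreal (t ^ n) * emeasure (Leb n) (aff n t v -` Pi\<^sub>E {..<n} A \<inter> space (Leb n))"
      using PA by (simp add: emeasure_distr)
    also have "aff n t v -` Pi\<^sub>E {..<n} A \<inter> space (Leb n) = Pi\<^sub>E {..<n} (\<lambda>i. (\<lambda>x. v i + t * x) -` A i)"
      by (auto simp: space_Leb PiE_iff aff_def)
    also have "ennreal (t ^ n) * emeasure (Leb n) (Pi\<^sub>E {..<n} (\<lambda>i. (\<lambda>x. v i + t * x) -` A i))
        = (\<Prod>i<n. ennreal t * emeasure lborel ((\<lambda>x. v i + t * x) -` A i))"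
      using pre assms by (subst emeasure_Leb_box) (auto simp: prod.distrib ennreal_power)
    also have "\<dots> = (\<Prod>i<n. emeasure lborel (A i))"
      by (intro prod.cong) (auto simp: one)
    finally show "emeasure ?M (Pi\<^sub>E {..<n} A) = (\<Prod>i\<in>{..<n}. emeasure lborel (A i))" .
  qed (auto simp: Leb_def)
  then show ?thesis by (simp add: Leb_def)
qed

lemma emeasure_Leb_aff:
  assumes "t > 0" "A \<in> sets (Leb n)"
  shows "emeasure (Leb n) A = ennreal (t ^ n) * emeasure (Leb n) {x \<in> space (Leb n). aff n t v x \<in> A}"
proof -
  have "emeasure (Leb n) A = emeasure (scale_measure (ennreal (t ^ n)) (distr (Leb n) (Leb n) (aff n t v))) A"
    using Leb_eq_scale_distr_aff[OF assms(1), of n v] by simp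
  also have "\<dots> = ennreal (t ^ n) * emeasure (Leb n) (aff n t v -` A \<inter> space (Leb n))"
    using assms(2) by (simp add: emeasure_distr)
  also have "aff n t v -` A \<inter> space (Leb n) = {x \<in> space (Leb n). aff n t v x \<in> A}" by auto
  finally show ?thesis .
qed

definition cball_Leb :: "nat \<Rightarrow> (nat \<Rightarrow> real) \<Rightarrow> real \<Rightarrow> (nat \<Rightarrow> real) set" where
  "cball_Leb n c r = {x \<in> {..<n} \<rightarrow>\<^sub>E UNIV. sqnorm n (\<lambda>i. x i - c i) \<le> r\<^sup>2}"

abbreviation "uball n \<equiv> cball_Leb n (\<lambda>_. 0) 1"

lemma sets_cball_Leb [measurable]: "cball_Leb n c r \<in> sets (Leb n)"
proof -
  have "(\<lambda>x. \<Sum>i<n. (x i - c i)\<^sup>2) \<in> borel_measurable (Leb n)"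
    by measurable
  then have "{x \<in> space (Leb n). (\<Sum>i<n. (x i - c i)\<^sup>2) \<le> r\<^sup>2} \<in> sets (Leb n)"
    by measurable
  then show ?thesis by (simp add: cball_Leb_def space_Leb sqnorm_def)
qed

lemma emeasure_cball_Leb:
  assumes "r > 0"
  shows "emeasure (Leb n) (cball_Leb n c r) = ennreal (r ^ n) * emeasure (Leb n) (uball n)"
proof -
  have "{x \<in> space (Leb n). aff n r c x \<in> cball_Leb n c r} = uball n"
    using assms aff_in_space[of n r c]
    by (auto simp: cball_Leb_def space_Leb aff_def sqnorm_def power_mult_distrib
        mult_le_cancel_left1 simp flip: sum_distrib_left)
  then show ?thesis using emeasure_Leb_aff[OF assms sets_cball_Leb, of n c r c] by simp
qed

lemma emeasure_uball_finite: "emeasure (Leb n) (uball n) < \<infinity>"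
proof -
  have "uball n \<subseteq> Pi\<^sub>E {..<n} (\<lambda>_. {-1..1})"
  proof
    fix x assume x: "x \<in> uball n"
    have "x i \<in> {-1..1}" if "i < n" for i
    proof -
      have "(x i)\<^sup>2 \<le> sqnorm n x"
        unfolding sqnorm_def using that by (intro member_le_sum) auto
      also have "\<dots> \<le> 1" using x by (simp add: cball_Leb_def)
      finally have "\<bar>x i\<bar> \<le> 1" by (simp add: abs_square_le_1)
      then show ?thesis by auto
    qed
    then show "x \<in> Pi\<^sub>E {..<n} (\<lambda>_. {-1..1})"
      using x by (auto simp: cball_Leb_def PiE_iff)
  qed
  moreover have "Pi\<^sub>E {..<n} (\<lambda>_. {-1..1::real}) \<in> sets (Leb n)"
    unfolding Leb_def by (intro sets_PiM_I_finite) auto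
  ultimately have "emeasure (Leb n) (uball n) \<le> emeasure (Leb n) (Pi\<^sub>E {..<n} (\<lambda>_. {-1..1}))"
    by (intro emeasure_mono)
  also have "\<dots> = (\<Prod>i<n. ennreal 2)" by (subst emeasure_Leb_box) auto
  also have "\<dots> < \<infinity>" by (simp add: ennreal_power power_less_top_ennreal)
  finally show ?thesis .
qed

lemma emeasure_uball_pos:
  assumes "n \<ge> 1"
  shows "0 < emeasure (Leb n) (uball n)"
proof -
  have "emeasure (Leb n) (punctured_ball n) \<le> emeasure (Leb n) (uball n)"
    by (intro emeasure_mono sets_cball_Leb) (auto simp: punctured_ball_def cball_Leb_def)
  with emeasure_punctured_ball_pos[OF assms] show ?thesis by (rule less_le_trans)
qed

text \<open>Points are extensional functions, \<open>undefined\<close> outside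
  \<open>{..<n}\<close>, so a convex combination has to be restricted again before it is a
  point.\<close>

definition cvx :: "nat \<Rightarrow> (nat \<Rightarrow> real) set \<Rightarrow> bool" where
  "cvx n X \<longleftrightarrow> X \<subseteq> space (Leb n) \<and>
    (\<forall>x\<in>X. \<forall>y\<in>X. \<forall>s. 0 \<le> s \<longrightarrow> s \<le> 1 \<longrightarrow> (\<lambda>i\<in>{..<n}. (1 - s) * x i + s * y i) \<in> X)"

lemma cvxD:
  assumes "cvx n X" "x \<in> X" "y \<in> X" "0 \<le> s" "s \<le> 1" "z \<in> space (Leb n)"
    "\<And>i. i < n \<Longrightarrow> z i = (1 - s) * x i + s * y i"
  shows "z \<in> X"
proof -
  have "z = (\<lambda>i\<in>{..<n}. (1 - s) * x i + s * y i)"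
    using assms(6,7) by (auto simp: space_Leb fun_eq_iff PiE_iff extensional_def)
  then show ?thesis using assms(1-5) by (simp add: cvx_def)
qed

text \<open>A weak form of the Rogers--Shephard inequality: if \<open>z = (a - b) / 2\<close> with \<open>a, b \<in> X\<close> then
  \<open>X \<inter> (X + z)\<close> contains \<open>(X + a) / 2\<close>; integrate the volume of this intersection over \<open>z\<close>.\<close>

lemma difference_body_volume:
  assumes X: "cvx n X" and AB: "A \<in> sets (Leb n)" "B \<in> sets (Leb n)" "A \<subseteq> X" "X \<subseteq> B"
    and eq: "emeasure (Leb n) A = emeasure (Leb n) B"
    and pos: "0 < emeasure (Leb n) A" and fin: "emeasure (Leb n) A < \<infinity>"
    and \<rho>: "\<rho> > 0"
    and diff: "\<And>z. z \<in> cball_Leb n (\<lambda>_. 0) \<rho> \<Longrightarrow> \<exists>a\<in>X. \<exists>b\<in>X. \<forall>i<n. z i = a i - b i"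
  shows "ennreal ((\<rho> / 4) ^ n) * emeasure (Leb n) (uball n) \<le> emeasure (Leb n) B"
proof -
  interpret L: sigma_finite_measure "Leb n" by (rule sigma_finite_Leb)
  interpret LL: pair_sigma_finite "Leb n" "Leb n" ..
  note [measurable] = AB(1,2)
  have XS: "X \<subseteq> space (Leb n)" using X by (simp add: cvx_def)
  let ?b = "emeasure (Leb n) B" and ?D = "cball_Leb n (\<lambda>_. 0) (\<rho> / 2)"
  \<comment> \<open>\<open>C z\<close> is the intersection of \<open>B\<close> with its translate by
    \<open>z\<close>. Since \<open>X\<close> need not be measurable, \<open>A\<close> supplies the
    lower bounds and \<open>B\<close> the measurable sets.\<close>
  define C where "C = (\<lambda>z. {y \<in> space (Leb n). y \<in> B \<and> vec_diff n y z \<in> B})"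
  have C_ge: "ennreal ((1 / 2) ^ n) * ?b \<le> emeasure (Leb n) (C z)" if z: "z \<in> ?D" for z
  proof -
    have zs: "z \<in> space (Leb n)" using z by (simp add: cball_Leb_def space_Leb)
    then have [measurable]: "(\<lambda>y. z) \<in> Leb n \<rightarrow>\<^sub>M Leb n" by simp
    have Cm [measurable]: "C z \<in> sets (Leb n)" unfolding C_def by measurable
    have "aff n 2 (\<lambda>_. 0) z \<in> cball_Leb n (\<lambda>_. 0) \<rho>"
    proof -
      have "sqnorm n (aff n 2 (\<lambda>_. 0) z) = 4 * sqnorm n z"
        by (simp add: sqnorm_def aff_def power_mult_distrib sum_distrib_left)
      then show ?thesis using z by (simp add: cball_Leb_def aff_def power_divide)
    qed
    then obtain a b where ab: "a \<in> X" "b \<in> X" "\<And>i. i < n \<Longrightarrow> 2 * z i = a i - b i"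
      using diff[of "aff n 2 (\<lambda>_. 0) z"] by (auto simp: aff_def)
    have "A \<subseteq> {x \<in> space (Leb n). aff n (1 / 2) (\<lambda>i. a i / 2) x \<in> C z}"
    proof
      fix x assume "x \<in> A"
      then have x: "x \<in> X" "x \<in> space (Leb n)" using AB XS by auto
      have "aff n (1 / 2) (\<lambda>i. a i / 2) x \<in> X"
        by (rule cvxD[OF X x(1) ab(1) _ _ aff_in_space, of "1 / 2"]) (auto simp: aff_def)
      moreover have "vec_diff n (aff n (1 / 2) (\<lambda>i. a i / 2) x) z \<in> X"
      proof (rule cvxD[OF X x(1) ab(2), of "1 / 2"])
        fix i assume "i < n"
        then show "vec_diff n (aff n (1 / 2) (\<lambda>i. a i / 2) x) z i = (1 - 1 / 2) * x i + 1 / 2 * b i"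
          using ab(3)[of i] by (simp add: vec_diff_def aff_def)
      qed (auto simp: vec_diff_def space_Leb)
      ultimately show "x \<in> {x \<in> space (Leb n). aff n (1 / 2) (\<lambda>i. a i / 2) x \<in> C z}"
        using x AB(4) aff_in_space by (auto simp: C_def)
    qed
    then have "emeasure (Leb n) A \<le> emeasure (Leb n) {x \<in> space (Leb n). aff n (1 / 2) (\<lambda>i. a i / 2) x \<in> C z}"
      by (intro emeasure_mono) measurable
    then show ?thesis
      unfolding emeasure_Leb_aff[OF _ Cm, of "1 / 2" "\<lambda>i. a i / 2", simplified] eq
      by (simp add: mult_left_mono)
  qed
  \<comment> \<open>Integrated over all \<open>z\<close>, the volume of \<open>C z\<close> is the
    square of the volume of \<open>B\<close> by Fubini, and one factor then cancels. The 4 in the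
    conclusion is one 2 from halving \<open>X\<close> and one 2 from halving the radius of the ball
    of translations.\<close>
  have "emeasure (Leb n) ?D * (ennreal ((1 / 2) ^ n) * ?b) = (\<integral>\<^sup>+z. indicator ?D z * (ennreal ((1 / 2) ^ n) * ?b) \<partial>Leb n)"
    by (subst nn_integral_multc) auto
  also have "\<dots> \<le> (\<integral>\<^sup>+z. \<integral>\<^sup>+y. indicator B y * indicator B (vec_diff n y z) \<partial>Leb n \<partial>Leb n)"
  proof (rule nn_integral_mono)
    fix z assume z: "z \<in> space (Leb n)"
    then have [measurable]: "(\<lambda>y. z) \<in> Leb n \<rightarrow>\<^sub>M Leb n" by simp
    have "(\<integral>\<^sup>+y. indicator B y * indicator B (vec_diff n y z) \<partial>Leb n) = (\<integral>\<^sup>+y. indicator (C z) y \<partial>Leb n)"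
      by (intro nn_integral_cong) (auto simp: C_def indicator_def)
    also have "\<dots> = emeasure (Leb n) (C z)" by (subst nn_integral_indicator) (auto simp: C_def)
    finally show "indicator ?D z * (ennreal ((1 / 2) ^ n) * ?b)
        \<le> (\<integral>\<^sup>+y. indicator B y * indicator B (vec_diff n y z) \<partial>Leb n)"
      using C_ge[of z] by (auto simp: indicator_def)
  qed
  also have "\<dots> = (\<integral>\<^sup>+y. \<integral>\<^sup>+z. indicator B y * indicator B (vec_diff n y z) \<partial>Leb n \<partial>Leb n)"
    by (rule LL.Fubini'[symmetric]) measurable
  also have "\<dots> = (\<integral>\<^sup>+y. indicator B y * ?b \<partial>Leb n)"
  proof (rule nn_integral_cong)
    fix y assume y: "y \<in> space (Leb n)"
    then have [measurable]: "(\<lambda>z. y) \<in> Leb n \<rightarrow>\<^sub>M Leb n" by simp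
    show "(\<integral>\<^sup>+z. indicator B y * indicator B (vec_diff n y z) \<partial>Leb n) = indicator B y * ?b"
      by (subst nn_integral_cmult) (auto simp: nn_integral_Leb_vec(2)[where h = "indicator B"])
  qed
  also have "\<dots> = ?b * ?b" by (subst nn_integral_multc) auto
  finally have "?b * (emeasure (Leb n) ?D * ennreal ((1 / 2) ^ n)) \<le> ?b * ?b" by (simp add: mult_ac)
  then have "emeasure (Leb n) ?D * ennreal ((1 / 2) ^ n) \<le> ?b"
    using pos fin eq by (simp add: ennreal_mult_le_mult_iff)
  moreover have "emeasure (Leb n) ?D * ennreal ((1 / 2) ^ n) = ennreal ((\<rho> / 4) ^ n) * emeasure (Leb n) (uball n)"
  proof -
    have "(\<rho> / 4) ^ n = (\<rho> / 2) ^ n * (1 / 2) ^ n" unfolding power_mult_distrib[symmetric] by simp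
    then have "ennreal ((\<rho> / 4) ^ n) = ennreal ((\<rho> / 2) ^ n) * ennreal ((1 / 2) ^ n)"
      using \<rho> by (simp add: ennreal_mult)
    then show ?thesis using emeasure_cball_Leb[of "\<rho> / 2" n "\<lambda>_. 0"] \<rho> by (simp only: mult_ac half_gt_zero)
  qed
  ultimately show ?thesis by simp
qed

section \<open>Convex sets up to null sets, and covering bounds\<close>

definition nbhd :: "nat \<Rightarrow> (nat \<Rightarrow> real) set \<Rightarrow> real \<Rightarrow> (nat \<Rightarrow> real) set" where
  "nbhd n X \<eta> = {y \<in> space (Leb n). \<exists>x\<in>X. \<forall>i<n. \<bar>y i - x i\<bar> < \<eta>}"

lemma sets_box_Leb: "{y \<in> space (Leb n). \<forall>i<n. \<bar>y i - q i\<bar> < d} \<in> sets (Leb n)"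
  by measurable

text \<open>An open set for the sup norm is a countable union of boxes with rational centres and
  radii 1/(j+1), hence measurable in the product sigma-algebra whatever \<open>X\<close> is.\<close>

lemma sets_nbhd: "nbhd n X \<eta> \<in> sets (Leb n)"
proof -
  let ?box = "\<lambda>q j. {y \<in> space (Leb n). \<forall>i<n. \<bar>y i - q i\<bar> < inverse (real (Suc j))}"
  define I where "I = {(q, j). q \<in> Pi\<^sub>E {..<n} (\<lambda>_. \<rat>) \<and> ?box q j \<subseteq> nbhd n X \<eta>}"
  have "countable ((Pi\<^sub>E {..<n} (\<lambda>_. \<rat>) :: (nat \<Rightarrow> real) set) \<times> (UNIV :: nat set))"
    by (intro countable_SIGMA countable_PiE) (auto simp: countable_rat)
  then have "countable I" by (rule countable_subset[rotated]) (auto simp: I_def)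
  have "nbhd n X \<eta> = (\<Union>(q, j)\<in>I. ?box q j)"
  proof (intro equalityI subsetI)
    fix y assume y: "y \<in> nbhd n X \<eta>"
    then obtain x where x: "x \<in> X" "\<And>i. i < n \<Longrightarrow> \<bar>y i - x i\<bar> < \<eta>" by (auto simp: nbhd_def)
    \<comment> \<open>The factor 2 leaves room for two moves of length below 1/(j+1): from a point
      of the box to its rational centre, and from there to \<open>y\<close>.\<close>
    have "eventually (\<lambda>j. \<forall>i\<in>{..<n}. \<bar>y i - x i\<bar> + 2 * inverse (real (Suc j)) < \<eta>) sequentially"
    proof (rule eventually_ball_finite)
      show "\<forall>i\<in>{..<n}. eventually (\<lambda>j. \<bar>y i - x i\<bar> + 2 * inverse (real (Suc j)) < \<eta>) sequentially"
      proof
        fix i assume i: "i \<in> {..<n}"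
        have "(\<lambda>j. \<bar>y i - x i\<bar> + 2 * inverse (real (Suc j))) \<longlonglongrightarrow> \<bar>y i - x i\<bar> + 2 * 0"
          by (intro tendsto_intros LIMSEQ_inverse_real_of_nat)
        then show "eventually (\<lambda>j. \<bar>y i - x i\<bar> + 2 * inverse (real (Suc j)) < \<eta>) sequentially"
          using x(2)[of i] i by (intro order_tendstoD(2)) auto
      qed
    qed simp
    then obtain j where j: "\<And>i. i < n \<Longrightarrow> \<bar>y i - x i\<bar> + 2 * inverse (real (Suc j)) < \<eta>"
      by (auto simp: eventually_sequentially)
    have "\<exists>q\<in>\<rat>. \<bar>y i - q\<bar> < inverse (real (Suc j))" for i
    proof -
      obtain q where "q \<in> \<rat>" "y i - inverse (real (Suc j)) < q" "q < y i + inverse (real (Suc j))"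
        using Rats_dense_in_real[of "y i - inverse (real (Suc j))" "y i + inverse (real (Suc j))"]
        by auto
      then show ?thesis by (intro bexI[of _ q]) (auto simp: abs_less_iff)
    qed
    then obtain q0 where q0: "\<And>i. q0 i \<in> \<rat>" "\<And>i. \<bar>y i - q0 i\<bar> < inverse (real (Suc j))" by metis
    define q where "q = restrict q0 {..<n}"
    have q: "q i = q0 i" if "i < n" for i using that by (simp add: q_def)
    have "?box q j \<subseteq> nbhd n X \<eta>"
    proof
      fix y' assume y': "y' \<in> ?box q j"
      have "\<bar>y' i - x i\<bar> < \<eta>" if "i < n" for i
        using y' that j[OF that] q0(2)[of i] q[OF that] by auto
      then show "y' \<in> nbhd n X \<eta>" using y' x(1) by (auto simp: nbhd_def)
    qed
    then have "(q, j) \<in> I" using q0(1) by (auto simp: I_def q_def)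
    moreover have "y \<in> ?box q j" using y q0(2) q by (auto simp: nbhd_def)
    ultimately show "y \<in> (\<Union>(q, j)\<in>I. ?box q j)" by blast
  qed (auto simp: I_def)
  also have "\<dots> \<in> sets (Leb n)"
    using \<open>countable I\<close> sets_box_Leb by (intro sets.countable_UN') auto
  finally show ?thesis .
qed

text \<open>The sup-norm neighbourhood of radius \<open>t * r\<close> of a convex set \<open>X\<close> containing a cube of radius \<open>r\<close>
  lies in the dilate of \<open>X\<close> by \<open>1 + t\<close> about the centre of the cube.\<close>

lemma convex_sandwich:
  assumes X: "cvx n X" and p: "p \<in> space (Leb n)" and r: "r > 0"
    and box: "\<And>y. y \<in> space (Leb n) \<Longrightarrow> (\<forall>i<n. \<bar>y i - p i\<bar> \<le> r) \<Longrightarrow> y \<in> X"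
    and bdd: "X \<subseteq> cball_Leb n c R" and R: "R > 0"
  obtains A B where "A \<in> sets (Leb n)" "B \<in> sets (Leb n)" "A \<subseteq> X" "X \<subseteq> B"
    "emeasure (Leb n) A = emeasure (Leb n) B" "0 < emeasure (Leb n) A" "emeasure (Leb n) A < \<infinity>"
proof -
  have XS: "X \<subseteq> space (Leb n)" using X by (simp add: cvx_def)
  define t where "t = (\<lambda>j. inverse (real (Suc j)))"
  have t: "t j > 0" for j by (simp add: t_def)
  define Y where "Y = (\<lambda>j. nbhd n X (r * t j))"
  \<comment> \<open>The map is the dilation about \<open>p\<close> by \<open>1 + t j\<close>, so
    \<open>Z j\<close> is \<open>Y j\<close> shrunk towards \<open>p\<close>.\<close>
  define Z where "Z = (\<lambda>j. {x \<in> space (Leb n). aff n (1 + t j) (\<lambda>i. - t j * p i) x \<in> Y j})"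
  have [measurable]: "Y j \<in> sets (Leb n)" for j unfolding Y_def by (rule sets_nbhd)
  have [measurable]: "Z j \<in> sets (Leb n)" for j unfolding Z_def by measurable
  have XY: "X \<subseteq> Y j" for j
  proof
    fix x assume "x \<in> X"
    then show "x \<in> Y j" using r t[of j] XS by (auto simp: Y_def nbhd_def intro!: bexI[of _ x])
  qed
  have ZX: "Z j \<subseteq> X" for j
  proof
    fix z assume z: "z \<in> Z j"
    define y where "y = aff n (1 + t j) (\<lambda>i. - t j * p i) z"
    have "y \<in> Y j" using z by (simp add: Z_def y_def)
    then obtain x where x: "x \<in> X" "\<And>i. i < n \<Longrightarrow> \<bar>y i - x i\<bar> < r * t j"
      by (auto simp: Y_def nbhd_def)
    \<comment> \<open>The error \<open>y - x\<close> is below \<open>r * t j\<close>, so after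
      division by \<open>t j\<close> it keeps \<open>w\<close> in the cube around \<open>p\<close>.
      The point \<open>z\<close> then lies on the segment from \<open>x\<close> to \<open>w\<close>,
      with weight \<open>t j / (1 + t j)\<close> at \<open>w\<close>.\<close>
    define w where "w = (\<lambda>i\<in>{..<n}. p i + (y i - x i) / t j)"
    have "w \<in> X"
    proof (rule box)
      show "w \<in> space (Leb n)" by (simp add: w_def space_Leb)
      show "\<forall>i<n. \<bar>w i - p i\<bar> \<le> r"
        using x(2) t[of j] by (auto simp: w_def divide_simps abs_mult less_imp_le)
    qed
    show "z \<in> X"
    proof (rule cvxD[OF X x(1) \<open>w \<in> X\<close>, of "t j / (1 + t j)"])
      fix i assume i: "i < n"
      have "y i = (1 + t j) * z i - t j * p i" using i by (simp add: y_def aff_def)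
      then have "z i * (1 + t j) = x i + t j * w i"
        using i t[of j] by (simp add: w_def field_simps)
      then have "z i = (x i + t j * w i) / (1 + t j)" using t[of j] by (simp add: eq_divide_eq)
      moreover have "1 - t j / (1 + t j) = 1 / (1 + t j)" using t[of j] by (simp add: field_simps)
      ultimately show "z i = (1 - t j / (1 + t j)) * x i + t j / (1 + t j) * w i"
        by (simp add: add_divide_distrib)
    qed (use t[of j] z in \<open>auto simp: Z_def\<close>)
  qed
  define A where "A = (\<Union>j. Z j)"
  define B where "B = (\<Inter>j. Y j)"
  have [measurable]: "A \<in> sets (Leb n)" "B \<in> sets (Leb n)" unfolding A_def B_def by measurable
  have AX: "A \<subseteq> X" and XB: "X \<subseteq> B" using ZX XY by (auto simp: A_def B_def)
  have "A \<subseteq> cball_Leb n c R" using AX bdd by simp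
  then have "emeasure (Leb n) A \<le> emeasure (Leb n) (cball_Leb n c R)" by (intro emeasure_mono) auto
  also have "\<dots> < \<infinity>"
    using emeasure_uball_finite[of n] by (simp add: emeasure_cball_Leb[OF R, of n c] ennreal_mult_less_top)
  finally have finA: "emeasure (Leb n) A < \<infinity>" .
  \<comment> \<open>The volumes of \<open>Y j\<close> and \<open>Z j\<close> differ by the factor
    \<open>(1 + t j) ^ n\<close>, which tends to 1; this forces \<open>A\<close> and
    \<open>B\<close> to have equal volume.\<close>
  have le: "emeasure (Leb n) B \<le> ennreal ((1 + t j) ^ n) * emeasure (Leb n) A" for j
  proof -
    have "emeasure (Leb n) B \<le> emeasure (Leb n) (Y j)" by (intro emeasure_mono) (auto simp: B_def)
    also have "\<dots> = ennreal ((1 + t j) ^ n) * emeasure (Leb n) (Z j)"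
      unfolding Z_def using t[of j] by (intro emeasure_Leb_aff) auto
    also have "\<dots> \<le> ennreal ((1 + t j) ^ n) * emeasure (Leb n) A"
      by (intro mult_left_mono emeasure_mono) (auto simp: A_def)
    finally show ?thesis .
  qed
  have BA: "emeasure (Leb n) B \<le> emeasure (Leb n) A"
  proof -
    obtain a where a: "emeasure (Leb n) A = ennreal a" "a \<ge> 0"
      using finA by (cases "emeasure (Leb n) A") auto
    have "(\<lambda>j. (1 + t j) ^ n * a) \<longlonglongrightarrow> (1 + 0) ^ n * a"
      unfolding t_def by (intro tendsto_intros LIMSEQ_inverse_real_of_nat)
    then have "(\<lambda>j. ennreal ((1 + t j) ^ n * a)) \<longlonglongrightarrow> ennreal a"
      by (intro tendsto_ennrealI) simp
    then show ?thesis
      using le a t by (intro LIMSEQ_le_const[where x = "emeasure (Leb n) A"])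
        (auto simp: ennreal_mult less_imp_le)
  qed
  have "emeasure (Leb n) A \<le> emeasure (Leb n) B" using AX XB by (intro emeasure_mono) auto
  with BA have eq: "emeasure (Leb n) A = emeasure (Leb n) B" by simp
  have "Pi\<^sub>E {..<n} (\<lambda>i. {p i - r..p i + r}) \<subseteq> B"
  proof
    fix y assume y: "y \<in> Pi\<^sub>E {..<n} (\<lambda>i. {p i - r..p i + r})"
    have "y \<in> X"
    proof (rule box)
      show "y \<in> space (Leb n)" using y by (auto simp: space_Leb PiE_iff)
      show "\<forall>i<n. \<bar>y i - p i\<bar> \<le> r"
      proof (intro allI impI)
        fix i assume "i < n"
        then have "y i \<in> {p i - r..p i + r}" using y by (auto simp: PiE_iff)
        then show "\<bar>y i - p i\<bar> \<le> r" by (auto simp: abs_le_iff)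
      qed
    qed
    then show "y \<in> B" using XB by auto
  qed
  then have "emeasure (Leb n) (Pi\<^sub>E {..<n} (\<lambda>i. {p i - r..p i + r})) \<le> emeasure (Leb n) B"
    by (intro emeasure_mono) auto
  moreover have "emeasure (Leb n) (Pi\<^sub>E {..<n} (\<lambda>i. {p i - r..p i + r})) = ennreal ((2 * r) ^ n)"
    using r by (subst emeasure_Leb_box) (auto simp: ennreal_power)
  moreover have "0 < ennreal ((2 * r) ^ n)" using r by simp
  ultimately have "0 < emeasure (Leb n) A" unfolding eq by (metis less_le_trans)
  then show ?thesis using that[of A B] AX XB eq finA by auto
qed

text \<open>\<open>X\<close> is \<open>A\<close> together with a part of the null set
  \<open>B - A\<close>, so it is measurable in the completion.\<close>

lemma completion_sandwich:
  assumes "A \<in> sets M" "B \<in> sets M" "A \<subseteq> X" "X \<subseteq> B" "emeasure M A = emeasure M B" "emeasure M A < \<infinity>"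
  shows "measure (completion M) X = measure M B"
proof -
  have "emeasure M (B - A) = 0"
    using assms by (subst emeasure_Diff) auto
  then have N: "B - A \<in> null_sets M" using assms by auto
  have X: "X \<in> sets (completion M)"
    using sets_completionI[of X A "X - A" "B - A" M] N assms by auto
  have "emeasure (completion M) A \<le> emeasure (completion M) X"
    using X assms by (intro emeasure_mono) auto
  moreover have "emeasure (completion M) X \<le> emeasure (completion M) B"
    using assms by (intro emeasure_mono) auto
  ultimately have "emeasure (completion M) X = emeasure M B"
    using assms by (simp add: emeasure_completion)
  then show ?thesis by (simp add: measure_def)
qed

lemma convex_volume_lower:
  assumes X: "cvx n X" and p: "p \<in> space (Leb n)" and r: "r > 0"
    and box: "\<And>y. y \<in> space (Leb n) \<Longrightarrow> (\<forall>i<n. \<bar>y i - p i\<bar> \<le> r) \<Longrightarrow> y \<in> X"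
    and bdd: "X \<subseteq> cball_Leb n c R" and R: "R > 0" and \<rho>: "\<rho> > 0"
    and diff: "\<And>z. z \<in> cball_Leb n (\<lambda>_. 0) \<rho> \<Longrightarrow> \<exists>a\<in>X. \<exists>b\<in>X. \<forall>i<n. z i = a i - b i"
  shows "(\<rho> / 4) ^ n * measure (Leb n) (uball n) \<le> measure (completion (Leb n)) X"
proof -
  obtain A B where AB: "A \<in> sets (Leb n)" "B \<in> sets (Leb n)" "A \<subseteq> X" "X \<subseteq> B"
    "emeasure (Leb n) A = emeasure (Leb n) B" "0 < emeasure (Leb n) A" "emeasure (Leb n) A < \<infinity>"
    using convex_sandwich[OF X p r box bdd R] by metis
  have "ennreal ((\<rho> / 4) ^ n) * emeasure (Leb n) (uball n) \<le> emeasure (Leb n) B"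
    by (rule difference_body_volume[OF X AB \<rho> diff])
  moreover have "emeasure (Leb n) (uball n) = ennreal (measure (Leb n) (uball n))"
    using emeasure_uball_finite[of n] by (intro emeasure_eq_ennreal_measure) auto
  moreover have "emeasure (Leb n) B = ennreal (measure (Leb n) B)"
    using AB by (intro emeasure_eq_ennreal_measure) auto
  ultimately have "(\<rho> / 4) ^ n * measure (Leb n) (uball n) \<le> measure (Leb n) B"
    using \<rho> by (simp flip: ennreal_mult)
  then show ?thesis using completion_sandwich[OF AB(1-5,7)] by simp
qed

text \<open>Each piece that meets \<open>X\<close> lies in a ball of radius \<delta> around one of
  its own points. Assuming a bound on diameters, and not balls with given centres, leaves the pieces
  free to be described outside coordinate space.\<close>

lemma volume_covering_upper:
  assumes J: "finite J" and cov: "X \<subseteq> (\<Union>j\<in>J. S j)" and \<delta>: "\<delta> > 0" and XS: "X \<subseteq> space (Leb n)"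
    and diam: "\<And>j x y. j \<in> J \<Longrightarrow> x \<in> X \<inter> S j \<Longrightarrow> y \<in> X \<inter> S j \<Longrightarrow> sqnorm n (\<lambda>i. x i - y i) \<le> \<delta>\<^sup>2"
  shows "measure (completion (Leb n)) X \<le> real (card J) * \<delta> ^ n * measure (Leb n) (uball n)"
proof (cases "X \<in> sets (completion (Leb n))")
  case True
  define c where "c = (\<lambda>j. SOME x. x \<in> X \<inter> S j)"
  let ?U = "\<Union>j\<in>J. cball_Leb n (c j) \<delta>"
  have "X \<subseteq> ?U"
  proof
    fix x assume x: "x \<in> X"
    then obtain j where j: "j \<in> J" "x \<in> S j" using cov by auto
    then have "\<exists>x. x \<in> X \<inter> S j" using x by auto
    then have "c j \<in> X \<inter> S j" unfolding c_def by (rule someI_ex)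
    then have "x \<in> cball_Leb n (c j) \<delta>"
      using diam[OF j(1), of x "c j"] x j XS by (auto simp: cball_Leb_def space_Leb)
    then show "x \<in> ?U" using j by auto
  qed
  have fin: "emeasure (Leb n) (cball_Leb n (c j) \<delta>) \<noteq> \<infinity>" for j
    using emeasure_uball_finite[of n] by (simp add: emeasure_cball_Leb[OF \<delta>, of n "c j"] ennreal_mult_eq_top_iff)
  have "emeasure (Leb n) ?U \<le> (\<Sum>j\<in>J. emeasure (Leb n) (cball_Leb n (c j) \<delta>))"
    using J by (intro emeasure_subadditive_finite) auto
  also have "\<dots> < \<infinity>" using fin J by (simp add: ennreal_sum_less_top less_top)
  finally have fU: "emeasure (Leb n) ?U < \<infinity>" .
  have Um: "?U \<in> sets (Leb n)" using J by (intro sets.finite_UN) auto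
  have "measure (completion (Leb n)) X \<le> measure (completion (Leb n)) ?U"
    using \<open>X \<subseteq> ?U\<close> True fU Um
    by (intro measure_mono_fmeasurable fmeasurableI) (simp_all add: emeasure_completion)
  also have "\<dots> = measure (Leb n) ?U" using Um by (rule measure_completion)
  also have "\<dots> \<le> (\<Sum>j\<in>J. measure (Leb n) (cball_Leb n (c j) \<delta>))"
    using J fin by (intro measure_UNION_le) auto
  also have "\<dots> = (\<Sum>j\<in>J. \<delta> ^ n * measure (Leb n) (uball n))"
    using \<delta> by (intro sum.cong refl) (simp add: measure_def emeasure_cball_Leb[OF \<delta>, of n "c _"] enn2real_mult)
  finally show ?thesis by simp
next
  case False
  \<comment> \<open>\<open>measure\<close> takes the value 0 on sets that are not
    measurable.\<close>
  then have "measure (completion (Leb n)) X = 0"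
    by (simp add: measure_def emeasure_notin_sets)
  then show ?thesis using \<delta> by (simp add: mult_nonneg_nonneg)
qed

section \<open>Gaussian integrals of polynomials\<close>

definition gauss_poly :: "real poly \<Rightarrow> real" where
  "gauss_poly p = (\<integral>x. std_normal_density x * poly p x \<partial>lborel)"

lemma integrable_gauss_poly: "integrable lborel (\<lambda>x. std_normal_density x * poly p x)"
proof -
  have "(\<lambda>x. std_normal_density x * poly p x) =
      (\<lambda>x. \<Sum>i\<le>Polynomial.degree p. Polynomial.coeff p i * (std_normal_density x * x ^ i))"
    by (simp add: poly_altdef sum_distrib_left mult_ac)
  then show ?thesis
    by (simp only:) (intro Bochner_Integration.integrable_sum integrable_mult_right integrable_std_normal_moment)
qed

lemma gauss_poly_add: "gauss_poly (p + q) = gauss_poly p + gauss_poly q"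
  using integrable_gauss_poly[of p] integrable_gauss_poly[of q]
  by (simp add: gauss_poly_def distrib_left)

lemma gauss_poly_diff: "gauss_poly (p - q) = gauss_poly p - gauss_poly q"
  using gauss_poly_add[of "p - q" q] by simp

lemma gauss_poly_smult: "gauss_poly (smult c p) = c * gauss_poly p"
proof -
  have "gauss_poly (smult c p) = (\<integral>x. c * (std_normal_density x * poly p x) \<partial>lborel)"
    unfolding gauss_poly_def by (intro Bochner_Integration.integral_cong) auto
  then show ?thesis by (simp add: gauss_poly_def)
qed

lemma gauss_poly_monom_even: "gauss_poly (monom 1 (2 * m)) = fact (2 * m) / (2 ^ m * fact m)"
  using integral_std_normal_moment_even[of m] by (simp add: gauss_poly_def poly_monom)

lemma gauss_poly_monom_odd: "gauss_poly (monom 1 (2 * m + 1)) = 0"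
  using integral_std_normal_moment_odd[of m] by (simp add: gauss_poly_def poly_monom)

lemma gauss_poly_0 [simp]: "gauss_poly 0 = 0" and gauss_poly_1 [simp]: "gauss_poly 1 = 1"
  using gauss_poly_smult[of 0 0] gauss_poly_monom_even[of 0] by (simp_all add: monom_0 one_pCons)

lemma gauss_poly_const: "gauss_poly [:c:] = c"
  using gauss_poly_smult[of c 1] by simp

lemma gauss_poly_sum: "gauss_poly (\<Sum>i\<in>A. f i) = (\<Sum>i\<in>A. gauss_poly (f i))"
  by (induction A rule: infinite_finite_induct) (auto simp: gauss_poly_add)

text \<open>Gaussian integration by parts. On even powers both sides are odd moments and vanish; on
  odd powers it is the recursion for even moments; linearity does the rest, without any boundary
  terms.\<close>

lemma gauss_poly_stein: "gauss_poly ([:0, 1:] * p) = gauss_poly (pderiv p)"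
proof -
  have X: "[:0, 1:] * monom 1 j = monom (1::real) (Suc j)" for j
    by (simp add: monom_Suc)
  have mono: "gauss_poly ([:0, 1:] * monom 1 j) = gauss_poly (pderiv (monom 1 j))" for j
  proof (cases "even j")
    case True
    then obtain m where j: "j = 2 * m" by (elim evenE)
    have "gauss_poly (pderiv (monom 1 j)) = 0"
    proof (cases m)
      case (Suc m')
      have "pderiv (monom (1::real) j) = smult (real j) (monom 1 (2 * m' + 1))"
        using j Suc by (simp add: pderiv_monom smult_monom)
      then show ?thesis using gauss_poly_monom_odd by (simp only: gauss_poly_smult)
    qed (simp add: j pderiv_monom)
    then show ?thesis using gauss_poly_monom_odd[of m] by (simp only: X j Suc_eq_plus1)
  next
    case False
    then obtain m where j: "j = 2 * m + 1" by (elim oddE)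
    have "pderiv (monom (1::real) j) = smult (real j) (monom 1 (2 * m))"
      using j by (simp add: pderiv_monom smult_monom)
    moreover have "Suc j = 2 * Suc m" using j by simp
    moreover have "fact (2 * Suc m) / (2 ^ Suc m * fact (Suc m)) = real j * (fact (2 * m) / (2 ^ m * fact m))"
    proof -
      have "fact (2 * Suc m) = real (2 * m + 2) * (real j * fact (2 * m))" using j by (simp add: mult_ac)
      moreover have "(2 ^ Suc m * fact (Suc m) :: real) = real (2 * m + 2) * (2 ^ m * fact m)" by simp
      ultimately show ?thesis by (simp only:) (simp del: of_nat_add)
    qed
    ultimately show ?thesis
      by (simp only: X gauss_poly_smult gauss_poly_monom_even)
  qed
  have p: "p = (\<Sum>i\<le>Polynomial.degree p. smult (Polynomial.coeff p i) (monom 1 i))"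
    using poly_as_sum_of_monoms[of p] by (simp add: smult_monom)
  have "gauss_poly ([:0, 1:] * p) = (\<Sum>i\<le>Polynomial.degree p. Polynomial.coeff p i * gauss_poly ([:0, 1:] * monom 1 i))"
    by (subst p) (simp only: sum_distrib_left gauss_poly_sum mult_smult_right gauss_poly_smult)
  also have "\<dots> = gauss_poly (pderiv p)"
    by (subst (3) p) (simp only: mono higher_pderiv_sum[of 1, simplified] pderiv_smult gauss_poly_sum gauss_poly_smult)
  finally show ?thesis .
qed

text \<open>The probabilists' Hermite polynomials, generated by the operator x - d/dx, which is the
  Gaussian adjoint of differentiation.\<close>

fun herm :: "nat \<Rightarrow> real poly" where
  "herm 0 = 1"
| "herm (Suc m) = [:0, 1:] * herm m - pderiv (herm m)"

text \<open>Each step of the recursion for \<open>herm\<close> moves one derivative to the other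
  factor. Orthogonality follows, since \<open>m\<close> derivatives annihilate every polynomial of
  degree below \<open>m\<close>.\<close>

lemma gauss_poly_herm: "gauss_poly (herm m * q) = gauss_poly ((pderiv ^^ m) q)"
proof (induction m arbitrary: q)
  case (Suc m)
  have "gauss_poly (herm (Suc m) * q) = gauss_poly ([:0, 1:] * (herm m * q)) - gauss_poly (pderiv (herm m) * q)"
    by (simp only: herm.simps left_diff_distrib gauss_poly_diff mult.assoc)
  also have "\<dots> = gauss_poly (herm m * pderiv q)"
    by (simp only: gauss_poly_stein pderiv_mult gauss_poly_add) (simp add: mult.commute)
  also have "\<dots> = gauss_poly ((pderiv ^^ Suc m) q)" by (simp add: Suc.IH funpow_swap1)
  finally show ?case .
qed simp

lemma degree_herm: "Polynomial.degree (herm m) \<le> m" and coeff_herm: "Polynomial.coeff (herm m) m = 1"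
proof (induction m)
  case (Suc m)
  { case 1
    have "Polynomial.degree ([:0, 1:] * herm m) \<le> Suc m"
      using Suc.IH(1) degree_mult_le[of "[:0, 1:]" "herm m"] by simp
    moreover have "Polynomial.degree (pderiv (herm m)) \<le> Suc m"
      using Suc.IH(1) by (simp add: degree_pderiv)
    ultimately show ?case by (simp only: herm.simps degree_diff_le)
  next
    case 2
    have "Polynomial.coeff (pderiv (herm m)) (Suc m) = 0"
      using Suc.IH(1) by (simp add: coeff_pderiv coeff_eq_0)
    then show ?case using Suc.IH(2) by simp }
qed auto

lemma higher_pderiv_degree_le:
  assumes "Polynomial.degree q \<le> m"
  shows "(pderiv ^^ m) q = [:fact m * Polynomial.coeff (q :: real poly) m:]"
proof (rule poly_eqI)
  fix i
  show "Polynomial.coeff ((pderiv ^^ m) q) i = Polynomial.coeff [:fact m * Polynomial.coeff q m:] i"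
    using assms by (cases i) (auto simp: coeff_higher_pderiv coeff_eq_0 pochhammer_fact)
qed

lemma gauss_poly_herm_le:
  "Polynomial.degree q \<le> m \<Longrightarrow> gauss_poly (herm m * q) = fact m * Polynomial.coeff q m"
  by (simp add: gauss_poly_herm higher_pderiv_degree_le gauss_poly_const)

lemma gauss_poly_herm_monom: "j \<le> m \<Longrightarrow> gauss_poly (herm m * monom 1 j) = (if j = m then fact m else 0)"
  by (subst gauss_poly_herm_le) (auto simp: degree_monom_eq)

lemma gauss_poly_herm_herm: "gauss_poly (herm m * herm j) = (if j = m then fact m else 0)"
proof -
  have *: "gauss_poly (herm m * herm j) = (if j = m then fact m else 0)" if "j \<le> m" for m j
    using that degree_herm[of j] coeff_herm[of m]
    by (subst gauss_poly_herm_le) (auto simp: coeff_eq_0)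
  show ?thesis
    using *[of j m] *[of m j] by (cases "j \<le> m") (auto simp: mult.commute)
qed

section \<open>Expectations over a standard Gaussian vector\<close>

definition gw :: "nat \<Rightarrow> (nat \<Rightarrow> real) \<Rightarrow> real" where
  "gw n x = (\<Prod>i<n. std_normal_density (x i))"

definition gE :: "nat \<Rightarrow> ((nat \<Rightarrow> real) \<Rightarrow> real) \<Rightarrow> real" where
  "gE n h = (LINT x|Leb n. gw n x * h x)"

definition gint :: "nat \<Rightarrow> ((nat \<Rightarrow> real) \<Rightarrow> real) \<Rightarrow> bool" where
  "gint n h \<longleftrightarrow> integrable (Leb n) (\<lambda>x. gw n x * h x)"

lemma gw_nonneg: "gw n x \<ge> 0"
  unfolding gw_def by (intro prod_nonneg) auto

text \<open>That the weight depends on \<open>sqnorm\<close> alone is what makes Gaussian and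
  spherical integrals of a form proportional.\<close>

lemma gw_radial: "gw n x = (1 / sqrt (2 * pi)) ^ n * exp (- sqnorm n x / 2)"
proof -
  have "exp (- sqnorm n x / 2) = (\<Prod>i<n. exp (- (x i)\<^sup>2 / 2))"
    unfolding sqnorm_def sum_negf[symmetric] sum_divide_distrib by (simp add: exp_sum)
  moreover have "gw n x = (1 / sqrt (2 * pi)) ^ n * (\<Prod>i<n. exp (- (x i)\<^sup>2 / 2))"
    unfolding gw_def std_normal_density_def prod.distrib by simp
  ultimately show ?thesis by (simp only:)
qed

lemma gint_add: "gint n f \<Longrightarrow> gint n g \<Longrightarrow> gint n (\<lambda>x. f x + g x)"
  and gE_add: "gint n f \<Longrightarrow> gint n g \<Longrightarrow> gE n (\<lambda>x. f x + g x) = gE n f + gE n g"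
  by (simp_all add: gint_def gE_def distrib_left)

lemma gint_diff: "gint n f \<Longrightarrow> gint n g \<Longrightarrow> gint n (\<lambda>x. f x - g x)"
  and gE_diff: "gint n f \<Longrightarrow> gint n g \<Longrightarrow> gE n (\<lambda>x. f x - g x) = gE n f - gE n g"
  by (simp_all add: gint_def gE_def right_diff_distrib)

lemma gint_cmult: "gint n f \<Longrightarrow> gint n (\<lambda>x. c * f x)"
  and gE_cmult: "gint n f \<Longrightarrow> gE n (\<lambda>x. c * f x) = c * gE n f"
  by (simp_all add: gint_def gE_def mult.left_commute[of _ c])

lemma gint_sum: "(\<And>i. i \<in> A \<Longrightarrow> gint n (f i)) \<Longrightarrow> gint n (\<lambda>x. \<Sum>i\<in>A. f i x)"
  and gE_sum: "(\<And>i. i \<in> A \<Longrightarrow> gint n (f i)) \<Longrightarrow> gE n (\<lambda>x. \<Sum>i\<in>A. f i x) = (\<Sum>i\<in>A. gE n (f i))"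
  by (simp_all add: gint_def gE_def sum_distrib_left)

lemma gE_nonneg: "(\<And>x. h x \<ge> 0) \<Longrightarrow> gE n h \<ge> 0"
  unfolding gE_def by (intro integral_nonneg_AE) (auto simp: gw_nonneg)

lemma gE_mono: "gint n f \<Longrightarrow> gint n g \<Longrightarrow> (\<And>x. f x \<le> g x) \<Longrightarrow> gE n f \<le> gE n g"
  unfolding gE_def gint_def by (intro integral_mono) (auto simp: gw_nonneg mult_left_mono)

lemma gE_prod:
  assumes "\<And>i. i < n \<Longrightarrow> integrable lborel (\<lambda>t. std_normal_density t * g i t)"
  shows "gint n (\<lambda>x. \<Prod>i<n. g i (x i))"
    and "gE n (\<lambda>x. \<Prod>i<n. g i (x i)) = (\<Prod>i<n. \<integral>t. std_normal_density t * g i t \<partial>lborel)"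
proof -
  interpret product_sigma_finite "\<lambda>_::nat. lborel :: real measure" by standard
  have eq: "gw n x * (\<Prod>i<n. g i (x i)) = (\<Prod>i<n. std_normal_density (x i) * g i (x i))" for x
    by (simp add: gw_def prod.distrib)
  show "gint n (\<lambda>x. \<Prod>i<n. g i (x i))"
    unfolding gint_def eq Leb_def using assms by (intro product_integrable_prod) auto
  show "gE n (\<lambda>x. \<Prod>i<n. g i (x i)) = (\<Prod>i<n. \<integral>t. std_normal_density t * g i t \<partial>lborel)"
    unfolding gE_def eq Leb_def using assms by (intro product_integral_prod) auto
qed

lemma
  shows gint_poly_prod: "gint n (\<lambda>x. \<Prod>i<n. poly (P i) (x i))"
    and gE_poly_prod: "gE n (\<lambda>x. \<Prod>i<n. poly (P i) (x i)) = (\<Prod>i<n. gauss_poly (P i))"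
  using gE_prod[of n "\<lambda>i. poly (P i)"] integrable_gauss_poly by (simp_all add: gauss_poly_def)

lemma mon_as_poly_prod:
  "keys a \<subseteq> {..<n} \<Longrightarrow> mon a x = (\<Prod>i<n. poly (monom 1 (lookup a i)) (x i))"
  by (subst mon_superset[of "{..<n}"]) (auto simp: poly_monom)

lemma gint_mon:
  assumes "keys a \<subseteq> {..<n}"
  shows "gint n (mon a)"
proof -
  have "mon a = (\<lambda>x. \<Prod>i<n. poly (monom 1 (lookup a i)) (x i))"
    by (intro ext mon_as_poly_prod assms)
  then show ?thesis by (simp only: gint_poly_prod)
qed

lemma gint_poly_eval: "f \<in> forms n m \<Longrightarrow> gint n (poly_eval f)"
  unfolding poly_eval_alt[abs_def] by (intro gint_sum gint_cmult gint_mon) (auto simp: forms_iff)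

definition hermite :: "nat \<Rightarrow> (nat \<Rightarrow>\<^sub>0 nat) \<Rightarrow> (nat \<Rightarrow> real) \<Rightarrow> real" where
  "hermite n a x = (\<Prod>i<n. poly (herm (lookup a i)) (x i))"

definition mfact :: "nat \<Rightarrow> (nat \<Rightarrow>\<^sub>0 nat) \<Rightarrow> real" where
  "mfact n a = (\<Prod>i<n. fact (lookup a i))"

text \<open>If \<open>a\<close> were dominated by \<open>b\<close> in every variable, equal degrees
  would make them equal. In the variable found here the Hermite factor of \<open>a\<close> is
  orthogonal to the lower power occurring in \<open>b\<close>.\<close>

lemma mon_differ:
  assumes "keys a \<subseteq> {..<n}" "keys b \<subseteq> {..<n}" "mdeg a = mdeg b" "a \<noteq> b"
  shows "\<exists>i<n. lookup b i < lookup a i"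
proof (rule ccontr)
  assume "\<not> ?thesis"
  then have le: "\<And>i. i \<in> {..<n} \<Longrightarrow> lookup a i \<le> lookup b i" by force
  have "(\<Sum>i<n. lookup a i) = (\<Sum>i<n. lookup b i)"
    using assms mdeg_superset[of "{..<n}" a] mdeg_superset[of "{..<n}" b] by simp
  then have "lookup a i = lookup b i" if "i < n" for i
    using sum_mono_inv[of "lookup a" "{..<n}" "lookup b" i] le that by auto
  moreover have "lookup a i = lookup b i" if "\<not> i < n" for i
    using assms(1,2) that by (metis in_keys_iff lessThan_iff subsetD)
  ultimately have "a = b" by (intro poly_mapping_eqI) blast
  with assms show False by simp
qed

lemma gint_mon_hermite:
  assumes "keys b \<subseteq> {..<n}"
  shows "gint n (\<lambda>x. mon b x * hermite n a x)"
    and "gE n (\<lambda>x. mon b x * hermite n a x) =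
      (\<Prod>i<n. gauss_poly (herm (lookup a i) * monom 1 (lookup b i)))"
proof -
  have eq: "mon b x * hermite n a x =
    (\<Prod>i<n. poly (herm (lookup a i) * monom 1 (lookup b i)) (x i))" for x
    by (simp add: mon_as_poly_prod[OF assms] hermite_def prod.distrib mult.commute)
  show "gint n (\<lambda>x. mon b x * hermite n a x)"
    "gE n (\<lambda>x. mon b x * hermite n a x) =
      (\<Prod>i<n. gauss_poly (herm (lookup a i) * monom 1 (lookup b i)))"
    unfolding eq by (rule gint_poly_prod, rule gE_poly_prod)
qed

lemma gE_mon_hermite:
  assumes "keys a \<subseteq> {..<n}" "keys b \<subseteq> {..<n}" "mdeg a = mdeg b"
  shows "gE n (\<lambda>x. mon b x * hermite n a x) = (if a = b then mfact n a else 0)"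
proof (cases "a = b")
  case True
  then show ?thesis using assms
    by (simp add: gint_mon_hermite gauss_poly_herm_monom mfact_def)
next
  case False
  then obtain i where i: "i < n" "lookup b i < lookup a i"
    using mon_differ assms by blast
  then have "gauss_poly (herm (lookup a i) * monom 1 (lookup b i)) = 0"
    by (simp add: gauss_poly_herm_monom)
  then show ?thesis using False i assms by (auto simp: gint_mon_hermite intro!: prod_zero)
qed

lemma gE_hermite_hermite:
  assumes "keys a \<subseteq> {..<n}" "keys b \<subseteq> {..<n}"
  shows "gint n (\<lambda>x. hermite n a x * hermite n b x)"
    and "gE n (\<lambda>x. hermite n a x * hermite n b x) = (if a = b then mfact n a else 0)"
proof -
  have eq: "hermite n a x * hermite n b x =
    (\<Prod>i<n. poly (herm (lookup a i) * herm (lookup b i)) (x i))" for x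
    by (simp add: hermite_def prod.distrib)
  show "gint n (\<lambda>x. hermite n a x * hermite n b x)" unfolding eq by (rule gint_poly_prod)
  have "gE n (\<lambda>x. hermite n a x * hermite n b x) =
      (\<Prod>i<n. gauss_poly (herm (lookup a i) * herm (lookup b i)))"
    unfolding eq by (rule gE_poly_prod)
  also have "\<dots> = (if a = b then mfact n a else 0)"
  proof (cases "a = b")
    case True
    then show ?thesis by (simp add: gauss_poly_herm_herm mfact_def)
  next
    case False
    then obtain i where i: "lookup a i \<noteq> lookup b i"
      by (metis poly_mapping_eqI)
    then have "i \<in> {..<n}" using assms by (metis in_keys_iff subsetD)
    moreover have "gauss_poly (herm (lookup a i) * herm (lookup b i)) = 0"
      using i by (simp add: gauss_poly_herm_herm)
    ultimately show ?thesis using False by (auto intro!: prod_zero)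
  qed
  finally show "gE n (\<lambda>x. hermite n a x * hermite n b x) = (if a = b then mfact n a else 0)" .
qed

text \<open>Bessel's inequality for the Hermite polynomials: \<open>hermite n a\<close> has leading monomial \<open>mon a\<close>,
  hence its inner product with \<open>f\<close> is \<open>a!\<close> times the coefficient of \<open>f\<close> at \<open>a\<close>.\<close>

lemma coeffs_le_gauss_norm:
  assumes f: "f \<in> forms n d"
  shows "(\<Sum>a\<in>keys f. (lookup f a)\<^sup>2) \<le> gE n (\<lambda>x. (poly_eval f x)\<^sup>2)"
proof -
  let ?K = "keys f" and ?c = "lookup f"
  have K: "\<And>a. a \<in> ?K \<Longrightarrow> keys a \<subseteq> {..<n}" "\<And>a. a \<in> ?K \<Longrightarrow> mdeg a = d"
    using f by (auto simp: forms_iff)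
  \<comment> \<open>\<open>Q\<close> is the orthogonal projection of \<open>f\<close> to the span of
    these Hermite polynomials.\<close>
  define Q where "Q = (\<lambda>x. \<Sum>a\<in>?K. ?c a * hermite n a x)"
  have pQ: "poly_eval f x * Q x = (\<Sum>a\<in>?K. \<Sum>b\<in>?K. (?c a * ?c b) * (mon a x * hermite n b x))" for x
    by (simp add: poly_eval_alt Q_def sum_product mult_ac)
  have QQ: "Q x * Q x = (\<Sum>a\<in>?K. \<Sum>b\<in>?K. (?c a * ?c b) * (hermite n a x * hermite n b x))" for x
    by (simp add: Q_def sum_product mult_ac)
  let ?s = "\<Sum>a\<in>?K. (?c a)\<^sup>2 * mfact n a"
  have ipQ: "gint n (\<lambda>x. poly_eval f x * Q x)"
    unfolding pQ by (intro gint_sum gint_cmult gint_mon_hermite(1) K)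
  have "gE n (\<lambda>x. poly_eval f x * Q x) = (\<Sum>a\<in>?K. \<Sum>b\<in>?K. (?c a * ?c b) * gE n (\<lambda>x. mon a x * hermite n b x))"
    unfolding pQ by (simp add: gE_sum gE_cmult gint_sum gint_cmult gint_mon_hermite(1) K)
  also have "\<dots> = (\<Sum>a\<in>?K. \<Sum>b\<in>?K. if b = a then (?c a * ?c b) * mfact n b else 0)"
    by (intro sum.cong refl) (simp add: gE_mon_hermite K)
  also have "\<dots> = ?s" by (simp add: power2_eq_square)
  finally have pQ_val: "gE n (\<lambda>x. poly_eval f x * Q x) = ?s" .
  have iQQ: "gint n (\<lambda>x. Q x * Q x)"
    unfolding QQ by (intro gint_sum gint_cmult gE_hermite_hermite(1) K)
  have "gE n (\<lambda>x. Q x * Q x) = (\<Sum>a\<in>?K. \<Sum>b\<in>?K. (?c a * ?c b) * gE n (\<lambda>x. hermite n a x * hermite n b x))"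
    unfolding QQ by (simp add: gE_sum gE_cmult gint_sum gint_cmult gE_hermite_hermite(1) K)
  also have "\<dots> = (\<Sum>a\<in>?K. \<Sum>b\<in>?K. if a = b then (?c a * ?c b) * mfact n a else 0)"
    by (intro sum.cong refl) (simp add: gE_hermite_hermite K)
  also have "\<dots> = ?s" by (simp add: power2_eq_square)
  finally have QQ_val: "gE n (\<lambda>x. Q x * Q x) = ?s" .
  have ipp: "gint n (\<lambda>x. poly_eval f x * poly_eval f x)"
    using gint_poly_eval[OF forms_mult[OF f f]] by (simp add: poly_eval_mult[abs_def])
  have eq: "(poly_eval f x - Q x)\<^sup>2 = poly_eval f x * poly_eval f x - 2 * (poly_eval f x * Q x) + Q x * Q x" for x
    by (simp add: power2_eq_square algebra_simps)
  \<comment> \<open>The inner products of \<open>Q\<close> with \<open>f\<close> and with itself are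
    the same number, so the squared distance from \<open>f\<close> to \<open>Q\<close> is the
    squared norm of \<open>f\<close> minus that number.\<close>
  have "0 \<le> gE n (\<lambda>x. (poly_eval f x - Q x)\<^sup>2)" by (rule gE_nonneg) simp
  also have "\<dots> = gE n (\<lambda>x. poly_eval f x * poly_eval f x) - 2 * ?s + ?s"
    unfolding eq by (simp add: gE_add gE_diff gE_cmult gint_diff gint_cmult ipp ipQ iQQ pQ_val QQ_val)
  finally have "?s \<le> gE n (\<lambda>x. (poly_eval f x)\<^sup>2)" by (simp add: power2_eq_square)
  moreover have "(\<Sum>a\<in>?K. (?c a)\<^sup>2) \<le> ?s"
  proof (rule sum_mono)
    fix a
    have "1 \<le> mfact n a" unfolding mfact_def by (intro prod_ge_1) (auto simp: fact_ge_1)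
    then show "(?c a)\<^sup>2 \<le> (?c a)\<^sup>2 * mfact n a" by (simp add: mult_le_cancel_left1)
  qed
  ultimately show ?thesis by linarith
qed

section \<open>Moments of linear forms and of the squared norm\<close>

lemma gauss_mgf_1: "integrable lborel (\<lambda>t. std_normal_density t * exp (u * t))"
  "(\<integral>t. std_normal_density t * exp (u * t) \<partial>lborel) = exp (u\<^sup>2 / 2)"
proof -
  have eq: "std_normal_density t * exp (u * t) = exp (u\<^sup>2 / 2) * normal_density u 1 t" for t
    by (simp add: normal_density_def power2_eq_square field_simps flip: exp_add)
  show "integrable lborel (\<lambda>t. std_normal_density t * exp (u * t))"
    "(\<integral>t. std_normal_density t * exp (u * t) \<partial>lborel) = exp (u\<^sup>2 / 2)"
    unfolding eq by simp_all
qed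

lemma gauss_mgf: "gint n (\<lambda>x. exp (\<Sum>i<n. u i * x i))" "gE n (\<lambda>x. exp (\<Sum>i<n. u i * x i)) = exp (sqnorm n u / 2)"
  using gE_prod[of n "\<lambda>i t. exp (u i * t)"] gauss_mgf_1
  by (simp_all add: exp_sum sqnorm_def sum_divide_distrib)

text \<open>One term of the exponential series at \<bar>y\<bar>; adding \<open>exp (- y)\<close>
  removes the absolute value, so that the moment generating function applies.\<close>

lemma power_le_fact_exp:
  fixes y :: real
  shows "y ^ (2 * m) \<le> fact (2 * m) * (exp y + exp (- y))"
proof -
  have *: "z ^ j / fact j \<le> exp z" if "z \<ge> 0" for z :: real and j
  proof -
    have "(\<Sum>i\<in>{j}. z ^ i /\<^sub>R fact i) \<le> suminf (\<lambda>i. z ^ i /\<^sub>R fact i)"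
      using that by (intro sum_le_suminf summable_exp_generic) auto
    then show ?thesis by (simp add: exp_def divide_inverse mult.commute)
  qed
  have "\<bar>y\<bar> ^ (2 * m) / fact (2 * m) \<le> exp \<bar>y\<bar>" by (rule *) simp
  also have "\<dots> \<le> exp y + exp (- y)" by (cases "y \<ge> 0") auto
  finally show ?thesis by (simp add: field_simps power_even_abs)
qed

lemma gint_sqnorm_power: "gint n (\<lambda>x. sqnorm n x ^ m)"
  using gint_poly_eval[OF r_pow_in_forms[of n m]] by (simp add: poly_eval_r_pow[abs_def])

lemma gint_lin_power: "gint n (\<lambda>x. (\<Sum>i<n. u i * x i) ^ m)"
  using gint_poly_eval[OF lin_power_in_forms[of n u m]] by (simp add: poly_eval_power[abs_def] poly_eval_lin)

text \<open>The 4 is 2 * 2: two exponentials, each with expectation at most exp(1/2), which is below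
  2.\<close>

lemma gE_lin_power_unit:
  assumes "sqnorm n u \<le> 1"
  shows "gE n (\<lambda>x. (\<Sum>i<n. u i * x i) ^ (2 * m)) \<le> 4 * fact (2 * m)"
proof -
  have i: "gint n (\<lambda>x. exp (- (\<Sum>i<n. u i * x i)))" "gE n (\<lambda>x. exp (- (\<Sum>i<n. u i * x i))) = exp (sqnorm n u / 2)"
    using gauss_mgf[of n "\<lambda>i. - u i"] by (simp_all add: sum_negf sqnorm_def)
  have "gE n (\<lambda>x. (\<Sum>i<n. u i * x i) ^ (2 * m)) \<le>
      gE n (\<lambda>x. fact (2 * m) * (exp (\<Sum>i<n. u i * x i) + exp (- (\<Sum>i<n. u i * x i))))"
    by (intro gE_mono gint_lin_power gint_cmult gint_add gauss_mgf i power_le_fact_exp)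
  also have "\<dots> = fact (2 * m) * (2 * exp (sqnorm n u / 2))"
    by (simp add: gE_cmult gE_add gint_add gauss_mgf i)
  also have "\<dots> \<le> fact (2 * m) * (2 * 2)"
  proof -
    have "exp (sqnorm n u / 2) \<le> exp (1 / 2)" using assms by simp
    also have "\<dots> \<le> 1 + 1/2 + (1/2)\<^sup>2" using exp_bound[of "1/2"] by simp
    also have "\<dots> \<le> (2 :: real)" by (simp add: power2_eq_square)
    finally show ?thesis by simp
  qed
  finally show ?thesis by simp
qed

lemma sqnorm_nonneg [simp]: "sqnorm n x \<ge> 0"
  by (simp add: sqnorm_def sum_nonneg)

lemma sqnorm_scale: "sqnorm n (\<lambda>i. c * x i) = c\<^sup>2 * sqnorm n x"
  by (simp add: sqnorm_def power_mult_distrib sum_distrib_left)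

lemma sqnorm_eq_0D: "sqnorm n x = 0 \<Longrightarrow> i < n \<Longrightarrow> x i = 0"
  by (simp add: sqnorm_def sum_nonneg_eq_0_iff)

lemma gE_lin_power:
  assumes "m \<ge> 1"
  shows "gE n (\<lambda>x. (\<Sum>i<n. u i * x i) ^ (2 * m)) \<le> 4 * fact (2 * m) * sqnorm n u ^ m"
proof (cases "sqnorm n u = 0")
  case True
  then have "(\<Sum>i<n. u i * x i) = 0" for x by (intro sum.neutral) (auto dest: sqnorm_eq_0D)
  then show ?thesis using True assms by (simp add: gE_def zero_power)
next
  case False
  define s where "s = sqrt (sqnorm n u)"
  have s: "s > 0" "s\<^sup>2 = sqnorm n u" using False by (auto simp: s_def order_less_le)
  define v where "v = (\<lambda>i. 1 / s * u i)"
  have "sqnorm n v = 1" unfolding v_def sqnorm_scale using s False by (simp add: power_divide)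
  then have v: "gE n (\<lambda>x. (\<Sum>i<n. v i * x i) ^ (2 * m)) \<le> 4 * fact (2 * m)"
    by (intro gE_lin_power_unit) simp
  have "(\<Sum>i<n. u i * x i) = s * (\<Sum>i<n. v i * x i)" for x
    using s by (simp add: v_def sum_distrib_left)
  then have "gE n (\<lambda>x. (\<Sum>i<n. u i * x i) ^ (2 * m)) = s ^ (2 * m) * gE n (\<lambda>x. (\<Sum>i<n. v i * x i) ^ (2 * m))"
    by (simp add: power_mult_distrib gE_cmult gint_lin_power)
  also have "\<dots> \<le> s ^ (2 * m) * (4 * fact (2 * m))" using v s by (intro mult_left_mono) auto
  also have "s ^ (2 * m) = sqnorm n u ^ m" using s by (simp add: power_mult)
  finally show ?thesis by (simp add: mult_ac)
qed

text \<open>Bernoulli's inequality for \<open>y / c\<close>. It stands in for Jensen's inequality: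
  when \<open>c\<close> is the mean of \<open>y\<close>, the linear term integrates to zero.\<close>

lemma power_tangent:
  fixes y c :: real
  assumes "y \<ge> 0" "c > 0"
  shows "c ^ m + m * c ^ (m - 1) * (y - c) \<le> y ^ m"
proof (cases m)
  case (Suc p)
  have "1 + real m * (y / c - 1) \<le> (1 + (y / c - 1)) ^ m"
    using assms by (intro Bernoulli_inequality) simp
  then have "c ^ m * (1 + real m * (y / c - 1)) \<le> c ^ m * (y / c) ^ m"
    using assms by (intro mult_left_mono) auto
  also have "\<dots> = y ^ m" using assms by (simp add: power_divide)
  also have "c ^ m * (1 + real m * (y / c - 1)) = c ^ m + m * c ^ (m - 1) * (y - c)"
    using assms Suc by (simp add: field_simps)
  finally show ?thesis .
qed simp

lemma gE_one: "gint n (\<lambda>_. 1)" "gE n (\<lambda>_. 1) = 1"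
  using gint_poly_prod[of n "\<lambda>_. 1"] gE_poly_prod[of n "\<lambda>_. 1"] by simp_all

lemma gE_sqnorm: "gE n (sqnorm n) = n"
proof -
  have i: "gint n (\<lambda>x. (x i)\<^sup>2)" "gE n (\<lambda>x. (x i)\<^sup>2) = 1" if "i < n" for i
  proof -
    have eq: "(x i)\<^sup>2 = (\<Prod>j<n. poly (if j = i then monom 1 2 else 1) (x j))" for x :: "nat \<Rightarrow> real"
      using that by (simp add: if_distrib[of "\<lambda>p. poly p _"] poly_monom prod.delta cong: if_cong)
    show "gint n (\<lambda>x. (x i)\<^sup>2)" unfolding eq by (rule gint_poly_prod)
    have "gauss_poly (monom 1 2) = 1" using gauss_poly_monom_even[of 1] by (simp add: fact_numeral)
    then show "gE n (\<lambda>x. (x i)\<^sup>2) = 1" unfolding eq gE_poly_prod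
      using that by (simp add: if_distrib[of gauss_poly] prod.delta cong: if_cong)
  qed
  then have "gE n (\<lambda>x. \<Sum>i<n. (x i)\<^sup>2) = (\<Sum>i<n. 1)" by (subst gE_sum) auto
  then show ?thesis unfolding sqnorm_def[abs_def] by simp
qed

lemma gE_sqnorm_power_ge:
  assumes "n \<ge> 1"
  shows "real n ^ m \<le> gE n (\<lambda>x. sqnorm n x ^ m)"
proof -
  have g1: "gint n (sqnorm n)" using gint_sqnorm_power[of n 1] by simp
  have "gE n (\<lambda>x. real n ^ m * 1 + real m * real n ^ (m - 1) * (sqnorm n x - real n * 1)) \<le> gE n (\<lambda>x. sqnorm n x ^ m)"
    using assms power_tangent[of _ "real n" m]
    by (intro gE_mono gint_add gint_cmult gE_one gint_diff g1 gint_sqnorm_power) auto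
  also have "gE n (\<lambda>x. real n ^ m * 1 + real m * real n ^ (m - 1) * (sqnorm n x - real n * 1)) = real n ^ m"
    by (simp only: gE_add gint_add gint_cmult gE_one gint_diff g1 gE_cmult gE_diff gE_sqnorm) simp
  finally show ?thesis .
qed

text \<open>The power mean inequality, summed from the tangents at the average \<open>c\<close>,
  where the linear terms cancel.\<close>

lemma sum_power_le:
  fixes y :: "nat \<Rightarrow> real"
  assumes "\<And>i. i < n \<Longrightarrow> y i \<ge> 0" "n \<ge> 1"
  shows "(\<Sum>i<n. y i) ^ m \<le> real n ^ m / real n * (\<Sum>i<n. y i ^ m)"
proof (cases "(\<Sum>i<n. y i) = 0")
  case True
  then have "\<And>i. i < n \<Longrightarrow> y i = 0" using assms(1) sum_nonneg_eq_0_iff[of "{..<n}" y] by auto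
  then show ?thesis using True assms by (cases m) auto
next
  case False
  define c where "c = (\<Sum>i<n. y i) / n"
  have S: "(\<Sum>i<n. y i) = n * c" using assms by (simp add: c_def)
  have "0 \<le> (\<Sum>i<n. y i)" using assms by (intro sum_nonneg) auto
  then have c: "c > 0" using False assms by (simp add: c_def order_less_le)
  have "(\<Sum>i<n. c ^ m + m * c ^ (m - 1) * (y i - c)) \<le> (\<Sum>i<n. y i ^ m)"
    using assms c by (intro sum_mono power_tangent) auto
  also have "(\<Sum>i<n. c ^ m + m * c ^ (m - 1) * (y i - c)) = n * c ^ m"
    by (simp add: sum.distrib sum_subtractf S flip: sum_distrib_left)
  finally have "real n ^ m / n * (n * c ^ m) \<le> real n ^ m / n * (\<Sum>i<n. y i ^ m)"
    by (intro mult_left_mono) auto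
  then show ?thesis using assms by (simp add: S power_mult_distrib)
qed

text \<open>By the power mean inequality it is enough to bound the 2m-th moment of one coordinate,
  which is a linear form of norm 1.\<close>

lemma gE_sqnorm_power_le:
  assumes "n \<ge> 1" "m \<ge> 1"
  shows "gE n (\<lambda>x. sqnorm n x ^ m) \<le> 4 * fact (2 * m) * real n ^ m"
proof -
  have i: "gint n (\<lambda>x. (x i) ^ (2 * m))" "gE n (\<lambda>x. (x i) ^ (2 * m)) \<le> 4 * fact (2 * m)" if "i < n" for i
  proof -
    let ?u = "\<lambda>j. if j = i then 1 else 0 :: real"
    have eq: "(\<Sum>j<n. ?u j * x j) = x i" for x
      using that by (simp add: if_distrib[of "\<lambda>t. t * _"] cong: if_cong)
    have "sqnorm n ?u = 1" using that by (simp add: sqnorm_def if_distrib[of "\<lambda>t. t ^ 2"] cong: if_cong)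
    then show "gE n (\<lambda>x. (x i) ^ (2 * m)) \<le> 4 * fact (2 * m)"
      using gE_lin_power_unit[of n ?u m] by (simp add: eq)
    show "gint n (\<lambda>x. (x i) ^ (2 * m))" using gint_lin_power[of n ?u "2 * m"] by (simp add: eq)
  qed
  have "gE n (\<lambda>x. sqnorm n x ^ m) \<le> gE n (\<lambda>x. real n ^ m / n * (\<Sum>i<n. (x i) ^ (2 * m)))"
    using assms sum_power_le[of n "\<lambda>i. (_ i)\<^sup>2" m]
    by (intro gE_mono gint_sqnorm_power gint_cmult gint_sum i) (auto simp: sqnorm_def power_mult)
  also have "\<dots> = real n ^ m / n * (\<Sum>i<n. gE n (\<lambda>x. (x i) ^ (2 * m)))"
    using i by (subst gE_cmult, intro gint_sum, simp, subst gE_sum) auto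
  also have "\<dots> \<le> real n ^ m / n * (\<Sum>i<n. 4 * fact (2 * m))"
    using i by (intro mult_left_mono sum_mono) auto
  also have "\<dots> = 4 * fact (2 * m) * real n ^ m" using assms by simp
  finally show ?thesis .
qed

section \<open>Integration over the sphere\<close>

lemma poly_eval_measurable:
  assumes "f \<in> forms n m"
  shows "poly_eval f \<in> borel_measurable (Leb n)"
proof -
  have "mon a \<in> borel_measurable (Leb n)" if "a \<in> keys f" for a
    unfolding mon_def[abs_def] using assms that
    by (intro borel_measurable_prod borel_measurable_power component_measurable_Leb)
      (auto simp: forms_iff)
  then show ?thesis unfolding poly_eval_alt[abs_def] by measurable
qed

lemma space_sphere_measure: "space (sphere_measure n) = unit_sphere n"
  by (auto simp: sphere_measure_alt space_restrict_space unit_sphere_def space_Leb)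

lemma sphere_coord_le:
  assumes "x \<in> unit_sphere n" "i < n"
  shows "\<bar>x i\<bar> \<le> 1"
proof -
  have "(x i)\<^sup>2 \<le> sqnorm n x" unfolding sqnorm_def using assms(2) by (intro member_le_sum) auto
  then show ?thesis using assms(1) by (simp add: unit_sphere_def abs_square_le_1)
qed

lemma poly_eval_sphere_bound:
  assumes "f \<in> forms n m" "x \<in> unit_sphere n"
  shows "\<bar>poly_eval f x\<bar> \<le> (\<Sum>a\<in>keys f. \<bar>lookup f a\<bar>)"
proof -
  have "\<bar>mon a x\<bar> \<le> 1" if "a \<in> keys f" for a
    unfolding mon_def abs_prod using assms that sphere_coord_le[OF assms(2)]
    by (intro prod_le_1) (auto simp: forms_iff power_abs subset_iff intro!: power_le_one)
  then have "\<bar>lookup f a * mon a x\<bar> \<le> \<bar>lookup f a\<bar>" if "a \<in> keys f" for a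
    using that by (simp add: abs_mult mult_left_le)
  then show ?thesis unfolding poly_eval_alt
    by (intro order.trans[OF sum_abs] sum_mono) auto
qed

lemma measurable_sphere:
  "f \<in> forms n m \<Longrightarrow> poly_eval f \<in> borel_measurable (sphere_measure n)"
  unfolding sphere_measure_alt using poly_eval_measurable by (simp add: measurable_restrict_space1)

lemma integrable_sphere:
  assumes "f \<in> forms n m" "n \<ge> 1"
  shows "integrable (sphere_measure n) (poly_eval f)"
proof -
  interpret prob_space "sphere_measure n" using assms(2) by (rule prob_space_sphere_measure)
  show ?thesis using poly_eval_sphere_bound[OF assms(1)] measurable_sphere[OF assms(1)]
    by (intro integrable_const_bound AE_I2) (auto simp: space_sphere_measure)
qed

lemma sphere_integral_add:
  assumes "f \<in> forms n m" "g \<in> forms n p" "n \<ge> 1"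
  shows "sphere_integral n (f + g) = sphere_integral n f + sphere_integral n g"
  using integrable_sphere[OF assms(1,3)] integrable_sphere[OF assms(2,3)]
  by (simp add: sphere_integral_def poly_eval_add)

lemma sphere_integral_scaleR: "sphere_integral n (c *\<^sub>R f) = c * sphere_integral n f"
  by (simp add: sphere_integral_def poly_eval_scaleR)

lemma sphere_integral_0 [simp]: "sphere_integral n 0 = 0"
  by (simp add: sphere_integral_def)

lemma sphere_integral_diff:
  assumes "f \<in> forms n m" "g \<in> forms n p" "n \<ge> 1"
  shows "sphere_integral n (f - g) = sphere_integral n f - sphere_integral n g"
  using integrable_sphere[OF assms(1,3)] integrable_sphere[OF assms(2,3)]
  by (simp add: sphere_integral_def poly_eval_diff)

lemma sphere_integral_sum:
  assumes "\<And>i. i \<in> A \<Longrightarrow> f i \<in> forms n m" "n \<ge> 1"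
  shows "sphere_integral n (\<Sum>i\<in>A. f i) = (\<Sum>i\<in>A. sphere_integral n (f i))"
  unfolding sphere_integral_def poly_eval_sum
  by (rule Bochner_Integration.integral_sum) (use assms integrable_sphere in blast)

lemma sphere_integral_nonneg:
  "(\<And>x. x \<in> unit_sphere n \<Longrightarrow> poly_eval f x \<ge> 0) \<Longrightarrow> sphere_integral n f \<ge> 0"
  unfolding sphere_integral_def by (intro integral_nonneg_AE AE_I2) (auto simp: space_sphere_measure)

lemma sphere_integral_r_pow:
  assumes "n \<ge> 1"
  shows "sphere_integral n (r_pow n k) = 1"
proof -
  interpret prob_space "sphere_measure n" using assms by (rule prob_space_sphere_measure)
  have "sphere_integral n (r_pow n k) = (LINT x|sphere_measure n. 1)"
    unfolding sphere_integral_def poly_eval_r_pow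
    by (intro Bochner_Integration.integral_cong) (auto simp: space_sphere_measure unit_sphere_def)
  then show ?thesis by (simp add: prob_space)
qed

lemma form_inner_eq: "form_inner n f g = sphere_integral n (f * g)"
  by (simp add: form_inner_def sphere_integral_def poly_eval_mult)

section \<open>Polar decomposition and comparison with the Gaussian\<close>

lemma nn_integral_Leb_aff:
  assumes "t > 0" and [measurable]: "h \<in> borel_measurable (Leb n)"
  shows "integral\<^sup>N (Leb n) h = ennreal (t ^ n) * (\<integral>\<^sup>+x. h (aff n t v x) \<partial>Leb n)"
proof -
  have "integral\<^sup>N (Leb n) h = integral\<^sup>N (scale_measure (ennreal (t ^ n)) (distr (Leb n) (Leb n) (aff n t v))) h"
    using Leb_eq_scale_distr_aff[OF assms(1), of n v] by simp
  then show ?thesis by (simp add: nn_integral_scale_measure nn_integral_distr)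
qed

text \<open>Functions of the direction only. The value 0 at the origin makes
  \<open>rad n \<phi> t\<close> vanish for every \<open>t \<le> 0\<close> without appeal to null
  sets.\<close>

definition hom0 :: "nat \<Rightarrow> ((nat \<Rightarrow> real) \<Rightarrow> ennreal) \<Rightarrow> bool" where
  "hom0 n \<phi> \<longleftrightarrow> \<phi> \<in> borel_measurable (Leb n) \<and>
    (\<forall>t>0. \<forall>x. \<phi> (aff n t (\<lambda>_. 0) x) = \<phi> x) \<and> (\<forall>x. sqnorm n x = 0 \<longrightarrow> \<phi> x = 0)"

definition rad :: "nat \<Rightarrow> ((nat \<Rightarrow> real) \<Rightarrow> ennreal) \<Rightarrow> real \<Rightarrow> ennreal" where
  "rad n \<phi> t = (\<integral>\<^sup>+x. \<phi> x * indicator {..t} (sqnorm n x) \<partial>Leb n)"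

lemma rad_scale:
  assumes "hom0 n \<phi>"
  shows "rad n \<phi> t = (if t > 0 then ennreal (sqrt t ^ n) * rad n \<phi> 1 else 0)"
proof (cases "t > 0")
  case True
  have [measurable]: "\<phi> \<in> borel_measurable (Leb n)" using assms by (simp add: hom0_def)
  have sq: "sqnorm n (aff n (sqrt t) (\<lambda>_. 0) x) = t * sqnorm n x" for x
    using True by (simp add: sqnorm_def aff_def power_mult_distrib sum_distrib_left)
  have "rad n \<phi> t = ennreal (sqrt t ^ n) *
      (\<integral>\<^sup>+x. \<phi> (aff n (sqrt t) (\<lambda>_. 0) x) * indicator {..t} (sqnorm n (aff n (sqrt t) (\<lambda>_. 0) x)) \<partial>Leb n)"
    unfolding rad_def using True by (intro nn_integral_Leb_aff) auto
  also have "(\<integral>\<^sup>+x. \<phi> (aff n (sqrt t) (\<lambda>_. 0) x) * indicator {..t} (sqnorm n (aff n (sqrt t) (\<lambda>_. 0) x)) \<partial>Leb n)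
      = rad n \<phi> 1"
    unfolding rad_def sq using assms True
    by (intro nn_integral_cong) (auto simp: hom0_def indicator_def)
  finally show ?thesis using True by simp
next
  case False
  have "\<phi> x * indicator {..t} (sqnorm n x) = 0" for x
    using assms False sqnorm_nonneg[of n x] unfolding hom0_def
    by (cases "sqnorm n x = 0") (simp_all add: indicator_def del: sqnorm_nonneg)
  then have "rad n \<phi> t = 0" unfolding rad_def by (simp only: nn_integral_const mult_zero_left)
  then show ?thesis using False by simp
qed

text \<open>Polar coordinates without a surface measure: under the densities \<phi> and \<psi> the
  squared norm has distribution functions that are both multiples of t^(n/2). After
  cross-multiplication they agree on all half-lines, hence as measures, and \<open>w\<close> can be
  integrated.\<close>

lemma radial_integrals_proportional:
  assumes \<phi>: "hom0 n \<phi>" "rad n \<phi> 1 < \<infinity>" and \<psi>: "hom0 n \<psi>" "rad n \<psi> 1 < \<infinity>"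
    and [measurable]: "w \<in> borel_measurable borel"
  shows "rad n \<psi> 1 * (\<integral>\<^sup>+x. \<phi> x * w (sqnorm n x) \<partial>Leb n) =
    rad n \<phi> 1 * (\<integral>\<^sup>+x. \<psi> x * w (sqnorm n x) \<partial>Leb n)"
proof -
  have [measurable]: "\<phi> \<in> borel_measurable (Leb n)" "\<psi> \<in> borel_measurable (Leb n)"
    using \<phi> \<psi> by (simp_all add: hom0_def)
  define M where "M = (\<lambda>\<phi>. distr (density (Leb n) \<phi>) borel (sqnorm n))"
  have M: "emeasure (M \<theta>) {..t} = rad n \<theta> t" if [measurable]: "\<theta> \<in> borel_measurable (Leb n)" for \<theta> t
  proof -
    have "emeasure (M \<theta>) {..t} = emeasure (density (Leb n) \<theta>) (sqnorm n -` {..t} \<inter> space (Leb n))"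
      unfolding M_def by (subst emeasure_distr) auto
    also have "\<dots> = (\<integral>\<^sup>+x. \<theta> x * indicator (sqnorm n -` {..t} \<inter> space (Leb n)) x \<partial>Leb n)"
      by (subst emeasure_density) auto
    also have "\<dots> = rad n \<theta> t"
      unfolding rad_def by (intro nn_integral_cong) (auto simp: indicator_def)
    finally show ?thesis .
  qed
  have I: "(\<integral>\<^sup>+s. w s \<partial>M \<theta>) = (\<integral>\<^sup>+x. \<theta> x * w (sqnorm n x) \<partial>Leb n)"
    if [measurable]: "\<theta> \<in> borel_measurable (Leb n)" for \<theta>
    unfolding M_def by (subst nn_integral_distr) (auto simp: nn_integral_density)
  have "scale_measure (rad n \<psi> 1) (M \<phi>) = scale_measure (rad n \<phi> 1) (M \<psi>)"
  proof (rule measure_eqI_generator_eq[where E = "range atMost" and \<Omega> = UNIV and A = "\<lambda>i. {..real i}"])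
    show "Int_stable (range (atMost :: real \<Rightarrow> _))" by (auto simp: Int_stable_def)
    fix X :: "real set" assume "X \<in> range atMost"
    then obtain t where t: "X = {..t}" by auto
    show "emeasure (scale_measure (rad n \<psi> 1) (M \<phi>)) X = emeasure (scale_measure (rad n \<phi> 1) (M \<psi>)) X"
      by (simp add: t M rad_scale[OF \<phi>(1), of t] rad_scale[OF \<psi>(1), of t] mult_ac)
  next
    show "sets (scale_measure (rad n \<psi> 1) (M \<phi>)) = sigma_sets UNIV (range atMost)"
      "sets (scale_measure (rad n \<phi> 1) (M \<psi>)) = sigma_sets UNIV (range atMost)"
      by (simp_all add: M_def borel_eq_atMost)
    show "(\<Union>i. {..real i}) = UNIV" by (auto intro: real_arch_simple)
    fix i
    show "emeasure (scale_measure (rad n \<psi> 1) (M \<phi>)) {..real i} \<noteq> \<infinity>"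
      using \<phi>(2) \<psi>(2) by (auto simp: M rad_scale[OF \<phi>(1), of "real i"] ennreal_mult_eq_top_iff)
  qed auto
  then have "(\<integral>\<^sup>+s. w s \<partial>scale_measure (rad n \<psi> 1) (M \<phi>)) = (\<integral>\<^sup>+s. w s \<partial>scale_measure (rad n \<phi> 1) (M \<psi>))"
    by simp
  moreover have "w \<in> borel_measurable (M \<theta>)" for \<theta> by (simp add: M_def)
  ultimately show ?thesis by (simp add: nn_integral_scale_measure I)
qed

text \<open>\<open>ennreal\<close> truncates negative values, so this represents \<open>f\<close>
  faithfully where \<open>f\<close> is nonnegative, which is how it is used.\<close>

definition angular :: "nat \<Rightarrow> rpoly \<Rightarrow> (nat \<Rightarrow> real) \<Rightarrow> ennreal" where
  "angular n f x = ennreal (poly_eval f (normalize_vec n x)) * indicator {0<..} (sqnorm n x)"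

lemma normalize_vec_measurable_Leb [measurable]: "normalize_vec n \<in> Leb n \<rightarrow>\<^sub>M Leb n"
  unfolding normalize_vec_def[abs_def]
  by (intro restrict_measurable_Leb borel_measurable_divide component_measurable_Leb
      measurable_compose[OF sqnorm_measurable]) auto

lemma hom0_angular:
  assumes "f \<in> forms n m"
  shows "hom0 n (angular n f)"
  unfolding hom0_def
proof (intro conjI allI impI)
  note [measurable] = poly_eval_measurable[OF assms]
  show "angular n f \<in> borel_measurable (Leb n)" unfolding angular_def[abs_def] by measurable
  fix t :: real and x :: "nat \<Rightarrow> real" assume t: "t > 0"
  have sq: "sqnorm n (aff n t (\<lambda>_. 0) x) = t\<^sup>2 * sqnorm n x" for x
    by (simp add: sqnorm_def aff_def power_mult_distrib sum_distrib_left)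
  have "normalize_vec n (aff n t (\<lambda>_. 0) x) = normalize_vec n x"
    using t unfolding normalize_vec_def sq by (auto simp: real_sqrt_mult aff_def fun_eq_iff)
  then show "angular n f (aff n t (\<lambda>_. 0) x) = angular n f x"
    using t by (simp add: angular_def sq indicator_def zero_less_mult_iff)
qed (simp add: angular_def)

lemma poly_eval_normalize:
  assumes "f \<in> forms n (2 * m)"
  shows "poly_eval f x = sqnorm n x ^ m * poly_eval f (normalize_vec n x)"
proof -
  have "poly_eval f x = poly_eval f (\<lambda>i. sqrt (sqnorm n x) * normalize_vec n x i)"
    using assms by (rule poly_eval_cong) (auto simp: normalize_vec_def dest: sqnorm_eq_0D)
  also have "\<dots> = sqrt (sqnorm n x) ^ (2 * m) * poly_eval f (normalize_vec n x)"
    by (rule poly_eval_homogeneous[OF assms])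
  finally show ?thesis by (simp add: power_mult)
qed

lemma nn_integral_sphere:
  assumes "f \<in> forms n m"
  shows "(\<integral>\<^sup>+x. ennreal (poly_eval f x) \<partial>sphere_measure n) =
    rad n (angular n f) 1 / emeasure (Leb n) (punctured_ball n)"
proof -
  note [measurable] = poly_eval_measurable[OF assms]
  let ?P = "punctured_ball n"
  have "(\<integral>\<^sup>+x. ennreal (poly_eval f x) \<partial>sphere_measure n) =
      (\<integral>\<^sup>+x. ennreal (poly_eval f (normalize_vec n x)) \<partial>unif_ball n)"
    unfolding sphere_measure_alt using normalize_vec_measurable
    by (subst nn_integral_distr) (auto simp: measurable_restrict_space1)
  also have "\<dots> = (\<integral>\<^sup>+x. ennreal (poly_eval f (normalize_vec n x)) * indicator ?P x \<partial>uniform_measure (Leb n) ?P)"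
    by (subst nn_integral_restrict_space) auto
  also have "\<dots> = (\<integral>\<^sup>+x. ennreal (poly_eval f (normalize_vec n x)) * indicator ?P x * indicator ?P x \<partial>Leb n) / emeasure (Leb n) ?P"
    by (subst nn_integral_uniform_measure) auto
  also have "(\<integral>\<^sup>+x. ennreal (poly_eval f (normalize_vec n x)) * indicator ?P x * indicator ?P x \<partial>Leb n) =
      rad n (angular n f) 1"
    unfolding rad_def angular_def
    by (intro nn_integral_cong) (auto simp: indicator_def punctured_ball_def space_Leb)
  finally show ?thesis .
qed

text \<open>Forms of the same degree 2m share the radial factor, the m-th power of
  \<open>sqnorm\<close>; only the angular parts differ. Comparing \<open>f\<close> with
  \<open>r_pow n m\<close>, whose mean on the sphere is 1, therefore determines the ratio of the two
  integrals. Nonnegativity allows the comparison in \<open>ennreal\<close>.\<close>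

theorem gaussian_sphere:
  assumes f: "f \<in> forms n (2 * m)" and m: "m \<ge> 1" and n: "n \<ge> 1" and nonneg: "\<And>x. poly_eval f x \<ge> 0"
  shows "gE n (poly_eval f) = sphere_integral n f * gE n (\<lambda>x. sqnorm n x ^ m)"
proof -
  let ?V = "emeasure (Leb n) (punctured_ball n)"
  have V: "?V \<noteq> 0" "?V \<noteq> \<infinity>"
    using emeasure_punctured_ball_pos[OF n] emeasure_punctured_ball_finite[of n] by auto
  have radV: "rad n (angular n g) 1 = ?V * ennreal (sphere_integral n g)"
    if g: "g \<in> forms n d" "\<And>x. poly_eval g x \<ge> 0" for g d
  proof -
    have "rad n (angular n g) 1 / ?V = ennreal (sphere_integral n g)"
      using nn_integral_sphere[OF g(1)] nn_integral_eq_integral[OF integrable_sphere[OF g(1) n]] g(2)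
      by (simp add: sphere_integral_def)
    moreover have "rad n (angular n g) 1 = rad n (angular n g) 1 / ?V * ?V"
      using V by (simp add: ennreal_divide_times ennreal_divide_self less_top)
    ultimately show ?thesis by (simp add: mult.commute)
  qed
  have r: "r_pow n m \<in> forms n (2 * m)" "poly_eval (r_pow n m) x \<ge> 0" for x
    by (simp_all add: r_pow_in_forms poly_eval_r_pow)
  define w where "w = (\<lambda>s. ennreal ((1 / sqrt (2 * pi)) ^ n * exp (- s / 2) * s ^ m))"
  have wm: "w \<in> borel_measurable borel" unfolding w_def by measurable
  have I: "(\<integral>\<^sup>+x. angular n g x * w (sqnorm n x) \<partial>Leb n) = ennreal (gE n (poly_eval g))"
    if g: "g \<in> forms n (2 * m)" "\<And>x. poly_eval g x \<ge> 0" for g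
  proof -
    have "angular n g x * w (sqnorm n x) = ennreal (gw n x * poly_eval g x)" for x
    proof (cases "sqnorm n x > 0")
      case True
      then show ?thesis using g(2)
        by (simp add: angular_def w_def gw_radial poly_eval_normalize[OF g(1), of x] mult_ac flip: ennreal_mult')
    next
      case False
      then have "sqnorm n x = 0" using sqnorm_nonneg[of n x] by linarith
      \<comment> \<open>At the origin \<open>angular\<close> is 0 by definition, and
        \<open>f\<close> vanishes because its degree is positive.\<close>
      then show ?thesis using m by (simp add: angular_def poly_eval_normalize[OF g(1), of x] zero_power)
    qed
    then show ?thesis
      using gint_poly_eval[OF g(1)] g(2) unfolding gE_def gint_def
      by (simp add: nn_integral_eq_integral gw_nonneg)
  qed
  have fin: "rad n (angular n g) 1 < \<infinity>" if g: "g \<in> forms n d" "\<And>x. poly_eval g x \<ge> 0" for g d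
    using radV[OF g] V by (simp add: ennreal_mult_less_top less_top)
  have "rad n (angular n (r_pow n m)) 1 * (\<integral>\<^sup>+x. angular n f x * w (sqnorm n x) \<partial>Leb n) =
      rad n (angular n f) 1 * (\<integral>\<^sup>+x. angular n (r_pow n m) x * w (sqnorm n x) \<partial>Leb n)"
    by (intro radial_integrals_proportional hom0_angular[OF f] hom0_angular[OF r(1)] fin[OF f nonneg] fin[OF r] wm)
  then have "?V * ennreal (gE n (poly_eval f)) =
      ?V * ennreal (sphere_integral n f) * ennreal (gE n (poly_eval (r_pow n m)))"
    by (simp add: I[OF f nonneg] I[OF r] radV[OF f nonneg] radV[OF r] sphere_integral_r_pow[OF n])
  then have "ennreal (gE n (poly_eval f)) = ennreal (sphere_integral n f) * ennreal (gE n (poly_eval (r_pow n m)))"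
    using V by (simp add: mult.assoc ennreal_mult_cancel_left)
  also have "\<dots> = ennreal (sphere_integral n f * gE n (poly_eval (r_pow n m)))"
    by (rule ennreal_mult'[symmetric]) (simp add: sphere_integral_nonneg nonneg)
  finally have "gE n (poly_eval f) = sphere_integral n f * gE n (poly_eval (r_pow n m))"
    by (subst (asm) ennreal_inj) (auto intro!: gE_nonneg mult_nonneg_nonneg sphere_integral_nonneg nonneg r)
  then show ?thesis by (simp add: poly_eval_r_pow[abs_def])
qed

lemma form_inner_eq_gE:
  assumes "f \<in> forms n d" "d \<ge> 1" "n \<ge> 1"
  shows "gE n (\<lambda>x. (poly_eval f x)\<^sup>2) = form_inner n f f * gE n (\<lambda>x. sqnorm n x ^ d)"
proof -
  have "f * f \<in> forms n (2 * d)" using forms_mult[OF assms(1,1)] by (simp add: mult_2)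
  from gaussian_sphere[OF this assms(2,3)] show ?thesis
    by (simp add: form_inner_eq poly_eval_mult[abs_def] power2_eq_square)
qed

lemma form_inner_nonneg: "form_inner n f f \<ge> 0"
  unfolding form_inner_eq by (intro sphere_integral_nonneg) (simp add: poly_eval_mult)

text \<open>The constant common to the moment bounds \<open>gE_lin_power\<close> and
  \<open>gE_sqnorm_power_le\<close>.\<close>

definition cg :: "nat \<Rightarrow> real" where
  "cg m = 4 * fact (2 * m)"

lemma cg_ge_1: "cg m \<ge> 1"
proof -
  have "(1 :: real) \<le> fact (2 * m)" by (rule fact_ge_1)
  then show ?thesis unfolding cg_def by linarith
qed

text \<open>The factor \<open>n ^ d\<close> is the change of scale: a Gaussian vector has squared
  norm about n, a point of the sphere has squared norm 1.\<close>

lemma coeffs_le_sphere_norm: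
  assumes "f \<in> forms n d" "d \<ge> 1" "n \<ge> 1"
  shows "(\<Sum>a\<in>keys f. (lookup f a)\<^sup>2) \<le> cg d * real n ^ d * form_inner n f f"
proof -
  have "(\<Sum>a\<in>keys f. (lookup f a)\<^sup>2) \<le> form_inner n f f * gE n (\<lambda>x. sqnorm n x ^ d)"
    using coeffs_le_gauss_norm[OF assms(1)] form_inner_eq_gE[OF assms] by simp
  also have "\<dots> \<le> form_inner n f f * (cg d * real n ^ d)"
    using gE_sqnorm_power_le[of n d] assms unfolding cg_def
    by (intro mult_left_mono form_inner_nonneg) auto
  finally show ?thesis by (simp add: mult_ac)
qed

lemma form_inner_eq_0D:
  assumes "f \<in> forms n d" "d \<ge> 1" "n \<ge> 1" "form_inner n f f = 0"
  shows "f = 0"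
proof -
  have "(\<Sum>a\<in>keys f. (lookup f a)\<^sup>2) \<le> 0"
    using coeffs_le_sphere_norm[OF assms(1-3)] assms(4) by simp
  then have "(\<Sum>a\<in>keys f. (lookup f a)\<^sup>2) = 0"
    by (intro antisym sum_nonneg) auto
  then have "\<forall>a\<in>keys f. lookup f a = 0"
    by (subst (asm) sum_nonneg_eq_0_iff) auto
  then show ?thesis by (intro poly_mapping_eqI) (auto simp: in_keys_iff)
qed

text \<open>The norm dominates the coefficients, so identities between forms, such as polarisation,
  may be checked pointwise.\<close>

lemma form_eqI:
  assumes "f \<in> forms n d" "g \<in> forms n d" "d \<ge> 1" "n \<ge> 1" "\<And>x. poly_eval f x = poly_eval g x"
  shows "f = g"
proof -
  have "form_inner n (f - g) (f - g) = 0"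
    by (simp add: form_inner_def poly_eval_diff assms(5))
  then have "f - g = 0" using assms by (intro form_inner_eq_0D[of _ n d] forms_diff) auto
  then show ?thesis by simp
qed

text \<open>The ratio of two Gaussian moments: the numerator is at most
  \<open>cg m * sqnorm n u ^ m\<close>, the denominator at least \<open>n ^ m\<close>.\<close>

lemma lin_power_integral_le:
  assumes "m \<ge> 1" "n \<ge> 1"
  shows "sphere_integral n (lin n u ^ (2 * m)) \<le> cg m * sqnorm n u ^ m / real n ^ m"
proof -
  let ?S = "sphere_integral n (lin n u ^ (2 * m))"
  have S: "?S \<ge> 0" by (intro sphere_integral_nonneg) (simp add: poly_eval_power power_mult)
  have "?S * real n ^ m \<le> ?S * gE n (\<lambda>x. sqnorm n x ^ m)"
    using gE_sqnorm_power_ge[OF assms(2)] S by (intro mult_left_mono)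
  also have "\<dots> = gE n (poly_eval (lin n u ^ (2 * m)))"
    using assms by (intro gaussian_sphere[symmetric] lin_power_in_forms) (auto simp: poly_eval_power power_mult)
  also have "\<dots> \<le> cg m * sqnorm n u ^ m"
    using gE_lin_power[OF assms(1), of n u] by (simp add: poly_eval_power[abs_def] poly_eval_lin cg_def)
  finally show ?thesis using assms(2) by (simp add: field_simps)
qed

text \<open>Bessel's inequality in degree 1, divided by the Gaussian expectation n of
  \<open>sqnorm\<close>.\<close>

lemma lin_square_integral_ge:
  assumes "n \<ge> 1"
  shows "sqnorm n u / n \<le> sphere_integral n (lin n u ^ 2)"
proof -
  let ?f = "lin n u"
  have "inj_on (\<lambda>i. single i (1 :: nat)) {..<n}"
    by (auto simp: inj_on_def single_nat_eq_iff)
  then have "(\<Sum>a\<in>(\<lambda>i. single i 1) ` {..<n}. (lookup ?f a)\<^sup>2) = sqnorm n u"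
    by (subst sum.reindex) (auto simp: lookup_lin[unfolded One_nat_def] sqnorm_def)
  moreover have "keys ?f \<subseteq> (\<lambda>i. single i 1) ` {..<n}"
  proof
    fix a assume a: "a \<in> keys ?f"
    then have "mdeg a = 1" using lin_in_forms[of n u] by (auto simp: forms_iff)
    then obtain i where i: "a = single i 1" using mdeg_1D by blast
    then have "i < n" using a lookup_lin[of n u i] by (auto simp: in_keys_iff split: if_splits)
    then show "a \<in> (\<lambda>i. single i 1) ` {..<n}" using i by auto
  qed
  then have "(\<Sum>a\<in>keys ?f. (lookup ?f a)\<^sup>2) =
      (\<Sum>a\<in>(\<lambda>i. single i 1) ` {..<n}. (lookup ?f a)\<^sup>2)"
    by (intro sum.mono_neutral_left) (auto simp: in_keys_iff)
  ultimately have "sqnorm n u \<le> gE n (\<lambda>x. (poly_eval ?f x)\<^sup>2)"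
    using coeffs_le_gauss_norm[OF lin_in_forms, of n u] by simp
  also have "\<dots> = form_inner n ?f ?f * gE n (\<lambda>x. sqnorm n x ^ 1)"
    using assms by (intro form_inner_eq_gE lin_in_forms) auto
  also have "\<dots> = sphere_integral n (lin n u ^ 2) * n"
    by (simp add: gE_sqnorm form_inner_eq power2_eq_square)
  finally show ?thesis using assms by (simp add: field_simps)
qed

text \<open>Jensen's inequality in tangent form; since the slope is nonnegative, a lower bound for
  the second moment is enough.\<close>

lemma lin_power_integral_ge:
  assumes "m \<ge> 1" "n \<ge> 1"
  shows "(sqnorm n u / n) ^ m \<le> sphere_integral n (lin n u ^ (2 * m))"
proof (cases "sqnorm n u = 0")
  case True
  then show ?thesis using assms
    by (auto simp: zero_power intro!: sphere_integral_nonneg) (simp add: poly_eval_power power_mult)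
next
  case False
  interpret prob_space "sphere_measure n" using assms(2) by (rule prob_space_sphere_measure)
  define c where "c = sqnorm n u / n"
  have c: "c > 0" using False assms sqnorm_nonneg[of n u] by (simp add: c_def order_less_le)
  have i2: "integrable (sphere_measure n) (\<lambda>x. (poly_eval (lin n u) x)\<^sup>2)"
    using integrable_sphere[OF lin_power_in_forms assms(2), of u 2] by (simp add: poly_eval_power[abs_def])
  have "c ^ m \<le> c ^ m + m * c ^ (m - 1) * (sphere_integral n (lin n u ^ 2) - c)"
    using lin_square_integral_ge[OF assms(2), of u] c by (simp add: c_def)
  also have "\<dots> = (LINT x|sphere_measure n. c ^ m + m * c ^ (m - 1) * ((poly_eval (lin n u) x)\<^sup>2 - c))"
    using i2 by (simp add: sphere_integral_def poly_eval_power prob_space)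
  also have "\<dots> \<le> (LINT x|sphere_measure n. poly_eval (lin n u ^ (2 * m)) x)"
  proof (rule integral_mono)
    fix x show "c ^ m + m * c ^ (m - 1) * ((poly_eval (lin n u) x)\<^sup>2 - c) \<le> poly_eval (lin n u ^ (2 * m)) x"
      using power_tangent[of "(poly_eval (lin n u) x)\<^sup>2" c m] c by (simp add: poly_eval_power power_mult)
  qed (use i2 integrable_sphere[OF lin_power_in_forms assms(2)] in auto)
  finally show ?thesis by (simp add: c_def sphere_integral_def)
qed

section \<open>Writing a form as a difference of sums of powers\<close>

text \<open>The mean on the sphere is the cost of a cone element. It is additive, and an element of
  cost at most 1 can be completed to mean exactly 1, so for \<open>f\<close> of mean zero
  \<open>rep n k 1 f\<close> places \<open>f\<close> in the difference body of
  \<open>Lf_tilde n k\<close>.\<close>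

definition rep :: "nat \<Rightarrow> nat \<Rightarrow> real \<Rightarrow> rpoly \<Rightarrow> bool" where
  "rep n k R f \<longleftrightarrow> (\<exists>F\<in>Lf n k. \<exists>G\<in>Lf n k. f = F - G \<and> sphere_integral n F \<le> R \<and> sphere_integral n G \<le> R)"

lemma rep_mono: "rep n k R f \<Longrightarrow> R \<le> R' \<Longrightarrow> rep n k R' f"
  unfolding rep_def by (meson order.trans)

lemma rep_0: "rep n k 0 0"
  unfolding rep_def using Lf_zero[of n k] by (intro bexI[of _ 0]) auto

lemma rep_add:
  assumes "n \<ge> 1" "rep n k R f" "rep n k S g"
  shows "rep n k (R + S) (f + g)"
proof -
  obtain F G where F: "F \<in> Lf n k" "G \<in> Lf n k" "f = F - G" "sphere_integral n F \<le> R" "sphere_integral n G \<le> R"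
    using assms(2) unfolding rep_def by blast
  obtain F' G' where F': "F' \<in> Lf n k" "G' \<in> Lf n k" "g = F' - G'" "sphere_integral n F' \<le> S" "sphere_integral n G' \<le> S"
    using assms(3) unfolding rep_def by blast
  have "sphere_integral n (F + F') \<le> R + S" "sphere_integral n (G + G') \<le> R + S"
    using F F' assms(1) by (simp_all add: sphere_integral_add[OF Lf_subset_forms Lf_subset_forms])
  moreover have "f + g = (F + F') - (G + G')" using F F' by simp
  ultimately show ?thesis unfolding rep_def using F F' Lf_add by blast
qed

lemma rep_scaleR:
  assumes "k \<ge> 1" "rep n k R f"
  shows "rep n k (\<bar>c\<bar> * R) (c *\<^sub>R f)"
proof -
  obtain F G where F: "F \<in> Lf n k" "G \<in> Lf n k" "f = F - G" "sphere_integral n F \<le> R" "sphere_integral n G \<le> R"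
    using assms(2) unfolding rep_def by blast
  have *: "\<bar>c\<bar> *\<^sub>R F \<in> Lf n k" "\<bar>c\<bar> *\<^sub>R G \<in> Lf n k"
    "sphere_integral n (\<bar>c\<bar> *\<^sub>R F) \<le> \<bar>c\<bar> * R" "sphere_integral n (\<bar>c\<bar> *\<^sub>R G) \<le> \<bar>c\<bar> * R"
    using F assms(1) by (auto intro!: Lf_scaleR mult_left_mono simp: sphere_integral_scaleR)
  show ?thesis
  proof (cases "c \<ge> 0")
    case True
    then have "c *\<^sub>R f = \<bar>c\<bar> *\<^sub>R F - \<bar>c\<bar> *\<^sub>R G" using F by (simp add: scaleR_diff_right)
    then show ?thesis unfolding rep_def using * by blast
  next
    case False
    then have "c *\<^sub>R f = \<bar>c\<bar> *\<^sub>R G - \<bar>c\<bar> *\<^sub>R F" using F by (simp add: scaleR_diff_right)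
    then show ?thesis unfolding rep_def using * by blast
  qed
qed

lemma rep_sum:
  assumes "n \<ge> 1" "\<And>i. i \<in> A \<Longrightarrow> rep n k (R i) (f i)"
  shows "rep n k (\<Sum>i\<in>A. R i) (\<Sum>i\<in>A. f i)"
  using assms(2) by (induction A rule: infinite_finite_induct) (auto intro: rep_0 rep_add[OF assms(1)])

lemma rep_lin_power:
  assumes "k \<ge> 1" "n \<ge> 1" "sqnorm n u \<le> s"
  shows "rep n k (cg k * s ^ k / real n ^ k) (lin n u ^ (2 * k))"
proof -
  have "sphere_integral n (lin n u ^ (2 * k)) \<le> cg k * sqnorm n u ^ k / real n ^ k"
    by (rule lin_power_integral_le[OF assms(1,2)])
  also have "\<dots> \<le> cg k * s ^ k / real n ^ k"
    using assms(3) cg_ge_1[of k] by (intro divide_right_mono mult_left_mono power_mono) auto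
  finally have *: "sphere_integral n (lin n u ^ (2 * k)) \<le> cg k * s ^ k / real n ^ k" .
  have "0 \<le> s" using assms(3) sqnorm_nonneg[of n u] by linarith
  then have "0 \<le> cg k * s ^ k / real n ^ k" using cg_ge_1[of k] by auto
  then show ?thesis
    unfolding rep_def using Lf_lin_power[of n u k] Lf_zero[of n k] * by (intro bexI[of _ "lin n u ^ (2 * k)"] bexI[of _ 0]) auto
qed

section \<open>Polarisation of products of linear forms\<close>

definition signs :: "nat \<Rightarrow> (nat \<Rightarrow> real) set" where
  "signs p = Pi\<^sub>E {..<p} (\<lambda>_. {-1, 1})"

lemma finite_signs: "finite (signs p)" and card_signs: "card (signs p) = 2 ^ p"
  unfolding signs_def by (auto intro!: finite_PiE simp: card_PiE numeral_2_eq_2)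

lemma signs_cases: "\<delta> \<in> signs p \<Longrightarrow> i < p \<Longrightarrow> \<delta> i = - 1 \<or> \<delta> i = 1"
  using PiE_mem[of \<delta> "{..<p}" "\<lambda>_. {-1, 1}" i] by (simp add: signs_def)

lemma signs_square: "\<delta> \<in> signs p \<Longrightarrow> i < p \<Longrightarrow> \<delta> i * \<delta> i = 1"
  and signs_abs: "\<delta> \<in> signs p \<Longrightarrow> i < p \<Longrightarrow> \<bar>\<delta> i\<bar> = 1"
  using signs_cases by force+

text \<open>The polarisation identity; the statement for arbitrary subsets \<open>J\<close> is what makes the induction on \<open>q\<close> work.\<close>

lemma polarisation:
  fixes y :: "nat \<Rightarrow> real"
  assumes "J \<subseteq> {..<p}" "q \<le> card J"
  shows "(\<Sum>\<delta>\<in>signs p. (\<Prod>j\<in>J. \<delta> j) * (\<Sum>i<p. \<delta> i * y i) ^ q) =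
    (if card J = q then 2 ^ p * fact q * (\<Prod>j\<in>J. y j) else 0)"
  using assms
proof (induction q arbitrary: J)
  case 0
  have "(\<Sum>\<delta>\<in>signs p. (\<Prod>j\<in>J. \<delta> j)) = (\<Sum>\<delta>\<in>signs p. \<Prod>i<p. if i \<in> J then \<delta> i else 1)"
    using 0(1) by (intro sum.cong refl) (simp add: prod.If_cases Int_absorb1)
  also have "\<dots> = (\<Prod>i<p. \<Sum>s\<in>{-1, 1}. if i \<in> J then s else 1)"
    unfolding signs_def by (rule prod_sum_PiE[symmetric]) auto
  also have "\<dots> = (\<Prod>i<p. if i \<in> J then 0 else 2)" by (intro prod.cong) auto
  also have "\<dots> = (if J = {} then 2 ^ p else 0)"
  proof (cases "J = {}")
    case False
    then obtain j where "j \<in> J" "j < p" using 0(1) by auto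
    then show ?thesis using False by (auto intro!: prod_zero)
  qed simp
  finally show ?case using 0(1) finite_subset[OF 0(1)] by auto
next
  case (Suc q)
  have fJ: "finite J" using finite_subset[OF Suc.prems(1)] by simp
  let ?T = "\<lambda>J. \<Sum>\<delta>\<in>signs p. (\<Prod>j\<in>J. \<delta> j) * (\<Sum>i<p. \<delta> i * y i) ^ q"
  \<comment> \<open>One factor of the power is split off and expanded over \<open>i\<close>. For
    \<open>i\<close> in \<open>J\<close> the two signs cancel and \<open>J\<close> loses
    \<open>i\<close>; for \<open>i\<close> outside, \<open>J\<close> grows beyond the remaining
    exponent and the induction hypothesis gives 0.\<close>
  have "(\<Sum>\<delta>\<in>signs p. (\<Prod>j\<in>J. \<delta> j) * (\<Sum>i<p. \<delta> i * y i) ^ Suc q) =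
      (\<Sum>\<delta>\<in>signs p. \<Sum>i<p. y i * ((\<delta> i * (\<Prod>j\<in>J. \<delta> j)) * (\<Sum>i<p. \<delta> i * y i) ^ q))"
    by (simp add: sum_distrib_left sum_distrib_right mult_ac)
  also have "\<dots> = (\<Sum>i<p. y i * (\<Sum>\<delta>\<in>signs p. (\<delta> i * (\<Prod>j\<in>J. \<delta> j)) * (\<Sum>i<p. \<delta> i * y i) ^ q))"
    by (subst sum.swap) (simp add: sum_distrib_left)
  also have "\<dots> = (\<Sum>i<p. if i \<in> J then y i * ?T (J - {i}) else 0)"
  proof (intro sum.cong refl)
    fix i assume i: "i \<in> {..<p}"
    show "y i * (\<Sum>\<delta>\<in>signs p. (\<delta> i * (\<Prod>j\<in>J. \<delta> j)) * (\<Sum>i<p. \<delta> i * y i) ^ q) =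
      (if i \<in> J then y i * ?T (J - {i}) else 0)"
    proof (cases "i \<in> J")
      case True
      have "\<delta> i * (\<Prod>j\<in>J. \<delta> j) = (\<Prod>j\<in>J - {i}. \<delta> j)" if "\<delta> \<in> signs p" for \<delta>
        using signs_square[OF that, of i] i by (simp add: prod.remove[OF fJ True] mult.assoc[symmetric])
      then show ?thesis using True by simp
    next
      case False
      have "?T (insert i J) = 0"
        using Suc.prems i False fJ by (subst Suc.IH) auto
      then show ?thesis using False fJ by simp
    qed
  qed
  also have "\<dots> = (\<Sum>i\<in>J. y i * ?T (J - {i}))"
    using Suc.prems(1) by (simp add: sum.If_cases Int_absorb1)
  also have "\<dots> = (\<Sum>i\<in>J. if card J = Suc q then 2 ^ p * fact q * (\<Prod>j\<in>J. y j) else 0)"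
  proof (intro sum.cong refl)
    fix i assume i: "i \<in> J"
    have "?T (J - {i}) = (if card (J - {i}) = q then 2 ^ p * fact q * (\<Prod>j\<in>J - {i}. y j) else 0)"
      using Suc.prems i fJ by (intro Suc.IH) auto
    moreover have "card (J - {i}) = q \<longleftrightarrow> card J = Suc q"
      using card_Diff_singleton[OF i] Suc.prems(2) by auto
    moreover have "(\<Prod>j\<in>J. y j) = y i * (\<Prod>j\<in>J - {i}. y j)" by (rule prod.remove[OF fJ i])
    ultimately show "y i * ?T (J - {i}) = (if card J = Suc q then 2 ^ p * fact q * (\<Prod>j\<in>J. y j) else 0)"
      by simp
  qed
  also have "\<dots> = (if card J = Suc q then 2 ^ p * fact (Suc q) * (\<Prod>j\<in>J. y j) else 0)"
    by (simp add: algebra_simps)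
  finally show ?case .
qed

text \<open>A signed sum of 2k unit vectors has squared norm at most (2k)^2, whose k-th power enters
  \<open>rep_lin_power\<close>.\<close>

definition crep0 :: "nat \<Rightarrow> real" where
  "crep0 k = cg k * (real (2 * k) ^ 2) ^ k"

lemma crep0_pos: "k \<ge> 1 \<Longrightarrow> crep0 k > 0"
  using cg_ge_1[of k] by (simp add: crep0_def)

lemma sqnorm_signed_sum:
  assumes "\<delta> \<in> signs p" "\<And>j. j < p \<Longrightarrow> sqnorm n (u j) \<le> 1"
  shows "sqnorm n (\<lambda>i. \<Sum>j<p. \<delta> j * u j i) \<le> (real p)\<^sup>2"
proof -
  have "sqnorm n (\<lambda>i. \<Sum>j<p. \<delta> j * u j i) \<le> (\<Sum>i<n. (\<Sum>j<p. (\<delta> j)\<^sup>2) * (\<Sum>j<p. (u j i)\<^sup>2))"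
    unfolding sqnorm_def by (intro sum_mono Cauchy_Schwarz_ineq_sum)
  also have "(\<Sum>j<p. (\<delta> j)\<^sup>2) = real p"
    using signs_square[OF assms(1)] by (simp add: power2_eq_square)
  also have "(\<Sum>i<n. real p * (\<Sum>j<p. (u j i)\<^sup>2)) = real p * (\<Sum>j<p. sqnorm n (u j))"
    unfolding sqnorm_def by (simp add: sum_distrib_left[symmetric]) (intro disjI2 sum.swap)
  also have "\<dots> \<le> real p * (\<Sum>j<p. 1)"
    using assms(2) by (intro mult_left_mono sum_mono) auto
  finally show ?thesis by (simp add: power2_eq_square)
qed

text \<open>Polarisation over the full index set writes the product as a signed combination of
  powers. The number of sign vectors cancels the normalising power of 2, and the remaining 1/(2k)!
  is estimated by 1.\<close>

lemma rep_prod_unit: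
  assumes k: "k \<ge> 1" and n: "n \<ge> 1" and u: "\<And>j. j < 2 * k \<Longrightarrow> sqnorm n (u j) \<le> 1"
  shows "rep n k (crep0 k / real n ^ k) (\<Prod>j<2 * k. lin n (u j))"
proof -
  let ?p = "2 * k"
  let ?w = "\<lambda>\<delta> i. \<Sum>j<?p. \<delta> j * u j i"
  let ?c = "\<lambda>\<delta>. (\<Prod>j<?p. \<delta> j) / (2 ^ ?p * fact ?p) :: real"
  have eq: "(\<Prod>j<?p. lin n (u j)) = (\<Sum>\<delta>\<in>signs ?p. ?c \<delta> *\<^sub>R lin n (?w \<delta>) ^ ?p)"
  proof (rule form_eqI[of _ n ?p])
    show "(\<Prod>j<?p. lin n (u j)) \<in> forms n ?p"
      using forms_prod[of "{..<?p}" "\<lambda>j. lin n (u j)" n "\<lambda>_. 1"] lin_in_forms by simp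
    show "(\<Sum>\<delta>\<in>signs ?p. ?c \<delta> *\<^sub>R lin n (?w \<delta>) ^ ?p) \<in> forms n ?p"
      by (intro forms_sum forms_scaleR lin_power_in_forms)
    fix x
    have prod: "poly_eval (\<Prod>j<m. lin n (u j)) x = (\<Prod>j<m. poly_eval (lin n (u j)) x)" for m
      by (induction m) (simp_all add: poly_eval_mult)
    have w: "poly_eval (lin n (?w \<delta>)) x = (\<Sum>j<?p. \<delta> j * poly_eval (lin n (u j)) x)" for \<delta>
      unfolding poly_eval_lin sum_distrib_left sum_distrib_right
      by (subst sum.swap) (simp add: mult_ac)
    show "poly_eval (\<Prod>j<?p. lin n (u j)) x = poly_eval (\<Sum>\<delta>\<in>signs ?p. ?c \<delta> *\<^sub>R lin n (?w \<delta>) ^ ?p) x"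
      using polarisation[of "{..<?p}" ?p ?p "\<lambda>j. poly_eval (lin n (u j)) x"]
      by (simp add: prod poly_eval_sum poly_eval_scaleR poly_eval_power w sum_divide_distrib[symmetric])
  qed (use k n in auto)
  have c: "\<bar>?c \<delta>\<bar> = 1 / (2 ^ ?p * fact ?p)" if "\<delta> \<in> signs ?p" for \<delta>
    using signs_abs[OF that] by (simp add: abs_prod)
  let ?R = "crep0 k / real n ^ k"
  have "rep n k ?R (lin n (?w \<delta>) ^ ?p)" if "\<delta> \<in> signs ?p" for \<delta>
    unfolding crep0_def by (rule rep_lin_power[OF k n sqnorm_signed_sum[OF that u]])
  then have "rep n k (\<Sum>\<delta>\<in>signs ?p. \<bar>?c \<delta>\<bar> * ?R) (\<Prod>j<?p. lin n (u j))"
    unfolding eq by (intro rep_sum n rep_scaleR k)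
  moreover have "(\<Sum>\<delta>\<in>signs ?p. \<bar>?c \<delta>\<bar> * ?R) = (\<Sum>\<delta>\<in>signs ?p. 1 / (2 ^ ?p * fact ?p) * ?R)"
    by (intro sum.cong) (simp_all only: c)
  moreover have "\<dots> = ?R / fact ?p" by (simp add: card_signs)
  moreover have "?R / fact ?p \<le> ?R"
  proof -
    have "?R \<ge> 0" using crep0_pos[OF k] by simp
    moreover have "(1 :: real) \<le> fact ?p" by (rule fact_ge_1)
    ultimately have "?R / fact ?p \<le> ?R / 1" by (intro divide_left_mono) auto
    then show ?thesis by simp
  qed
  ultimately show ?thesis using rep_mono by simp
qed

section \<open>Monomials as words, and grouping by a removed variable\<close>

lemma mdeg_Suc_keys: "mdeg a = Suc d \<Longrightarrow> \<exists>i. i \<in> keys a"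
  by (cases "keys a = {}") (simp add: mdeg_def, blast)

lemma mon_as_sum_singles:
  assumes "mdeg a = d"
  shows "\<exists>t. (\<forall>j<d. t j \<in> keys a) \<and> a = (\<Sum>j<d. single (t j) 1)"
  using assms
proof (induction d arbitrary: a)
  case 0
  then have "a = 0" by (intro poly_mapping_eqI) (auto simp: mdeg_def in_keys_iff)
  then show ?case by auto
next
  case (Suc d)
  then obtain i where i: "i \<in> keys a" using mdeg_Suc_keys by blast
  define b where "b = a - single i 1"
  have a: "a = b + single i 1"
    using i by (intro poly_mapping_eqI) (auto simp: b_def lookup_add lookup_minus lookup_single when_def in_keys_iff)
  then have "mdeg b = d" using Suc.prems by (simp add: mdeg_add mdeg_single)
  then obtain t where t: "\<forall>j<d. t j \<in> keys b" "b = (\<Sum>j<d. single (t j) 1)"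
    using Suc.IH by blast
  have "keys b \<subseteq> keys a" unfolding a keys_add_nat by blast
  then show ?case using t i a by (intro exI[of _ "t(d := i)"]) (auto simp: less_Suc_eq)
qed

lemma single_sum_eq_prod:
  "finite A \<Longrightarrow> single (\<Sum>j\<in>A. single (t j) 1) 1 = (\<Prod>j\<in>A. poly_var (t j))"
proof (induction A rule: finite_induct)
  case (insert x A)
  have "single (single (t x) 1 + (\<Sum>j\<in>A. single (t j) 1)) (1 :: real) =
      poly_var (t x) * single (\<Sum>j\<in>A. single (t j) 1) 1"
    by (simp add: poly_var_def mult_single)
  then show ?case using insert by simp
qed simp

definition evec :: "nat \<Rightarrow> nat \<Rightarrow> real" where
  "evec i j = (if j = i then 1 else 0)"

lemma lin_evec: "i < n \<Longrightarrow> lin n (evec i) = poly_var i" and sqnorm_evec: "i < n \<Longrightarrow> sqnorm n (evec i) = 1"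
  by (simp_all add: lin_def evec_def sqnorm_def if_distrib[of "\<lambda>t. t *\<^sub>R _"] if_distrib[of "\<lambda>t. t ^ 2"] cong: if_cong)

text \<open>\<open>b\<close> is a product of 2k-1 variables, so together with the normalised
  \<open>lin n v\<close> there are 2k unit factors. The cost thus involves the Euclidean norm of
  \<open>v\<close> and not the sum of its entries.\<close>

lemma rep_lin_mon:
  assumes k: "k \<ge> 1" and n: "n \<ge> 1" and b: "keys b \<subseteq> {..<n}" "mdeg b = 2 * k - 1"
  shows "rep n k (sqrt (sqnorm n v) * (crep0 k / real n ^ k)) (lin n v * single b 1)"
proof (cases "sqnorm n v = 0")
  case True
  then have "lin n v = 0" by (auto simp: lin_def dest: sqnorm_eq_0D intro!: sum.neutral)
  then show ?thesis using True rep_0 by simp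
next
  case False
  define s where "s = sqrt (sqnorm n v)"
  have s: "s > 0" "s\<^sup>2 = sqnorm n v" using False by (auto simp: s_def order_less_le)
  obtain t where t: "\<forall>j<2 * k - 1. t j \<in> keys b" "b = (\<Sum>j<2 * k - 1. single (t j) 1)"
    using mon_as_sum_singles[OF b(2)] by blast
  have tn: "t j < n" if "j < 2 * k - 1" for j using t(1) that b(1) by auto
  let ?v = "\<lambda>i. 1 / s * v i"
  define u where "u = (\<lambda>j. if j < 2 * k - 1 then evec (t j) else ?v)"
  have "sqnorm n ?v = 1" unfolding sqnorm_scale using s False by (simp add: power_divide)
  then have "sqnorm n (u j) \<le> 1" for j by (simp add: u_def sqnorm_evec tn)
  then have R: "rep n k (crep0 k / real n ^ k) (\<Prod>j<2 * k. lin n (u j))"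
    by (intro rep_prod_unit k n)
  have "(\<Prod>j<2 * k. lin n (u j)) = (\<Prod>j<Suc (2 * k - 1). lin n (u j))" using k by simp
  also have "\<dots> = (\<Prod>j<2 * k - 1. poly_var (t j)) * lin n ?v"
    unfolding prod.lessThan_Suc by (simp add: u_def lin_evec tn)
  also have "\<dots> = lin n ?v * single b 1"
    using single_sum_eq_prod[of "{..<2 * k - 1}" t] t(2) by (simp add: mult.commute)
  finally have "rep n k (\<bar>s\<bar> * (crep0 k / real n ^ k)) (s *\<^sub>R (lin n ?v * single b 1))"
    using rep_scaleR[OF k R, of s] by simp
  moreover have "s *\<^sub>R (lin n ?v * single b 1) = lin n v * single b 1"
    unfolding lin_scale using s by (simp add: scaleR_mult_left)
  ultimately show ?thesis using s by (simp add: s_def)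
qed

text \<open>Any choice of a variable will do, but it must be fixed once for each monomial, so that
  the monomial falls into exactly one group.\<close>

definition peel_var :: "(nat \<Rightarrow>\<^sub>0 nat) \<Rightarrow> nat" where
  "peel_var a = (SOME i. i \<in> keys a)"

definition peel :: "(nat \<Rightarrow>\<^sub>0 nat) \<Rightarrow> (nat \<Rightarrow>\<^sub>0 nat)" where
  "peel a = a - single (peel_var a) 1"

lemma peel:
  assumes "mdeg a = Suc d"
  shows "peel_var a \<in> keys a" "a = peel a + single (peel_var a) 1" "mdeg (peel a) = d"
proof -
  have "\<exists>i. i \<in> keys a" using assms by (rule mdeg_Suc_keys)
  then show i: "peel_var a \<in> keys a" unfolding peel_var_def by (rule someI_ex)
  show eq: "a = peel a + single (peel_var a) 1"
    using i by (intro poly_mapping_eqI)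
      (auto simp: peel_def lookup_add lookup_minus lookup_single when_def in_keys_iff)
  then show "mdeg (peel a) = d" using assms mdeg_add[of "peel a" "single (peel_var a) 1"]
    by (simp add: mdeg_single)
qed

text \<open>The pair of \<open>peel a\<close> and \<open>peel_var a\<close> determines
  \<open>a\<close>. The condition on \<open>peel_var\<close> discards the other ways of obtaining a
  monomial as \<open>b\<close> times a variable. The general codomain covers sums of polynomials as
  well as sums of squared coefficients.\<close>

lemma sum_peel:
  fixes h :: "(nat \<Rightarrow>\<^sub>0 nat) \<Rightarrow> 'a :: comm_monoid_add"
  assumes K: "finite K" "\<And>a. a \<in> K \<Longrightarrow> keys a \<subseteq> {..<n}" "\<And>a. a \<in> K \<Longrightarrow> mdeg a = Suc d"
  shows "(\<Sum>b\<in>peel ` K. \<Sum>i<n. if b + single i 1 \<in> K \<and> peel_var (b + single i 1) = i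
      then h (b + single i 1) else 0) = (\<Sum>a\<in>K. h a)"
proof -
  let ?e = "\<lambda>b i. b + single i (1 :: nat)"
  let ?P = "{x \<in> peel ` K \<times> {..<n}. ?e (fst x) (snd x) \<in> K \<and> peel_var (?e (fst x) (snd x)) = snd x}"
  have "(\<Sum>b\<in>peel ` K. \<Sum>i<n. if ?e b i \<in> K \<and> peel_var (?e b i) = i then h (?e b i) else 0) =
      (\<Sum>x\<in>peel ` K \<times> {..<n}. if ?e (fst x) (snd x) \<in> K \<and> peel_var (?e (fst x) (snd x)) = snd x
        then h (?e (fst x) (snd x)) else 0)"
    by (simp add: sum.cartesian_product case_prod_unfold)
  also have "\<dots> = (\<Sum>x\<in>?P. h (?e (fst x) (snd x)))"
    using K(1) by (intro sum.inter_filter[symmetric]) auto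
  also have "\<dots> = (\<Sum>a\<in>K. h a)"
  proof (rule sum.reindex_bij_witness[where j = "\<lambda>x. ?e (fst x) (snd x)" and i = "\<lambda>a. (peel a, peel_var a)"])
    fix x assume x: "x \<in> ?P"
    have "peel (?e (fst x) (snd x)) = fst x" using x by (simp add: peel_def)
    then show "(peel (?e (fst x) (snd x)), peel_var (?e (fst x) (snd x))) = x" using x by (simp add: prod_eq_iff)
  next
    fix a assume a: "a \<in> K"
    note p = peel[OF K(3)[OF a]]
    show "?e (fst (peel a, peel_var a)) (snd (peel a, peel_var a)) = a" using p(2) by simp
    show "(peel a, peel_var a) \<in> ?P" using a p K(2)[OF a] p(2)[symmetric] by auto
  qed auto
  finally show ?thesis .
qed

text \<open>Every monomial of degree d comes from a word of d variables.\<close>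

lemma card_monomials_le:
  assumes "\<And>b. b \<in> B \<Longrightarrow> keys b \<subseteq> {..<n} \<and> mdeg b = d"
  shows "finite B" "card B \<le> n ^ d"
proof -
  let ?T = "Pi\<^sub>E {..<d} (\<lambda>_. {..<n})"
  let ?g = "\<lambda>t. \<Sum>j<d. single (t j) (1::nat)"
  have sub: "B \<subseteq> ?g ` ?T"
  proof
    fix b assume b: "b \<in> B"
    obtain t where t: "\<forall>j<d. t j \<in> keys b" "b = ?g t"
      using mon_as_sum_singles[of b d] assms[OF b] by blast
    have "restrict t {..<d} \<in> ?T" using t(1) assms[OF b] by auto
    moreover have "b = ?g (restrict t {..<d})" using t(2) by simp
    ultimately show "b \<in> ?g ` ?T" by blast
  qed
  have fin: "finite ?T" by (intro finite_PiE) auto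
  show "finite B" using finite_subset[OF sub] fin by simp
  have "card B \<le> card ?T" using sub fin by (intro surj_card_le) auto
  then show "card B \<le> n ^ d" by (simp add: card_PiE)
qed

definition crep :: "nat \<Rightarrow> real" where
  "crep k = crep0 k * sqrt (cg (2 * k))"

lemma crep_pos: "k \<ge> 1 \<Longrightarrow> crep k > 0"
  using crep0_pos[of k] cg_ge_1[of "2 * k"] by (simp add: crep_def)

text \<open>Group the monomials of \<open>f\<close> by the monomial \<open>b\<close> left after removing one variable. Each group is
  \<open>lin v\<^sub>b * b\<close>, whose cost is proportional to the norm of \<open>v\<^sub>b\<close>, and there are at most \<open>n ^ (2k - 1)\<close> groups.\<close>

theorem rep_form:
  assumes f: "f \<in> forms n (2 * k)" and k: "k \<ge> 1" and n: "n \<ge> 1"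
  shows "rep n k (crep k * sqrt (real n ^ (2 * k - 1)) * sqrt (form_inner n f f)) f"
proof -
  define K where "K = keys f"
  obtain d where d: "2 * k = Suc d" "d = 2 * k - 1" using k by (cases "2 * k") auto
  have K: "finite K" "\<And>a. a \<in> K \<Longrightarrow> keys a \<subseteq> {..<n}" "\<And>a. a \<in> K \<Longrightarrow> mdeg a = Suc d"
    using f unfolding d(1) by (auto simp: K_def forms_iff)
  define B where "B = peel ` K"
  let ?e = "\<lambda>b i. b + single i (1 :: nat)"
  define v where "v = (\<lambda>b i. if ?e b i \<in> K \<and> peel_var (?e b i) = i then lookup f (?e b i) else 0)"
  have Bk: "keys b \<subseteq> {..<n} \<and> mdeg b = d" if "b \<in> B" for b
  proof -
    obtain a where a: "a \<in> K" "b = peel a" using \<open>b \<in> B\<close> by (auto simp: B_def)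
    have "keys b \<subseteq> keys a"
      using peel(2)[OF K(3)[OF a(1)]] keys_add_nat[of "peel a" "single (peel_var a) 1"] a(2) by auto
    then show ?thesis using peel(3)[OF K(3)[OF a(1)]] K(2)[OF a(1)] a(2) by auto
  qed
  have fB: "finite B" and cB: "card B \<le> n ^ d" using card_monomials_le[OF Bk] by auto
  have "(\<Sum>b\<in>B. lin n (v b) * single b 1) =
      (\<Sum>b\<in>B. \<Sum>i<n. if ?e b i \<in> K \<and> peel_var (?e b i) = i
        then single (?e b i) (lookup f (?e b i)) else 0)"
  proof (intro sum.cong refl)
    fix b
    have "lin n (v b) * single b 1 = (\<Sum>i<n. v b i *\<^sub>R single (?e b i) 1)"
      by (simp add: lin_def sum_distrib_right scaleR_mult_left poly_var_def mult_single add.commute)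
    also have "\<dots> = (\<Sum>i<n. single (?e b i) (v b i))"
      by (intro sum.cong refl poly_mapping_eqI) (auto simp: lookup_scaleR lookup_single when_def)
    finally show "lin n (v b) * single b 1 = (\<Sum>i<n. if ?e b i \<in> K \<and> peel_var (?e b i) = i
        then single (?e b i) (lookup f (?e b i)) else 0)"
      by (simp add: v_def if_distrib[of "single _"] cong: if_cong)
  qed
  also have "\<dots> = (\<Sum>a\<in>K. single a (lookup f a))"
    unfolding B_def by (rule sum_peel[OF K])
  also have "\<dots> = f" unfolding K_def by (rule poly_sum_singles)
  finally have f_eq: "(\<Sum>b\<in>B. lin n (v b) * single b 1) = f" .
  have "(\<Sum>b\<in>B. sqnorm n (v b)) = (\<Sum>b\<in>B. \<Sum>i<n. if ?e b i \<in> K \<and> peel_var (?e b i) = i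
        then (lookup f (?e b i))\<^sup>2 else 0)"
    unfolding sqnorm_def v_def by (intro sum.cong refl) simp
  also have "\<dots> = (\<Sum>a\<in>K. (lookup f a)\<^sup>2)"
    unfolding B_def by (rule sum_peel[OF K])
  also have "\<dots> \<le> cg (2 * k) * real n ^ (2 * k) * form_inner n f f"
    unfolding K_def using f k n by (intro coeffs_le_sphere_norm) auto
  finally have sq: "(\<Sum>b\<in>B. sqnorm n (v b)) \<le> cg (2 * k) * real n ^ (2 * k) * form_inner n f f" .
  let ?C = "crep0 k / real n ^ k"
  have "rep n k (\<Sum>b\<in>B. sqrt (sqnorm n (v b)) * ?C) f"
    unfolding f_eq[symmetric] using Bk unfolding d(2) by (intro rep_sum n rep_lin_mon k) auto
  then have "rep n k ((\<Sum>b\<in>B. sqrt (sqnorm n (v b))) * ?C) f" by (simp only: sum_distrib_right)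
  moreover have "(\<Sum>b\<in>B. sqrt (sqnorm n (v b))) * ?C \<le> crep k * sqrt (real n ^ (2 * k - 1)) * sqrt (form_inner n f f)"
  proof -
    \<comment> \<open>Cauchy-Schwarz over the groups: their number contributes the square root of
      \<open>n ^ d\<close>, and their squared norms add up to the squared coefficients of
      \<open>f\<close>.\<close>
    have "(\<Sum>b\<in>B. sqrt (sqnorm n (v b)))\<^sup>2 \<le> (\<Sum>b\<in>B. 1\<^sup>2) * (\<Sum>b\<in>B. (sqrt (sqnorm n (v b)))\<^sup>2)"
      using Cauchy_Schwarz_ineq_sum[of "\<lambda>_. 1" "\<lambda>b. sqrt (sqnorm n (v b))" B] by simp
    also have "\<dots> = real (card B) * (\<Sum>b\<in>B. sqnorm n (v b))" by simp
    also have "\<dots> \<le> real n ^ d * (cg (2 * k) * real n ^ (2 * k) * form_inner n f f)"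
      using cB sq by (intro mult_mono) (auto simp: sum_nonneg simp flip: of_nat_power)
    finally have "(\<Sum>b\<in>B. sqrt (sqnorm n (v b))) \<le> sqrt (real n ^ d * (cg (2 * k) * real n ^ (2 * k) * form_inner n f f))"
      by (rule real_le_rsqrt)
    also have "\<dots> = sqrt (real n ^ d) * sqrt (cg (2 * k)) * real n ^ k * sqrt (form_inner n f f)"
    proof -
      have "sqrt (real n ^ (2 * k)) = real n ^ k" by (simp add: power_even_eq)
      then show ?thesis by (simp add: real_sqrt_mult)
    qed
    finally have "(\<Sum>b\<in>B. sqrt (sqnorm n (v b))) * ?C \<le>
        sqrt (real n ^ d) * sqrt (cg (2 * k)) * real n ^ k * sqrt (form_inner n f f) * ?C"
      using crep0_pos[OF k] by (intro mult_right_mono) auto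
    \<comment> \<open>Here the \<open>n ^ k\<close> of the coefficient bound cancels the
      \<open>n ^ k\<close> in the denominator of \<open>?C\<close>.\<close>
    also have "\<dots> = crep k * sqrt (real n ^ (2 * k - 1)) * sqrt (form_inner n f f)"
      using n unfolding d(2) by (simp add: crep_def)
    finally show ?thesis .
  qed
  ultimately show ?thesis by (rule rep_mono)
qed

section \<open>Orthonormal coordinates on the space of forms of mean zero\<close>

lemma form_inner_commute: "form_inner n f g = form_inner n g f"
  by (simp add: form_inner_eq mult.commute)

lemma form_inner_add_left:
  "f \<in> forms n d \<Longrightarrow> g \<in> forms n d \<Longrightarrow> h \<in> forms n d \<Longrightarrow> n \<ge> 1 \<Longrightarrow>
    form_inner n (f + g) h = form_inner n f h + form_inner n g h"
  by (simp add: form_inner_eq distrib_right sphere_integral_add[OF forms_mult forms_mult])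

lemma form_inner_diff_left:
  "f \<in> forms n d \<Longrightarrow> g \<in> forms n d \<Longrightarrow> h \<in> forms n d \<Longrightarrow> n \<ge> 1 \<Longrightarrow>
    form_inner n (f - g) h = form_inner n f h - form_inner n g h"
  by (simp add: form_inner_eq left_diff_distrib sphere_integral_diff[OF forms_mult forms_mult])

lemma form_inner_scaleR_left: "form_inner n (c *\<^sub>R f) h = c * form_inner n f h"
  by (simp add: form_inner_eq scaleR_mult_left sphere_integral_scaleR)

lemma form_inner_scaleR_right: "form_inner n h (c *\<^sub>R f) = c * form_inner n h f"
  by (simp add: form_inner_eq scaleR_mult_right sphere_integral_scaleR)

lemma form_inner_0_left [simp]: "form_inner n 0 h = 0" and form_inner_0_right [simp]: "form_inner n h 0 = 0"
  by (simp_all add: form_inner_eq)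

lemma form_inner_sum_left:
  assumes "\<And>i. i \<in> A \<Longrightarrow> f i \<in> forms n d" "h \<in> forms n d" "n \<ge> 1"
  shows "form_inner n (\<Sum>i\<in>A. f i) h = (\<Sum>i\<in>A. form_inner n (f i) h)"
  unfolding form_inner_eq sum_distrib_right
  by (rule sphere_integral_sum) (use assms forms_mult in blast)+

lemma M_space_forms: "f \<in> M_space n k \<Longrightarrow> f \<in> forms n (2 * k)"
  by (simp add: M_space_def)

lemma subspace_M_space: "n \<ge> 1 \<Longrightarrow> subspace (M_space n k)"
  unfolding subspace_def M_space_def
  by (auto simp: forms_add forms_scaleR sphere_integral_scaleR sphere_integral_add)

text \<open>The length \<open>d\<close> is free, unlike in \<open>orthonormal_basis_M\<close>, so
  that a family of maximal length can be selected.\<close>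

definition orthonormal_in :: "nat \<Rightarrow> rpoly set \<Rightarrow> nat \<Rightarrow> (nat \<Rightarrow> rpoly) \<Rightarrow> bool" where
  "orthonormal_in n M d b \<longleftrightarrow> (\<forall>i<d. b i \<in> M) \<and>
    (\<forall>i<d. \<forall>j<d. form_inner n (b i) (b j) = (if i = j then 1 else 0))"

lemma orthonormal_in_inner:
  assumes "orthonormal_in n M d b" "M \<subseteq> forms n p" "n \<ge> 1" "j < d"
  shows "form_inner n (\<Sum>i<d. c i *\<^sub>R b i) (b j) = c j"
proof -
  have "form_inner n (\<Sum>i<d. c i *\<^sub>R b i) (b j) = (\<Sum>i<d. form_inner n (c i *\<^sub>R b i) (b j))"
    using assms by (intro form_inner_sum_left[of _ _ n p] forms_scaleR) (auto simp: orthonormal_in_def)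
  also have "\<dots> = (\<Sum>i<d. if i = j then c i else 0)"
    using assms by (intro sum.cong) (auto simp: form_inner_scaleR_left orthonormal_in_def)
  finally show ?thesis using assms by simp
qed

lemma orthonormal_in_independent:
  assumes "orthonormal_in n M d b" "M \<subseteq> forms n p" "n \<ge> 1"
  shows "inj_on b {..<d}" "independent (b ` {..<d})"
proof -
  show inj: "inj_on b {..<d}"
  proof (rule inj_onI)
    fix i j assume ij: "i \<in> {..<d}" "j \<in> {..<d}" "b i = b j"
    have "form_inner n (b i) (b i) = 1" "i \<noteq> j \<Longrightarrow> form_inner n (b i) (b j) = 0"
      using assms(1) ij(1,2) by (simp_all add: orthonormal_in_def)
    then show "i = j" using ij(3) by fastforce
  qed
  show "independent (b ` {..<d})"
  proof (rule independent_if_scalars_zero)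
    fix g x assume g: "(\<Sum>x\<in>b ` {..<d}. g x *\<^sub>R x) = 0" and "x \<in> b ` {..<d}"
    then obtain j where j: "j < d" "x = b j" by auto
    have "(\<Sum>i<d. g (b i) *\<^sub>R b i) = 0" using g inj by (simp add: sum.reindex)
    then show "g x = 0" using orthonormal_in_inner[OF assms j(1), of "g \<circ> b"] j by simp
  qed simp
qed

definition monomials :: "nat \<Rightarrow> nat \<Rightarrow> (nat \<Rightarrow>\<^sub>0 nat) set" where
  "monomials n d = {a. keys a \<subseteq> {..<n} \<and> mdeg a = d}"

lemma finite_monomials: "finite (monomials n d)"
  by (rule card_monomials_le(1)[of _ n d]) (auto simp: monomials_def)

lemma forms_span: "forms n d \<subseteq> span ((\<lambda>a. single a 1) ` monomials n d)"
proof
  fix f assume f: "f \<in> forms n d"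
  have "f = (\<Sum>a\<in>keys f. lookup f a *\<^sub>R single a 1)"
  proof -
    have "c *\<^sub>R single a 1 = single a c" for a :: "nat \<Rightarrow>\<^sub>0 nat" and c :: real
      by (rule poly_mapping_eqI) (simp add: lookup_scaleR lookup_single when_def)
    then show ?thesis by (simp add: poly_sum_singles)
  qed
  also have "\<dots> \<in> span ((\<lambda>a. single a 1) ` monomials n d)"
    using f by (intro span_sum span_scale span_base) (auto simp: forms_iff monomials_def)
  finally show "f \<in> span ((\<lambda>a. single a 1) ` monomials n d)" .
qed

text \<open>Orthonormal families are independent, so their length is bounded by the number of
  monomials and a longest one exists. If it did not span, the normalised residue \<open>w\<close> of
  a vector outside the span would extend it.\<close>

lemma orthonormal_basis_exists:
  assumes n: "n \<ge> 1" and k: "k \<ge> 1"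
  shows "\<exists>b. orthonormal_basis_M n k b"
proof -
  let ?M = "M_space n k" and ?T = "(\<lambda>a. single a 1) ` monomials n (2 * k) :: rpoly set"
  have MF: "?M \<subseteq> forms n (2 * k)" by (auto simp: M_space_def)
  have sub: "subspace ?M" by (rule subspace_M_space[OF n])
  have finT: "finite ?T" using finite_monomials by simp
  have bound: "d \<le> card ?T" if "orthonormal_in n ?M d b" for d b
  proof -
    note ind = orthonormal_in_independent[OF that MF n]
    have "b ` {..<d} \<subseteq> span ?T" using that MF forms_span[of n "2 * k"] by (auto simp: orthonormal_in_def)
    then have "card (b ` {..<d}) \<le> card ?T" using independent_span_bound[OF finT ind(2)] by blast
    then show ?thesis by (simp add: card_image[OF ind(1)])
  qed
  have "orthonormal_in n ?M 0 (\<lambda>_. 0)" by (simp add: orthonormal_in_def)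
  then have "\<exists>d. (\<exists>b. orthonormal_in n ?M d b) \<and> (\<forall>d'. (\<exists>b. orthonormal_in n ?M d' b) \<longrightarrow> d' \<le> d)"
    using bound by (intro ex_has_greatest_nat[where b = "Suc (card ?T)" and k = 0 and f = id, simplified])
      (auto simp: less_Suc_eq_le)
  then obtain d b where b: "orthonormal_in n ?M d b"
    and max: "\<And>d' b'. orthonormal_in n ?M d' b' \<Longrightarrow> d' \<le> d" by blast
  note ind = orthonormal_in_independent[OF b MF n]
  have bM: "b ` {..<d} \<subseteq> ?M" using b by (auto simp: orthonormal_in_def)
  have spanM: "span (b ` {..<d}) \<subseteq> ?M" using bM sub by (rule span_minimal)
  have Mspan: "?M \<subseteq> span (b ` {..<d})"
  proof
    fix v assume v: "v \<in> ?M"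
    define q where "q = (\<Sum>i<d. form_inner n v (b i) *\<^sub>R b i)"
    have q: "q \<in> span (b ` {..<d})" unfolding q_def by (intro span_sum span_scale span_base) auto
    define w where "w = v - q"
    have w: "w \<in> ?M" unfolding w_def using v q spanM by (intro subspace_diff[OF sub]) auto
    have orth: "form_inner n w (b j) = 0" if "j < d" for j
    proof -
      have "form_inner n w (b j) = form_inner n v (b j) - form_inner n q (b j)"
        unfolding w_def using v q spanM MF bM that n by (intro form_inner_diff_left[of _ n "2 * k"]) auto
      then show ?thesis using orthonormal_in_inner[OF b MF n that, of "\<lambda>i. form_inner n v (b i)"]
        by (simp add: q_def)
    qed
    show "v \<in> span (b ` {..<d})"
    proof (rule ccontr)
      assume "v \<notin> span (b ` {..<d})"
      then have "w \<noteq> 0" using q by (auto simp: w_def)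
      then have pos: "form_inner n w w > 0"
        using form_inner_eq_0D[of w n "2 * k"] form_inner_nonneg[of n w] w MF k n
        by (fastforce simp: order_less_le)
      define s where "s = 1 / sqrt (form_inner n w w)"
      define b' where "b' = (\<lambda>i. if i < d then b i else s *\<^sub>R w)"
      have "s * (s * form_inner n w w) = 1" using pos by (simp add: s_def)
      then have "orthonormal_in n ?M (Suc d) b'"
        using b orth w subspace_scale[OF sub] unfolding orthonormal_in_def b'_def
        by (auto simp: less_Suc_eq form_inner_scaleR_left form_inner_scaleR_right form_inner_commute[of n "b _" w])
      then show False using max by fastforce
    qed
  qed
  have "dim ?M = card (b ` {..<d})" by (intro dim_unique[OF bM Mspan ind(2)]) simp
  then have "D_M n k = d" by (simp add: D_M_def card_image[OF ind(1)])
  then have "orthonormal_basis_M n k b"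
    using b bM spanM Mspan by (auto simp: orthonormal_basis_M_def orthonormal_in_def)
  then show ?thesis by blast
qed

section \<open>Coordinates with respect to an orthonormal basis\<close>

definition lincomb :: "nat \<Rightarrow> (nat \<Rightarrow> rpoly) \<Rightarrow> (nat \<Rightarrow> real) \<Rightarrow> rpoly" where
  "lincomb d b c = (\<Sum>i<d. c i *\<^sub>R b i)"

definition coord_set :: "nat \<Rightarrow> (nat \<Rightarrow> rpoly) \<Rightarrow> rpoly set \<Rightarrow> (nat \<Rightarrow> real) set" where
  "coord_set d b S = {c \<in> {..<d} \<rightarrow>\<^sub>E UNIV. lincomb d b c \<in> S}"

lemma lincomb_diff: "lincomb d b (\<lambda>i. x i - y i) = lincomb d b x - lincomb d b y"
  by (simp add: lincomb_def scaleR_diff_left sum_subtractf)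

lemma lincomb_cong: "(\<And>i. i < d \<Longrightarrow> x i = y i) \<Longrightarrow> lincomb d b x = lincomb d b y"
  by (simp add: lincomb_def)

lemma orthonormal_basis_in: "orthonormal_basis_M n k b \<Longrightarrow> orthonormal_in n (M_space n k) (D_M n k) b"
  by (auto simp: orthonormal_basis_M_def orthonormal_in_def)

lemma lincomb_in_M:
  assumes "orthonormal_basis_M n k b"
  shows "lincomb (D_M n k) b c \<in> M_space n k"
proof -
  have "lincomb (D_M n k) b c \<in> span (b ` {..<D_M n k})"
    unfolding lincomb_def by (intro span_sum span_scale span_base) auto
  then show ?thesis using assms by (simp add: orthonormal_basis_M_def)
qed

lemma form_inner_lincomb_basis:
  assumes "orthonormal_basis_M n k b" "n \<ge> 1" "j < D_M n k"
  shows "form_inner n (lincomb (D_M n k) b c) (b j) = c j"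
  unfolding lincomb_def
  using orthonormal_in_inner[OF orthonormal_basis_in[OF assms(1)] _ assms(2,3)] by (auto simp: M_space_def)

lemma form_inner_lincomb:
  assumes "orthonormal_basis_M n k b" "n \<ge> 1"
  shows "form_inner n (lincomb (D_M n k) b c) (lincomb (D_M n k) b c) = sqnorm (D_M n k) c"
proof -
  let ?l = "lincomb (D_M n k) b c"
  have bM: "b i \<in> forms n (2 * k)" if "i < D_M n k" for i
    using assms(1) that by (auto simp: orthonormal_basis_M_def M_space_def)
  have "form_inner n ?l ?l = (\<Sum>i<D_M n k. form_inner n (c i *\<^sub>R b i) ?l)"
    using bM assms(2) M_space_forms[OF lincomb_in_M[OF assms(1)]]
    by (subst (1) lincomb_def, intro form_inner_sum_left[of _ _ n "2 * k"] forms_scaleR) auto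
  also have "\<dots> = (\<Sum>i<D_M n k. c i * c i)"
    using form_inner_lincomb_basis[OF assms]
    by (intro sum.cong) (simp_all add: form_inner_scaleR_left form_inner_commute[of n "b _"])
  finally show ?thesis by (simp add: sqnorm_def power2_eq_square)
qed

lemma M_space_lincomb:
  assumes "orthonormal_basis_M n k b" "n \<ge> 1" "f \<in> M_space n k"
  obtains c where "c \<in> {..<D_M n k} \<rightarrow>\<^sub>E UNIV" "f = lincomb (D_M n k) b c"
proof -
  let ?B = "b ` {..<D_M n k}"
  have MF: "M_space n k \<subseteq> forms n (2 * k)" by (auto simp: M_space_def)
  note inj = orthonormal_in_independent(1)[OF orthonormal_basis_in[OF assms(1)] MF assms(2)]
  have "f \<in> span ?B" using assms by (simp add: orthonormal_basis_M_def)
  then obtain u where "f = (\<Sum>v\<in>?B. u v *\<^sub>R v)" by (auto simp: span_finite)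
  then have "f = lincomb (D_M n k) b (\<lambda>i. u (b i))" using inj by (simp add: lincomb_def sum.reindex)
  also have "\<dots> = lincomb (D_M n k) b (\<lambda>i\<in>{..<D_M n k}. u (b i))" by (intro lincomb_cong) simp
  finally show ?thesis by (rule that[rotated]) simp
qed

lemma coord_set_B_M:
  assumes "orthonormal_basis_M n k b" "n \<ge> 1"
  shows "coord_set (D_M n k) b (B_M n k) = uball (D_M n k)"
  using lincomb_in_M[OF assms(1)]
  by (auto simp: coord_set_def B_M_def form_inner_lincomb[OF assms] cball_Leb_def)

lemma cvx_coord_set:
  assumes "convex S"
  shows "cvx d (coord_set d b S)"
  unfolding cvx_def
proof (intro conjI ballI allI impI)
  fix x y and s :: real assume *: "x \<in> coord_set d b S" "y \<in> coord_set d b S" "0 \<le> s" "s \<le> 1"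
  have "lincomb d b (\<lambda>i\<in>{..<d}. (1 - s) * x i + s * y i) = (1 - s) *\<^sub>R lincomb d b x + s *\<^sub>R lincomb d b y"
    by (simp add: lincomb_def scaleR_add_left sum.distrib scaleR_sum_right)
  also have "\<dots> \<in> S" using * assms by (intro convexD) (auto simp: coord_set_def)
  finally show "(\<lambda>i\<in>{..<d}. (1 - s) * x i + s * y i) \<in> coord_set d b S" by (simp add: coord_set_def)
qed (auto simp: coord_set_def space_Leb)

section \<open>The lower bound\<close>

lemma Lf_tilde_subset_M: "f \<in> Lf_tilde n k \<Longrightarrow> f \<in> M_space n k"
  by (simp add: Lf_tilde_def)

lemma convex_Lf_tilde:
  assumes "n \<ge> 1" "k \<ge> 1"
  shows "convex (Lf_tilde n k)"
proof (rule convexI)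
  fix f g and u v :: real
  assume *: "f \<in> Lf_tilde n k" "g \<in> Lf_tilde n k" "0 \<le> u" "0 \<le> v" "u + v = 1"
  have "u *\<^sub>R f + v *\<^sub>R g + r_pow n k = u *\<^sub>R f + v *\<^sub>R g + (u + v) *\<^sub>R r_pow n k"
    using *(5) by simp
  also have "\<dots> = u *\<^sub>R (f + r_pow n k) + v *\<^sub>R (g + r_pow n k)"
    by (simp add: algebra_simps)
  also have "\<dots> \<in> Lf n k"
    using * assms(2) by (intro Lf_add[OF Lf_scaleR Lf_scaleR]) (auto simp: Lf_tilde_def)
  finally have "u *\<^sub>R f + v *\<^sub>R g + r_pow n k \<in> Lf n k" .
  moreover have "u *\<^sub>R f + v *\<^sub>R g \<in> M_space n k"
    using * by (intro subspace_add[OF subspace_M_space[OF assms(1)]] subspace_scale[OF subspace_M_space[OF assms(1)]])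
      (auto simp: Lf_tilde_def)
  ultimately show "u *\<^sub>R f + v *\<^sub>R g \<in> Lf_tilde n k" by (simp add: Lf_tilde_def)
qed

text \<open>The 2k-th power of the first variable has positive mean and can be rescaled. The result
  serves to raise the mean of cone elements to 1 and as a placeholder.\<close>

lemma unit_mass_power:
  assumes "n \<ge> 1" "k \<ge> 1"
  obtains w where "sphere_integral n (lin n w ^ (2 * k)) = 1"
proof -
  let ?s = "sphere_integral n (lin n (evec 0) ^ (2 * k))"
  have "(sqnorm n (evec 0) / n) ^ k \<le> ?s" by (rule lin_power_integral_ge[OF assms(2,1)])
  moreover have "(sqnorm n (evec 0) / n) ^ k > 0" using assms by (simp add: sqnorm_evec)
  ultimately have s: "?s > 0" by linarith
  have "lin n (\<lambda>i. 1 / root (2 * k) ?s * evec 0 i) ^ (2 * k) = (1 / ?s) *\<^sub>R lin n (evec 0) ^ (2 * k)"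
    unfolding lin_scale scaleR_power using s assms(2) by (simp add: power_divide)
  then have "sphere_integral n (lin n (\<lambda>i. 1 / root (2 * k) ?s * evec 0 i) ^ (2 * k)) = 1"
    using s by (simp add: sphere_integral_scaleR)
  then show ?thesis using that by blast
qed

text \<open>The norm at which the cost in \<open>rep_form\<close> reaches 1; its order is
  n^(-k+1/2).\<close>

definition inner_radius :: "nat \<Rightarrow> nat \<Rightarrow> real" where
  "inner_radius n k = 1 / (crep k * sqrt (real n ^ (2 * k - 1)))"

lemma inner_radius_pos: "n \<ge> 1 \<Longrightarrow> k \<ge> 1 \<Longrightarrow> inner_radius n k > 0"
  using crep_pos[of k] by (simp add: inner_radius_def)

lemma Lf_tilde_difference:
  assumes n: "n \<ge> 1" and k: "k \<ge> 1" and f: "f \<in> M_space n k" "form_inner n f f \<le> (inner_radius n k)\<^sup>2"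
  shows "\<exists>a\<in>Lf_tilde n k. \<exists>b\<in>Lf_tilde n k. f = a - b"
proof -
  have "crep k * sqrt (real n ^ (2 * k - 1)) * sqrt (form_inner n f f) \<le>
      crep k * sqrt (real n ^ (2 * k - 1)) * inner_radius n k"
    using f(2) inner_radius_pos[OF n k] crep_pos[OF k]
    by (intro mult_left_mono real_le_lsqrt form_inner_nonneg) auto
  also have "\<dots> = 1" using n crep_pos[OF k] by (simp add: inner_radius_def)
  finally have "rep n k 1 f" using rep_form[OF M_space_forms[OF f(1)] k n] by (rule rep_mono[rotated])
  then obtain F G where F: "F \<in> Lf n k" "G \<in> Lf n k" "f = F - G" "sphere_integral n F \<le> 1" "sphere_integral n G \<le> 1"
    unfolding rep_def by blast
  have FG: "sphere_integral n F = sphere_integral n G"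
    using f(1) sphere_integral_diff[OF Lf_subset_forms[OF F(1)] Lf_subset_forms[OF F(2)] n] F(3)
    by (simp add: M_space_def)
  obtain w where w: "sphere_integral n (lin n w ^ (2 * k)) = 1" using unit_mass_power[OF n k] .
  let ?p = "lin n w ^ (2 * k)"
  \<comment> \<open>Since \<open>f\<close> has mean zero, \<open>F\<close> and \<open>G\<close> have
    the same mean, so the same multiple of \<open>?p\<close> completes both and cancels in the
    difference.\<close>
  define e where "e = (\<lambda>H. H + (1 - sphere_integral n H) *\<^sub>R ?p)"
  have e: "e H - r_pow n k \<in> Lf_tilde n k" if H: "H \<in> Lf n k" "sphere_integral n H \<le> 1" for H
  proof -
    have eL: "e H \<in> Lf n k"
      unfolding e_def using H k by (intro Lf_add Lf_scaleR Lf_lin_power) auto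
    have "sphere_integral n (e H) = 1"
      unfolding e_def using w
      by (simp add: sphere_integral_add[OF Lf_subset_forms[OF H(1)] forms_scaleR[OF lin_power_in_forms] n] sphere_integral_scaleR)
    then have "sphere_integral n (e H - r_pow n k) = 0"
      by (simp add: sphere_integral_diff[OF Lf_subset_forms[OF eL] r_pow_in_forms n] sphere_integral_r_pow[OF n])
    then show ?thesis using eL Lf_subset_forms[OF eL] r_pow_in_forms
      by (simp add: Lf_tilde_def M_space_def forms_diff)
  qed
  have "f = (e F - r_pow n k) - (e G - r_pow n k)" using F(3) FG by (simp add: e_def)
  then show ?thesis using e[OF F(1,4)] e[OF F(2,5)] by blast
qed

text \<open>The weights are the means of the summands, so total mean 1 makes the sum a convex
  combination. The lower bound for means of powers forces
  \<open>sqnorm n (w j) \<le> n\<close>.\<close>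

lemma Lf_normalised_decomp:
  assumes n: "n \<ge> 1" and k: "k \<ge> 1" and F: "F \<in> Lf n k" "sphere_integral n F = 1"
  shows "\<exists>(N :: nat) m w. (\<forall>j<N. 0 \<le> m j) \<and> (\<Sum>j<N. m j) = 1 \<and> (\<forall>j<N. sqnorm n (w j) \<le> n) \<and>
    (\<forall>j<N. sphere_integral n (lin n (w j) ^ (2 * k)) = 1) \<and> F = (\<Sum>j<N. m j *\<^sub>R lin n (w j) ^ (2 * k))"
proof -
  obtain N u where u: "F = (\<Sum>j<(N::nat). lin n (u j) ^ (2 * k))" using Lf_decomp[OF F(1)] .
  define m where "m = (\<lambda>j. sphere_integral n (lin n (u j) ^ (2 * k)))"
  obtain w0 where w0: "sphere_integral n (lin n w0 ^ (2 * k)) = 1" using unit_mass_power[OF n k] .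
  \<comment> \<open>A summand of mean 0 is the zero form and has weight 0; \<open>w0\<close> only
    keeps the normalisation valid for that index.\<close>
  define w where "w = (\<lambda>j. if m j = 0 then w0 else (\<lambda>i. 1 / root (2 * k) (m j) * u j i))"
  have m: "m j \<ge> 0" for j
    unfolding m_def by (intro sphere_integral_nonneg) (simp add: poly_eval_power power_mult)
  have w1: "sphere_integral n (lin n (w j) ^ (2 * k)) = 1" and mw: "m j *\<^sub>R lin n (w j) ^ (2 * k) = lin n (u j) ^ (2 * k)" for j
  proof -
    have "sphere_integral n (lin n (w j) ^ (2 * k)) = 1 \<and> m j *\<^sub>R lin n (w j) ^ (2 * k) = lin n (u j) ^ (2 * k)"
    proof (cases "m j = 0")
      case True
      then have "(sqnorm n (u j) / n) ^ k \<le> 0" using lin_power_integral_ge[OF k n, of "u j"] by (simp add: m_def)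
      then have "(sqnorm n (u j) / n) ^ k = 0"
        using sqnorm_nonneg[of n "u j"] n by (intro antisym zero_le_power divide_nonneg_pos) auto
      then have "sqnorm n (u j) = 0" using n k by auto
      then have "lin n (u j) = 0" by (auto simp: lin_def dest: sqnorm_eq_0D intro!: sum.neutral)
      then show ?thesis using True w0 k by (simp add: w_def zero_power)
    next
      case False
      then have "m j > 0" using m[of j] by simp
      moreover have "lin n (w j) ^ (2 * k) = (1 / m j) *\<^sub>R lin n (u j) ^ (2 * k)"
        unfolding w_def using False m[of j] k by (simp only: if_False lin_scale scaleR_power) (simp add: power_divide)
      ultimately show ?thesis by (simp add: sphere_integral_scaleR) (simp add: m_def)
    qed
    then show "sphere_integral n (lin n (w j) ^ (2 * k)) = 1" "m j *\<^sub>R lin n (w j) ^ (2 * k) = lin n (u j) ^ (2 * k)" by auto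
  qed
  have "sqnorm n (w j) \<le> n" for j
  proof (rule ccontr)
    assume "\<not> sqnorm n (w j) \<le> n"
    then have "1 < sqnorm n (w j) / n" using n by (simp add: less_divide_eq)
    then have "1 < (sqnorm n (w j) / n) ^ k" using k by (intro one_less_power) auto
    then show False using lin_power_integral_ge[OF k n, of "w j"] w1[of j] by simp
  qed
  moreover have "(\<Sum>j<N. m j) = 1"
    using F(2) sphere_integral_sum[of "{..<N}" "\<lambda>j. lin n (u j) ^ (2 * k)" n "2 * k"] n
    by (simp add: u m_def lin_power_in_forms)
  moreover have "F = (\<Sum>j<N. m j *\<^sub>R lin n (w j) ^ (2 * k))" using u mw by simp
  ultimately show ?thesis
    by (intro exI[of _ N] exI[of _ m] exI[of _ w] conjI allI impI) (simp_all only: m w1)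
qed

text \<open>The bound is free of n because the squared norm n of \<open>w\<close> compensates the
  division by \<open>n ^ (2 * k)\<close>; the sampling argument needs this uniformity.\<close>

lemma form_inner_power_le:
  assumes "n \<ge> 1" "k \<ge> 1" "sqnorm n w \<le> n"
  shows "form_inner n (lin n w ^ (2 * k)) (lin n w ^ (2 * k)) \<le> cg (2 * k)"
proof -
  have "form_inner n (lin n w ^ (2 * k)) (lin n w ^ (2 * k)) = sphere_integral n (lin n w ^ (2 * (2 * k)))"
    unfolding form_inner_eq power_add[symmetric] by (simp add: mult_2)
  also have "\<dots> \<le> cg (2 * k) * sqnorm n w ^ (2 * k) / real n ^ (2 * k)"
    using assms by (intro lin_power_integral_le) auto
  also have "\<dots> \<le> cg (2 * k) * real n ^ (2 * k) / real n ^ (2 * k)"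
    using assms cg_ge_1[of "2 * k"] by (intro divide_right_mono mult_left_mono power_mono) auto
  finally show ?thesis using assms(1) by simp
qed

lemma form_inner_square_add:
  assumes "f \<in> forms n d" "g \<in> forms n d" "n \<ge> 1"
  shows "form_inner n (f + g) (f + g) = form_inner n f f + 2 * form_inner n f g + form_inner n g g"
  using form_inner_add_left[OF assms(1,2) forms_add[OF assms(1,2)] assms(3)]
    form_inner_add_left[OF assms(1,2,1,3)] form_inner_add_left[OF assms(1,2,2,3)]
    form_inner_commute[of n f "f + g"] form_inner_commute[of n g "f + g"] form_inner_commute[of n g f]
  by linarith

lemma form_inner_square_diff:
  assumes "f \<in> forms n d" "g \<in> forms n d" "n \<ge> 1"
  shows "form_inner n (f - g) (f - g) = form_inner n f f - 2 * form_inner n f g + form_inner n g g"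
  using form_inner_diff_left[OF assms(1,2) forms_diff[OF assms(1,2)] assms(3)]
    form_inner_diff_left[OF assms(1,2,1,3)] form_inner_diff_left[OF assms(1,2,2,3)]
    form_inner_commute[of n f "f - g"] form_inner_commute[of n g "f - g"] form_inner_commute[of n g f]
  by linarith

lemma form_inner_square_add_le:
  assumes "f \<in> forms n d" "g \<in> forms n d" "n \<ge> 1"
  shows "form_inner n (f + g) (f + g) \<le> 2 * form_inner n f f + 2 * form_inner n g g"
  using form_inner_square_add[OF assms] form_inner_square_diff[OF assms] form_inner_nonneg[of n "f - g"] by linarith

lemma form_inner_square_diff_le:
  assumes "f \<in> forms n d" "g \<in> forms n d" "n \<ge> 1"
  shows "form_inner n (f - g) (f - g) \<le> 2 * form_inner n f f + 2 * form_inner n g g"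
  using form_inner_square_add[OF assms] form_inner_square_diff[OF assms] form_inner_nonneg[of n "f + g"] by linarith

text \<open>With \<open>j\<close> chosen with probability \<open>m j\<close>, the form
  \<open>P j - F\<close> has expectation zero, so its cross term with \<open>E\<close> averages out
  and only its variance is added.\<close>

lemma variance_identity:
  assumes P: "\<And>j. j < N \<Longrightarrow> P j \<in> forms n d" and m: "(\<Sum>j<(N::nat). m j) = (1::real)" and E: "E \<in> forms n d" and n: "n \<ge> 1"
  defines "F \<equiv> \<Sum>j<N. m j *\<^sub>R P j"
  shows "(\<Sum>j<N. m j * form_inner n (E + (P j - F)) (E + (P j - F))) =
    form_inner n E E + (\<Sum>j<N. m j * form_inner n (P j) (P j)) - form_inner n F F"
proof -
  have F: "F \<in> forms n d" unfolding F_def using P by (intro forms_sum forms_scaleR) auto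
  have s: "(\<Sum>j<N. m j * form_inner n (P j) H) = form_inner n F H" if "H \<in> forms n d" for H
    unfolding F_def using P that n
    by (subst form_inner_sum_left[of _ _ n d]) (auto intro: forms_scaleR simp: form_inner_scaleR_left)
  have "(\<Sum>j<N. m j * form_inner n (E + (P j - F)) (E + (P j - F))) =
      (\<Sum>j<N. m j * form_inner n E E + 2 * (m j * form_inner n (P j) E) - m j * (2 * form_inner n F E)
        + m j * form_inner n (P j) (P j) - 2 * (m j * form_inner n (P j) F) + m j * form_inner n F F)"
  proof (intro sum.cong refl)
    fix j assume "j \<in> {..<N}"
    then have Pj: "P j \<in> forms n d" using P by simp
    have e: "form_inner n E (P j - F) = form_inner n (P j) E - form_inner n F E"
      using form_inner_diff_left[OF Pj F E n] by (simp only: form_inner_commute[of n E "P j - F"])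
    show "m j * form_inner n (E + (P j - F)) (E + (P j - F)) =
      m j * form_inner n E E + 2 * (m j * form_inner n (P j) E) - m j * (2 * form_inner n F E)
        + m j * form_inner n (P j) (P j) - 2 * (m j * form_inner n (P j) F) + m j * form_inner n F F"
      unfolding form_inner_square_add[OF E forms_diff[OF Pj F] n] form_inner_square_diff[OF Pj F n] e
      by (simp add: algebra_simps)
  qed
  also have "\<dots> = form_inner n E E + (\<Sum>j<N. m j * form_inner n (P j) (P j)) - form_inner n F F"
    using s[OF E] s[OF F] m
    by (simp add: sum.distrib sum_subtractf flip: sum_distrib_left sum_distrib_right)
  finally show ?thesis .
qed

text \<open>The variance identity with \<open>E = 0\<close> bounds the norm of a convex combination
  by the average over its members; translating by \<open>r_pow n k\<close>, of norm 1, accounts for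
  the rest. It is used for boundedness of the body only.\<close>

lemma Lf_tilde_bounded:
  assumes n: "n \<ge> 1" and k: "k \<ge> 1" and f: "f \<in> Lf_tilde n k"
  shows "form_inner n f f \<le> 2 * cg (2 * k) + 2"
proof -
  let ?F = "f + r_pow n k"
  have F: "?F \<in> Lf n k" using f by (simp add: Lf_tilde_def)
  have fM: "f \<in> forms n (2 * k)" "sphere_integral n f = 0" using f by (auto simp: Lf_tilde_def M_space_def)
  have S: "sphere_integral n ?F = 1"
    using fM by (simp add: sphere_integral_add[OF fM(1) r_pow_in_forms n] sphere_integral_r_pow[OF n])
  obtain N m w where d: "\<And>j. j < (N :: nat) \<Longrightarrow> 0 \<le> m j" "(\<Sum>j<N. m j) = 1"
    "\<And>j. j < N \<Longrightarrow> sqnorm n (w j) \<le> n" "?F = (\<Sum>j<N. m j *\<^sub>R lin n (w j) ^ (2 * k))"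
    using Lf_normalised_decomp[OF n k F S] by blast
  let ?P = "\<lambda>j. lin n (w j) ^ (2 * k)"
  have "0 \<le> (\<Sum>j<N. m j * form_inner n (0 + (?P j - ?F)) (0 + (?P j - ?F)))"
    using d(1) by (intro sum_nonneg mult_nonneg_nonneg form_inner_nonneg) auto
  also have "\<dots> = (\<Sum>j<N. m j * form_inner n (?P j) (?P j)) - form_inner n ?F ?F"
    unfolding d(4) using n by (subst variance_identity[of N ?P n "2 * k"]) (auto simp: lin_power_in_forms d(2))
  also have "(\<Sum>j<N. m j * form_inner n (?P j) (?P j)) \<le> (\<Sum>j<N. m j * cg (2 * k))"
    using d(1,3) form_inner_power_le[OF n k] by (intro sum_mono mult_left_mono) auto
  also have "\<dots> = cg (2 * k)" using d(2) by (simp flip: sum_distrib_right)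
  finally have FF: "form_inner n ?F ?F \<le> cg (2 * k)" by simp
  have "r_pow n k * r_pow n k = r_pow n (2 * k)" by (simp add: r_pow_def mult_2 power_add)
  then have "form_inner n (r_pow n k) (r_pow n k) = 1"
    by (simp add: form_inner_eq sphere_integral_r_pow[OF n])
  then show ?thesis
    using form_inner_square_diff_le[OF Lf_subset_forms[OF F] r_pow_in_forms n] FF by simp
qed

text \<open>\<open>convex_volume_lower\<close> also asks for a cube inside the body. The difference
  property provides it: each axis vector of length \<rho> is the difference of two points of the
  body, so the body contains a segment in every coordinate direction, and averages of points on
  these segments fill a cube.\<close>

theorem Lf_tilde_volume_lower:
  assumes n: "n \<ge> 1" and k: "k \<ge> 1" and D: "D_M n k \<ge> 1" and b: "orthonormal_basis_M n k b"
  shows "(inner_radius n k / 4) ^ D_M n k * measure (Leb (D_M n k)) (uball (D_M n k))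
    \<le> measure (completion (Leb (D_M n k))) (coord_set (D_M n k) b (Lf_tilde n k))"
proof -
  let ?D = "D_M n k" and ?K = "Lf_tilde n k" and ?\<rho> = "inner_radius n k"
  let ?X = "coord_set ?D b ?K"
  note \<rho> = inner_radius_pos[OF n k]
  have diff: "\<exists>x\<in>?X. \<exists>y\<in>?X. \<forall>i<?D. z i = x i - y i" if z: "z \<in> cball_Leb ?D (\<lambda>_. 0) ?\<rho>" for z
  proof -
    have "form_inner n (lincomb ?D b z) (lincomb ?D b z) \<le> ?\<rho>\<^sup>2"
      using z by (simp add: form_inner_lincomb[OF b n] cball_Leb_def)
    then obtain f g where fg: "f \<in> ?K" "g \<in> ?K" "lincomb ?D b z = f - g"
      using Lf_tilde_difference[OF n k lincomb_in_M[OF b]] by blast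
    obtain x where x: "x \<in> {..<?D} \<rightarrow>\<^sub>E UNIV" "f = lincomb ?D b x"
      using M_space_lincomb[OF b n Lf_tilde_subset_M[OF fg(1)]] .
    obtain y where y: "y \<in> {..<?D} \<rightarrow>\<^sub>E UNIV" "g = lincomb ?D b y"
      using M_space_lincomb[OF b n Lf_tilde_subset_M[OF fg(2)]] .
    have "lincomb ?D b z = lincomb ?D b (\<lambda>i. x i - y i)" using fg(3) x y by (simp add: lincomb_diff)
    then have "z i = x i - y i" if "i < ?D" for i
      using form_inner_lincomb_basis[OF b n that, of z] form_inner_lincomb_basis[OF b n that, of "\<lambda>i. x i - y i"] by simp
    moreover have "x \<in> ?X" "y \<in> ?X" using x y fg by (auto simp: coord_set_def)
    ultimately show ?thesis by blast
  qed
  have "\<exists>x\<in>?X. \<exists>y\<in>?X. \<forall>i<?D. ?\<rho> * evec j i = x i - y i" if "j < ?D" for j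
  proof -
    have "(\<lambda>i\<in>{..<?D}. ?\<rho> * evec j i) \<in> cball_Leb ?D (\<lambda>_. 0) ?\<rho>"
    proof -
      have "sqnorm ?D (\<lambda>i\<in>{..<?D}. ?\<rho> * evec j i) = sqnorm ?D (\<lambda>i. ?\<rho> * evec j i)" by (simp add: sqnorm_def)
      then show ?thesis using that by (simp add: cball_Leb_def sqnorm_scale sqnorm_evec)
    qed
    from diff[OF this] show ?thesis by auto
  qed
  then obtain x y where xy: "\<And>j. j < ?D \<Longrightarrow> x j \<in> ?X" "\<And>j. j < ?D \<Longrightarrow> y j \<in> ?X"
    "\<And>i j. j < ?D \<Longrightarrow> i < ?D \<Longrightarrow> ?\<rho> * evec j i = x j i - y j i" by metis
  \<comment> \<open>The centre is the average of the midpoints of the D segments. Averaging scales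
    each half-length \<rho>/2 by 1/D, whence \<open>r\<close>.\<close>
  define p where "p = (\<lambda>i\<in>{..<?D}. \<Sum>j<?D. (1 / ?D) * ((x j i + y j i) / 2))"
  define r where "r = ?\<rho> / (2 * ?D)"
  have r: "r > 0" using \<rho> D by (simp add: r_def)
  have box: "c \<in> ?X" if c: "c \<in> space (Leb ?D)" "\<forall>i<?D. \<bar>c i - p i\<bar> \<le> r" for c
  proof -
    \<comment> \<open>\<tau> is the position on the j-th segment, measured from its midpoint, that
      produces the displacement \<open>c j - p j\<close> after averaging.\<close>
    define \<tau> where "\<tau> = (\<lambda>j. ?D * (c j - p j) / ?\<rho>)"
    have \<tau>: "\<bar>\<tau> j\<bar> \<le> 1 / 2" if "j < ?D" for j
    proof -
      have "\<bar>\<tau> j\<bar> = ?D * \<bar>c j - p j\<bar> / ?\<rho>" using \<rho> by (simp add: \<tau>_def abs_mult)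
      also have "\<dots> \<le> ?D * r / ?\<rho>" using c(2) that \<rho> by (intro divide_right_mono mult_left_mono) auto
      also have "\<dots> = 1 / 2" using \<rho> D by (simp add: r_def)
      finally show ?thesis .
    qed
    let ?z = "\<lambda>j. (1 / 2 + \<tau> j) *\<^sub>R lincomb ?D b (x j) + (1 / 2 - \<tau> j) *\<^sub>R lincomb ?D b (y j)"
    have "?z j \<in> ?K" if "j < ?D" for j
      using xy(1,2)[OF that] \<tau>[OF that]
      by (intro convexD[OF convex_Lf_tilde[OF n k]]) (auto simp: coord_set_def abs_le_iff)
    then have "(\<Sum>j<?D. (1 / ?D) *\<^sub>R ?z j) \<in> ?K"
      using D by (intro convex_sum convex_Lf_tilde n k) auto
    moreover have "(\<Sum>j<?D. (1 / ?D) *\<^sub>R ?z j) = lincomb ?D b c"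
    proof -
      have "(\<Sum>j<?D. (1 / ?D) *\<^sub>R ?z j) =
          lincomb ?D b (\<lambda>i. \<Sum>j<?D. (1 / ?D) * ((1 / 2 + \<tau> j) * x j i + (1 / 2 - \<tau> j) * y j i))"
        unfolding lincomb_def scaleR_sum_left sum.distrib[symmetric] scaleR_sum_right
        by (subst sum.swap) (simp add: scaleR_add_left algebra_simps)
      also have "\<dots> = lincomb ?D b c"
      proof (rule lincomb_cong)
        fix i assume i: "i < ?D"
        have "(\<Sum>j<?D. (1 / ?D) * ((1 / 2 + \<tau> j) * x j i + (1 / 2 - \<tau> j) * y j i)) =
            (\<Sum>j<?D. (1 / ?D) * ((x j i + y j i) / 2) + (1 / ?D) * \<tau> j * (x j i - y j i))"
          by (intro sum.cong) (auto simp: field_simps)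
        also have "\<dots> = p i + (\<Sum>j<?D. (1 / ?D) * \<tau> j * (?\<rho> * evec j i))"
          using i xy(3) by (simp add: sum.distrib p_def)
        also have "(\<Sum>j<?D. (1 / ?D) * \<tau> j * (?\<rho> * evec j i)) = (\<Sum>j<?D. if j = i then (1 / ?D) * \<tau> j * ?\<rho> else 0)"
          by (intro sum.cong) (auto simp: evec_def)
        also have "\<dots> = c i - p i" using i \<rho> D by (simp add: \<tau>_def)
        finally show "(\<Sum>j<?D. (1 / ?D) * ((1 / 2 + \<tau> j) * x j i + (1 / 2 - \<tau> j) * y j i)) = c i" by simp
      qed
      finally show ?thesis .
    qed
    ultimately show ?thesis using c(1) by (simp add: coord_set_def space_Leb)
  qed
  have bdd: "?X \<subseteq> cball_Leb ?D (\<lambda>_. 0) (2 * cg (2 * k) + 2)"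
  proof
    fix c assume c: "c \<in> ?X"
    then have "sqnorm ?D c \<le> 2 * cg (2 * k) + 2"
      using Lf_tilde_bounded[OF n k, of "lincomb ?D b c"] by (simp add: coord_set_def form_inner_lincomb[OF b n])
    \<comment> \<open>The ball is given by its radius, so the bound on the squared norm is itself
      squared; being at least 1, it only grows.\<close>
    also have "\<dots> \<le> (2 * cg (2 * k) + 2)\<^sup>2" using cg_ge_1[of "2 * k"] by (intro self_le_power) auto
    finally show "c \<in> cball_Leb ?D (\<lambda>_. 0) (2 * cg (2 * k) + 2)" using c by (simp add: cball_Leb_def coord_set_def)
  qed
  show ?thesis
  proof (rule convex_volume_lower[OF cvx_coord_set[OF convex_Lf_tilde[OF n k]] _ r box bdd _ \<rho> diff])
    show "p \<in> space (Leb ?D)" by (simp add: p_def space_Leb)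
    show "0 < 2 * cg (2 * k) + 2" using cg_ge_1[of "2 * k"] by linarith
  qed
qed

section \<open>The dimension\<close>

definition sqfree_mon :: "nat set \<Rightarrow> nat \<Rightarrow>\<^sub>0 nat" where
  "sqfree_mon I = (\<Sum>i\<in>I. single i 1)"

lemma lookup_sqfree_mon: "finite I \<Longrightarrow> lookup (sqfree_mon I) i = (if i \<in> I then 1 else 0)"
  by (simp add: sqfree_mon_def lookup_sum lookup_single when_def)

text \<open>Squarefree monomials of degree 2k are brought to mean zero by subtracting multiples of
  the 2k-th power of the first variable. That power is not squarefree, so the squarefree
  coefficients are unchanged and independence survives.\<close>

lemma D_M_ge:
  assumes n: "n \<ge> 1" and k: "k \<ge> 1"
  shows "n choose (2 * k) \<le> D_M n k"
proof -
  obtain b where b: "orthonormal_basis_M n k b" using orthonormal_basis_exists[OF n k] by blast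
  define \<I> where "\<I> = {I. I \<subseteq> {..<n} \<and> card I = 2 * k}"
  have fin: "finite \<I>" and fI: "\<And>I. I \<in> \<I> \<Longrightarrow> finite I"
    by (auto simp: \<I>_def finite_subset)
  let ?P = "single (single 0 (2 * k)) 1 :: rpoly"
  have P: "?P \<in> forms n (2 * k)" using n by (intro forms_single) (auto simp: mdeg_single)
  have "poly_eval ?P = poly_eval (lin n (evec 0) ^ (2 * k))"
    using n by (intro ext) (simp add: poly_eval_single mon_single poly_eval_power lin_evec poly_eval_poly_var)
  then have "sphere_integral n ?P = sphere_integral n (lin n (evec 0) ^ (2 * k))"
    by (simp add: sphere_integral_def)
  moreover have "(sqnorm n (evec 0) / n) ^ k \<le> sphere_integral n (lin n (evec 0) ^ (2 * k))"
    by (rule lin_power_integral_ge[OF k n])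
  moreover have "(sqnorm n (evec 0) / n) ^ k > 0" using n by (simp add: sqnorm_evec)
  ultimately have s: "sphere_integral n ?P > 0" by linarith
  define S where "S = (\<lambda>I. single (sqfree_mon I) 1 :: rpoly)"
  define f where "f = (\<lambda>I. S I - (sphere_integral n (S I) / sphere_integral n ?P) *\<^sub>R ?P)"
  have S: "S I \<in> forms n (2 * k)" if "I \<in> \<I>" for I
  proof -
    have "keys (sqfree_mon I) \<subseteq> I"
      using lookup_sqfree_mon[OF fI[OF that]] by (auto simp: in_keys_iff split: if_splits)
    moreover have "mdeg (sqfree_mon I) = 2 * k"
      using that fI[OF that] by (simp add: sqfree_mon_def mdeg_sum mdeg_single \<I>_def)
    ultimately show ?thesis unfolding S_def using that by (intro forms_single) (auto simp: \<I>_def)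
  qed
  have fM: "f I \<in> M_space n k" if "I \<in> \<I>" for I
    using S[OF that] P s n unfolding M_space_def f_def
    by (simp add: forms_diff forms_scaleR sphere_integral_diff[OF S[OF that] forms_scaleR[OF P]] sphere_integral_scaleR)
  have lookup_f: "lookup (f I) (sqfree_mon J) = (if I = J then 1 else 0)" if "I \<in> \<I>" "J \<in> \<I>" for I J
  proof -
    have "sqfree_mon I = sqfree_mon J \<longleftrightarrow> I = J"
    proof
      assume "sqfree_mon I = sqfree_mon J"
      then have "(if i \<in> I then 1 else 0 :: nat) = (if i \<in> J then 1 else 0)" for i
        using lookup_sqfree_mon[OF fI[OF that(1)], of i] lookup_sqfree_mon[OF fI[OF that(2)], of i] by simp
      then show "I = J" by (metis set_eqI zero_neq_one)
    qed simp
    moreover have "single 0 (2 * k) \<noteq> sqfree_mon J"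
    proof
      assume "single 0 (2 * k) = sqfree_mon J"
      then have "2 * k = (if 0 \<in> J then 1 else 0)"
        using lookup_sqfree_mon[OF fI[OF that(2)], of 0] by (metis lookup_single_eq)
      then show False using k by (auto split: if_splits)
    qed
    ultimately show ?thesis
      by (simp add: f_def S_def lookup_minus lookup_scaleR lookup_single when_def)
  qed
  have inj: "inj_on f \<I>"
  proof (rule inj_onI)
    fix I J assume IJ: "I \<in> \<I>" "J \<in> \<I>" "f I = f J"
    have "lookup (f I) (sqfree_mon J) = 1" using IJ lookup_f[of J J] by simp
    then show "I = J" using lookup_f[OF IJ(1,2)] by (simp split: if_splits)
  qed
  have ind: "independent (f ` \<I>)"
  proof (rule independent_if_scalars_zero)
    fix g x assume g: "(\<Sum>x\<in>f ` \<I>. g x *\<^sub>R x) = 0" and "x \<in> f ` \<I>"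
    then obtain J where J: "J \<in> \<I>" "x = f J" by auto
    have "(\<Sum>I\<in>\<I>. g (f I) *\<^sub>R f I) = 0" using g inj by (simp add: sum.reindex)
    then have "lookup (\<Sum>I\<in>\<I>. g (f I) *\<^sub>R f I) (sqfree_mon J) = 0" by simp
    then have "(\<Sum>I\<in>\<I>. g (f I) * (if I = J then 1 else 0)) = 0"
      using J(1) by (simp add: lookup_sum lookup_scaleR lookup_f cong: sum.cong)
    then show "g x = 0" using J fin by (simp add: if_distrib[of "\<lambda>t. _ * t"] cong: if_cong)
  qed (simp add: fin)
  have "f ` \<I> \<subseteq> span (b ` {..<D_M n k})" using fM b by (auto simp: orthonormal_basis_M_def)
  then have "card (f ` \<I>) \<le> card (b ` {..<D_M n k})"
    using independent_span_bound[OF _ ind, of "b ` {..<D_M n k}"] by simp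
  also have "\<dots> \<le> D_M n k" using card_image_le[of "{..<D_M n k}" b] by simp
  finally have "card \<I> \<le> D_M n k" by (simp add: card_image[OF inj])
  then show ?thesis using n_subsets[of "{..<n}" "2 * k"] by (simp add: \<I>_def)
qed

section \<open>The upper bound\<close>

lemma weighted_average_le:
  fixes a :: "nat \<Rightarrow> real"
  assumes "\<And>j. j < N \<Longrightarrow> 0 \<le> m j" "(\<Sum>j<N. m j) = 1" "(\<Sum>j<N. m j * a j) \<le> c"
  shows "\<exists>j<N. a j \<le> c"
proof (rule ccontr)
  assume "\<not> ?thesis"
  then have gt: "c < a j" if "j < N" for j using that by force
  have "(\<Sum>j<N. m j * (a j - c)) = (\<Sum>j<N. m j * a j) - c"
    using assms(2) by (simp add: right_diff_distrib sum_subtractf flip: sum_distrib_right)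
  then have le: "(\<Sum>j<N. m j * (a j - c)) \<le> 0" using assms(3) by simp
  have nn: "0 \<le> m j * (a j - c)" if "j \<in> {..<N}" for j
    using assms(1)[of j] gt[of j] that by simp
  then have "(\<Sum>j<N. m j * (a j - c)) = 0" using le sum_nonneg[of "{..<N}" "\<lambda>j. m j * (a j - c)"] by auto
  then have "\<forall>j\<in>{..<N}. m j * (a j - c) = 0" using nn by (subst (asm) sum_nonneg_eq_0_iff) auto
  then have "m j = 0" if "j < N" for j using gt[OF that] that by auto
  then show False using assms(2) by simp
qed

text \<open>Maurey's lemma, by a greedy choice: the variance identity yields a summand which does not
  increase the squared norm of the accumulated error by more than \<open>C\<close>.\<close>

lemma greedy_approximation:
  assumes P: "\<And>j. j < N \<Longrightarrow> P j \<in> forms n d" "\<And>j. j < N \<Longrightarrow> form_inner n (P j) (P j) \<le> C"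
    and m: "\<And>j. j < N \<Longrightarrow> 0 \<le> m j" "(\<Sum>j<(N::nat). m j) = (1::real)" and n: "n \<ge> 1"
    and F: "F = (\<Sum>j<N. m j *\<^sub>R P j)"
  shows "\<exists>\<tau>. (\<forall>s<t. \<tau> s < N) \<and>
    form_inner n (\<Sum>s<t. P (\<tau> s) - F) (\<Sum>s<t. P (\<tau> s) - F) \<le> real t * C"
proof (induction t)
  case 0
  then show ?case by simp
next
  case (Suc t)
  then obtain \<tau> where \<tau>: "\<forall>s<t. \<tau> s < N"
    "form_inner n (\<Sum>s<t. P (\<tau> s) - F) (\<Sum>s<t. P (\<tau> s) - F) \<le> real t * C" by blast
  let ?E = "\<Sum>s<t. P (\<tau> s) - F"
  have FF: "F \<in> forms n d" unfolding F using P by (intro forms_sum forms_scaleR) auto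
  have E: "?E \<in> forms n d" using P \<tau>(1) FF by (intro forms_sum forms_diff) auto
  have "(\<Sum>j<N. m j * form_inner n (?E + (P j - F)) (?E + (P j - F))) =
      form_inner n ?E ?E + (\<Sum>j<N. m j * form_inner n (P j) (P j)) - form_inner n F F"
    unfolding F by (rule variance_identity[OF P(1) m(2) _ n]) (use E in \<open>simp_all add: F\<close>)
  also have "\<dots> \<le> real t * C + (\<Sum>j<N. m j * C) - 0"
    using P(2) m(1) \<tau>(2) form_inner_nonneg
    by (intro add_mono diff_mono sum_mono mult_left_mono) auto
  also have "\<dots> = real (Suc t) * C" using m(2) by (simp add: algebra_simps flip: sum_distrib_left)
  finally have "(\<Sum>j<N. m j * form_inner n (?E + (P j - F)) (?E + (P j - F))) \<le> real (Suc t) * C" .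
  from weighted_average_le[OF m this]
  obtain j where j: "j < N" "form_inner n (?E + (P j - F)) (?E + (P j - F)) \<le> real (Suc t) * C" by blast
  have "(\<Sum>s<Suc t. P ((\<tau>(t := j)) s) - F) = ?E + (P j - F)" by simp
  then show ?case using j \<tau>(1) by (intro exI[of _ "\<tau>(t := j)"]) (auto simp: less_Suc_eq)
qed

lemma form_inner_le_sup:
  assumes "h \<in> forms n d" "n \<ge> 1" "\<And>x. x \<in> unit_sphere n \<Longrightarrow> \<bar>poly_eval h x\<bar> \<le> e"
  shows "form_inner n h h \<le> e\<^sup>2"
proof -
  interpret prob_space "sphere_measure n" using assms(2) by (rule prob_space_sphere_measure)
  have "form_inner n h h = (LINT x|sphere_measure n. poly_eval (h * h) x)"
    by (simp add: form_inner_def poly_eval_mult)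
  also have "\<dots> \<le> (LINT x|sphere_measure n. e\<^sup>2)"
  proof (rule integral_mono)
    fix x assume "x \<in> space (sphere_measure n)"
    then have "\<bar>poly_eval h x\<bar> \<le> e" using assms(3) by (simp add: space_sphere_measure)
    then have "\<bar>poly_eval h x\<bar>\<^sup>2 \<le> e\<^sup>2" by (intro power_mono) auto
    then show "poly_eval (h * h) x \<le> e\<^sup>2" by (simp add: poly_eval_mult power2_eq_square)
  qed (use integrable_sphere[OF forms_mult[OF assms(1,1)] assms(2)] in auto)
  finally show ?thesis by (simp add: prob_space)
qed

text \<open>Multiples of 1/Q between -n and n. The range is generous for vectors with squared norm
  at most n, but the cardinality matters only through its logarithm.\<close>

definition grid :: "nat \<Rightarrow> nat \<Rightarrow> (nat \<Rightarrow> real) set" where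
  "grid n Q = Pi\<^sub>E {..<n} (\<lambda>_. (\<lambda>j. real_of_int j / Q) ` {- int (n * Q)..int (n * Q)})"

lemma finite_grid: "finite (grid n Q)"
  unfolding grid_def by (intro finite_PiE) auto

lemma card_grid: "card (grid n Q) \<le> (2 * n * Q + 1) ^ n"
proof -
  have "card ((\<lambda>j. real_of_int j / Q) ` {- int (n * Q)..int (n * Q)}) \<le> card {- int (n * Q)..int (n * Q)}"
    by (rule card_image_le) simp
  also have "\<dots> = 2 * n * Q + 1" by (simp add: nat_eq_iff algebra_simps)
  finally show ?thesis unfolding grid_def by (simp add: card_PiE power_mono)
qed

lemma grid_approx:
  assumes n: "n \<ge> 1" and Q: "Q \<ge> 1" and w: "sqnorm n w \<le> n"
  obtains g where "g \<in> grid n Q" "\<And>i. i < n \<Longrightarrow> \<bar>w i - g i\<bar> \<le> 1 / Q"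
proof -
  define g where "g = (\<lambda>i\<in>{..<n}. real_of_int \<lfloor>w i * Q\<rfloor> / Q)"
  have "\<lfloor>w i * Q\<rfloor> \<in> {- int (n * Q)..int (n * Q)}" if "i < n" for i
  proof -
    have "(w i)\<^sup>2 \<le> sqnorm n w" unfolding sqnorm_def using that by (intro member_le_sum) auto
    also have "\<dots> \<le> (real n)\<^sup>2" using w n by (simp add: self_le_power order.trans)
    finally have "\<bar>w i\<bar> \<le> n" by (simp add: abs_le_square_iff[symmetric])
    then have "\<bar>w i * Q\<bar> \<le> real n * Q" by (simp add: abs_mult mult_right_mono)
    then have "- (real n * Q) \<le> w i * Q" "w i * Q \<le> real n * Q" by (auto simp: abs_le_iff)
    then show ?thesis by (auto simp: le_floor_iff floor_le_iff)
  qed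
  then have "g \<in> grid n Q" unfolding grid_def g_def by auto
  moreover have "\<bar>w i - g i\<bar> \<le> 1 / Q" if "i < n" for i
  proof -
    have "w i - g i = (w i * Q - \<lfloor>w i * Q\<rfloor>) / Q" using that Q by (simp add: g_def field_simps)
    moreover have "\<bar>w i * Q - \<lfloor>w i * Q\<rfloor>\<bar> \<le> 1"
      using floor_correct[of "w i * Q"] by (simp add: abs_le_iff) linarith
    ultimately show ?thesis using Q by (simp add: divide_right_mono)
  qed
  ultimately show ?thesis by (rule that)
qed

text \<open>After division by 2n both values lie in [-1, 1], where the p-th power is p-Lipschitz.
  The condition \<open>n \<le> Q\<close> keeps the perturbed value within 2n.\<close>

lemma lin_power_perturb:
  fixes Q p :: nat
  assumes n: "n \<ge> 1" and Q: "Q \<ge> 1" and Qn: "n \<le> Q" and w: "sqnorm n w \<le> n" and g: "\<And>i. i < n \<Longrightarrow> \<bar>w i - g i\<bar> \<le> 1 / Q"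
    and x: "x \<in> unit_sphere n"
  shows "\<bar>poly_eval (lin n w ^ p) x - poly_eval (lin n g ^ p) x\<bar> \<le> p * (2 * real n) ^ p * (n / Q)"
proof -
  let ?a = "\<Sum>i<n. w i * x i" and ?b = "\<Sum>i<n. g i * x i"
  have x1: "\<bar>x i\<bar> \<le> 1" if "i < n" for i using sphere_coord_le[OF x that] .
  have "?a\<^sup>2 \<le> sqnorm n w * sqnorm n x" unfolding sqnorm_def by (rule Cauchy_Schwarz_ineq_sum)
  also have "\<dots> \<le> (real n)\<^sup>2" using w x n by (simp add: unit_sphere_def self_le_power order.trans)
  finally have a: "\<bar>?a\<bar> \<le> n" by (simp add: abs_le_square_iff[symmetric])
  have "?a - ?b = (\<Sum>i<n. (w i - g i) * x i)" by (simp add: left_diff_distrib sum_subtractf)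
  also have "\<bar>\<dots>\<bar> \<le> (\<Sum>i<n. \<bar>w i - g i\<bar> * \<bar>x i\<bar>)"
    using sum_abs[of "\<lambda>i. (w i - g i) * x i" "{..<n}"] by (simp add: abs_mult)
  also have "\<dots> \<le> (\<Sum>i<n. 1 / Q * 1)" using g x1 by (intro sum_mono mult_mono) auto
  finally have ab: "\<bar>?a - ?b\<bar> \<le> n / Q" by simp
  also have "n / Q \<le> 1" using Qn Q by simp
  finally have b: "\<bar>?b\<bar> \<le> 2 * n" using a n by linarith
  let ?R = "2 * real n"
  have R: "?R \<ge> 1" using n by simp
  have "\<bar>(?a / ?R) ^ p - (?b / ?R) ^ p\<bar> \<le> p * \<bar>?a / ?R - ?b / ?R\<bar>"
    using norm_power_diff[of "?a / ?R" "?b / ?R" p] a b n by (simp add: abs_divide)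
  also have "\<dots> \<le> p * (n / Q)"
  proof -
    have "\<bar>?a / ?R - ?b / ?R\<bar> = \<bar>?a - ?b\<bar> / ?R" using R by (simp add: diff_divide_distrib[symmetric] abs_divide)
    also have "\<dots> \<le> \<bar>?a - ?b\<bar> / 1" using R by (intro divide_left_mono) auto
    finally show ?thesis using ab by (intro mult_left_mono) auto
  qed
  finally have "?R ^ p * \<bar>(?a / ?R) ^ p - (?b / ?R) ^ p\<bar> \<le> ?R ^ p * (p * (n / Q))"
    using R by (intro mult_left_mono) auto
  moreover have "?R ^ p * \<bar>(?a / ?R) ^ p - (?b / ?R) ^ p\<bar> = \<bar>?a ^ p - ?b ^ p\<bar>"
  proof -
    have "?R ^ p * \<bar>(?a / ?R) ^ p - (?b / ?R) ^ p\<bar> = \<bar>?R ^ p * ((?a / ?R) ^ p - (?b / ?R) ^ p)\<bar>"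
      using R by (simp add: abs_mult)
    also have "?R ^ p * ((?a / ?R) ^ p - (?b / ?R) ^ p) = ?a ^ p - ?b ^ p"
      using n by (simp add: right_diff_distrib power_divide)
    finally show ?thesis .
  qed
  ultimately show ?thesis by (simp add: poly_eval_power poly_eval_lin mult_ac)
qed

text \<open>The factor 2k and one (2n)^(2k) undo the Lipschitz constant of
  \<open>lin_power_perturb\<close>; the second (2n)^(2k) leaves an error of at most n^(-k).\<close>

definition mesh :: "nat \<Rightarrow> nat \<Rightarrow> nat" where
  "mesh n k = 2 * k * (2 * n) ^ (4 * k)"

lemma mesh_bounds:
  assumes "n \<ge> 1" "k \<ge> 1"
  shows "mesh n k \<ge> 1" "n \<le> mesh n k"
    "real (2 * k) * (2 * real n) ^ (2 * k) * (n / mesh n k) \<le> 1 / real n ^ k"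
proof -
  have "n \<le> 2 * n" by simp
  also have "\<dots> \<le> (2 * n) ^ (4 * k)" using assms by (intro self_le_power) auto
  also have "\<dots> \<le> mesh n k" using assms by (simp add: mesh_def)
  finally show "n \<le> mesh n k" .
  then show "mesh n k \<ge> 1" using assms by linarith
  have "real n * real n ^ k = real n ^ Suc k" by simp
  also have "\<dots> \<le> real n ^ (2 * k)" using assms by (intro power_increasing) auto
  also have "\<dots> \<le> (2 * real n) ^ (2 * k)" by (intro power_mono) auto
  finally have le: "real n * real n ^ k \<le> (2 * real n) ^ (2 * k)" .
  have "(2 * real n) ^ (4 * k) = (2 * real n) ^ (2 * k) * (2 * real n) ^ (2 * k)"
    unfolding power_add[symmetric] by simp
  then have "real (2 * k) * (2 * real n) ^ (2 * k) * (n / mesh n k) = n / (2 * real n) ^ (2 * k)"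
    using assms by (simp add: mesh_def)
  also have "\<dots> \<le> 1 / real n ^ k" using le assms by (simp add: field_simps)
  finally show "real (2 * k) * (2 * real n) ^ (2 * k) * (n / mesh n k) \<le> 1 / real n ^ k" .
qed

text \<open>The error is the sampling error \<open>A\<close>, from Maurey's lemma, plus the rounding
  error \<open>B\<close>, bounded uniformly on the sphere. The factors 2 come from squaring a sum of
  two terms.\<close>

lemma Lf_grid_approx:
  fixes m :: nat
  assumes n: "n \<ge> 1" and k: "k \<ge> 1" and m: "m \<ge> 1" and F: "F \<in> Lf n k" "sphere_integral n F = 1"
  shows "\<exists>\<tau>\<in>Pi\<^sub>E {..<m} (\<lambda>_. grid n (mesh n k)).
    form_inner n (F - (1 / m) *\<^sub>R (\<Sum>s<m. lin n (\<tau> s) ^ (2 * k))) (F - (1 / m) *\<^sub>R (\<Sum>s<m. lin n (\<tau> s) ^ (2 * k)))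
      \<le> 2 * cg (2 * k) / m + 2 * (1 / real n ^ k)\<^sup>2"
proof -
  let ?Q = "mesh n k"
  obtain N \<mu> w where d: "\<And>j. j < (N :: nat) \<Longrightarrow> 0 \<le> \<mu> j" "(\<Sum>j<N. \<mu> j) = 1"
    "\<And>j. j < N \<Longrightarrow> sqnorm n (w j) \<le> n" "F = (\<Sum>j<N. \<mu> j *\<^sub>R lin n (w j) ^ (2 * k))"
    using Lf_normalised_decomp[OF n k F] by blast
  let ?P = "\<lambda>j. lin n (w j) ^ (2 * k)"
  obtain \<sigma> where \<sigma>: "\<forall>s<m. \<sigma> s < N"
    "form_inner n (\<Sum>s<m. ?P (\<sigma> s) - F) (\<Sum>s<m. ?P (\<sigma> s) - F) \<le> real m * cg (2 * k)"
    using greedy_approximation[of N ?P n "2 * k" "cg (2 * k)" \<mu> F m, OF lin_power_in_forms form_inner_power_le[OF n k d(3)] d(1,2) n d(4)]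
    by blast
  have "\<exists>g. g \<in> grid n ?Q \<and> (\<forall>i<n. \<bar>w (\<sigma> s) i - g i\<bar> \<le> 1 / ?Q)" if "s < m" for s
    using grid_approx[OF n mesh_bounds(1)[OF n k] d(3)[of "\<sigma> s"]] \<sigma>(1) that by blast
  then obtain g where g: "\<And>s. s < m \<Longrightarrow> g s \<in> grid n ?Q" "\<And>s i. s < m \<Longrightarrow> i < n \<Longrightarrow> \<bar>w (\<sigma> s) i - g s i\<bar> \<le> 1 / ?Q"
    by metis
  define \<tau> where "\<tau> = restrict g {..<m}"
  have \<tau>: "\<tau> \<in> Pi\<^sub>E {..<m} (\<lambda>_. grid n ?Q)" using g(1) by (simp add: \<tau>_def)
  let ?y = "(1 / m) *\<^sub>R (\<Sum>s<m. lin n (\<tau> s) ^ (2 * k))"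
  define A where "A = (- 1 / m) *\<^sub>R (\<Sum>s<m. ?P (\<sigma> s) - F)"
  define B where "B = (1 / m) *\<^sub>R (\<Sum>s<m. ?P (\<sigma> s) - lin n (\<tau> s) ^ (2 * k))"
  have Ff: "F \<in> forms n (2 * k)" using F(1) by (rule Lf_subset_forms)
  have A: "A \<in> forms n (2 * k)" unfolding A_def
    using Ff by (intro forms_scaleR forms_sum forms_diff lin_power_in_forms)
  have B: "B \<in> forms n (2 * k)" unfolding B_def
    by (intro forms_scaleR forms_sum forms_diff lin_power_in_forms)
  have "F - ?y = A + B"
  proof -
    have "(\<Sum>s<m. F) = real m *\<^sub>R F" by (simp add: sum_constant_scaleR del: sum_constant)
    then show ?thesis using m
      by (simp add: A_def B_def sum_subtractf scaleR_diff_right)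
  qed
  moreover have "form_inner n A A \<le> cg (2 * k) / m"
  proof -
    have "form_inner n A A = (1 / m)\<^sup>2 * form_inner n (\<Sum>s<m. ?P (\<sigma> s) - F) (\<Sum>s<m. ?P (\<sigma> s) - F)"
      unfolding A_def form_inner_scaleR_left form_inner_scaleR_right by (simp add: power2_eq_square)
    also have "\<dots> \<le> (1 / m)\<^sup>2 * (real m * cg (2 * k))" using \<sigma>(2) by (intro mult_left_mono) auto
    also have "\<dots> = cg (2 * k) / m" using m by (simp add: power2_eq_square)
    finally show ?thesis .
  qed
  moreover have "form_inner n B B \<le> (1 / real n ^ k)\<^sup>2"
  proof (rule form_inner_le_sup[OF B n])
    fix x assume x: "x \<in> unit_sphere n"
    have "\<bar>poly_eval B x\<bar> = (1 / m) * \<bar>\<Sum>s<m. poly_eval (?P (\<sigma> s)) x - poly_eval (lin n (\<tau> s) ^ (2 * k)) x\<bar>"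
      by (simp add: B_def poly_eval_scaleR poly_eval_sum poly_eval_diff abs_mult)
    also have "\<dots> \<le> (1 / m) * (\<Sum>s<m. \<bar>poly_eval (?P (\<sigma> s)) x - poly_eval (lin n (\<tau> s) ^ (2 * k)) x\<bar>)"
      by (intro mult_left_mono sum_abs) simp
    also have "\<dots> \<le> (1 / m) * (\<Sum>s<m. 1 / real n ^ k)"
    proof (intro mult_left_mono sum_mono)
      fix s assume s: "s \<in> {..<m}"
      have "\<bar>poly_eval (?P (\<sigma> s)) x - poly_eval (lin n (\<tau> s) ^ (2 * k)) x\<bar> \<le> real (2 * k) * (2 * real n) ^ (2 * k) * (n / ?Q)"
        using s \<sigma>(1) d(3) g(2) by (intro lin_power_perturb n mesh_bounds k x) (auto simp: \<tau>_def)
      also note mesh_bounds(3)[OF n k]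
      finally show "\<bar>poly_eval (?P (\<sigma> s)) x - poly_eval (lin n (\<tau> s) ^ (2 * k)) x\<bar> \<le> 1 / real n ^ k" .
    qed simp
    also have "\<dots> = 1 / real n ^ k" using m by simp
    finally show "\<bar>poly_eval B x\<bar> \<le> 1 / real n ^ k" .
  qed
  ultimately have "form_inner n (F - ?y) (F - ?y) \<le> 2 * cg (2 * k) / m + 2 * (1 / real n ^ k)\<^sup>2"
    using form_inner_square_add_le[OF A B n] by simp
  then show ?thesis using \<tau> by blast
qed

text \<open>The averages \<open>y \<tau>\<close> need not have mean 1, so the pieces are cut out by
  distance in the space of all forms; the difference of two points of a piece lies in
  \<open>M_space n k\<close> again, and its norm there is at most 2\<rho>.\<close>

theorem Lf_tilde_volume_upper:
  fixes m :: nat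
  assumes n: "n \<ge> 1" and k: "k \<ge> 1" and m: "m \<ge> 1" and b: "orthonormal_basis_M n k b"
    and \<rho>: "\<rho> > 0" "2 * cg (2 * k) / m + 2 * (1 / real n ^ k)\<^sup>2 \<le> \<rho>\<^sup>2"
  shows "measure (completion (Leb (D_M n k))) (coord_set (D_M n k) b (Lf_tilde n k))
    \<le> real ((2 * n * mesh n k + 1) ^ (n * m)) * (2 * \<rho>) ^ D_M n k * measure (Leb (D_M n k)) (uball (D_M n k))"
proof -
  let ?D = "D_M n k" and ?J = "Pi\<^sub>E {..<m} (\<lambda>_. grid n (mesh n k))"
  let ?X = "coord_set ?D b (Lf_tilde n k)"
  define y where "y = (\<lambda>\<tau>. (1 / m) *\<^sub>R (\<Sum>s<m. lin n (\<tau> s) ^ (2 * k)))"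
  define h where "h = (\<lambda>\<tau> c. lincomb ?D b c + r_pow n k - y \<tau>)"
  define S where "S = (\<lambda>\<tau>. {c. form_inner n (h \<tau> c) (h \<tau> c) \<le> \<rho>\<^sup>2})"
  have yf: "y \<tau> \<in> forms n (2 * k)" for \<tau> unfolding y_def by (intro forms_scaleR forms_sum lin_power_in_forms)
  have hf: "h \<tau> c \<in> forms n (2 * k)" for \<tau> c
    unfolding h_def using M_space_forms[OF lincomb_in_M[OF b]] r_pow_in_forms yf by (intro forms_diff forms_add)
  have finJ: "finite ?J" by (intro finite_PiE) (auto simp: finite_grid)
  have "card ?J = card (grid n (mesh n k)) ^ m" by (simp add: card_PiE)
  also have "\<dots> \<le> ((2 * n * mesh n k + 1) ^ n) ^ m" by (intro power_mono card_grid) auto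
  also have "\<dots> = (2 * n * mesh n k + 1) ^ (n * m)" by (simp add: power_mult)
  finally have cJ: "card ?J \<le> (2 * n * mesh n k + 1) ^ (n * m)" .
  have "measure (completion (Leb ?D)) ?X \<le> real (card ?J) * (2 * \<rho>) ^ ?D * measure (Leb ?D) (uball ?D)"
  proof (rule volume_covering_upper[OF finJ, where S = S])
    show "?X \<subseteq> (\<Union>\<tau>\<in>?J. S \<tau>)"
    proof
      fix c assume c: "c \<in> ?X"
      let ?f = "lincomb ?D b c"
      have f: "?f \<in> Lf_tilde n k" using c by (simp add: coord_set_def)
      then have F: "?f + r_pow n k \<in> Lf n k" by (simp add: Lf_tilde_def)
      have "?f \<in> forms n (2 * k)" "sphere_integral n ?f = 0" using f by (auto simp: Lf_tilde_def M_space_def)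
      then have S1: "sphere_integral n (?f + r_pow n k) = 1"
        by (simp add: sphere_integral_add[OF _ r_pow_in_forms n] sphere_integral_r_pow[OF n])
      obtain \<tau> where "\<tau> \<in> ?J" "form_inner n (h \<tau> c) (h \<tau> c) \<le> 2 * cg (2 * k) / m + 2 * (1 / real n ^ k)\<^sup>2"
        using Lf_grid_approx[OF n k m F S1] unfolding h_def y_def by blast
      then show "c \<in> (\<Union>\<tau>\<in>?J. S \<tau>)" using \<rho>(2) by (auto simp: S_def intro: order.trans)
    qed
    show "?X \<subseteq> space (Leb ?D)" by (auto simp: coord_set_def space_Leb)
    fix \<tau> c c' assume c: "c \<in> ?X \<inter> S \<tau>" "c' \<in> ?X \<inter> S \<tau>"
    have "h \<tau> c - h \<tau> c' = lincomb ?D b (\<lambda>i. c i - c' i)" by (simp add: h_def lincomb_diff)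
    then have "sqnorm ?D (\<lambda>i. c i - c' i) = form_inner n (h \<tau> c - h \<tau> c') (h \<tau> c - h \<tau> c')"
      by (simp add: form_inner_lincomb[OF b n])
    also have "\<dots> \<le> 2 * form_inner n (h \<tau> c) (h \<tau> c) + 2 * form_inner n (h \<tau> c') (h \<tau> c')"
      by (rule form_inner_square_diff_le[OF hf hf n])
    also have "\<dots> \<le> (2 * \<rho>)\<^sup>2" using c by (simp add: S_def power_mult_distrib)
    finally show "sqnorm ?D (\<lambda>i. c i - c' i) \<le> (2 * \<rho>)\<^sup>2" .
  qed (use \<rho> in simp)
  also have "\<dots> \<le> real ((2 * n * mesh n k + 1) ^ (n * m)) * (2 * \<rho>) ^ ?D * measure (Leb ?D) (uball ?D)"
    using cJ \<rho>(1) by (intro mult_right_mono) (auto simp only: of_nat_mono of_nat_le_iff measure_nonneg zero_le_power mult_nonneg_nonneg)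
  finally show ?thesis .
qed

section \<open>Asymptotics\<close>

definition vratio :: "nat \<Rightarrow> nat \<Rightarrow> real" where
  "vratio n k = Vol_M n k (Lf_tilde n k) / Vol_M n k (B_M n k)"

lemma vratio_eq:
  assumes n: "n \<ge> 1" and k: "k \<ge> 1"
  obtains b where "orthonormal_basis_M n k b"
    "vratio n k = measure (completion (Leb (D_M n k))) (coord_set (D_M n k) b (Lf_tilde n k)) /
      measure (Leb (D_M n k)) (uball (D_M n k))"
proof -
  define b where "b = (SOME b. orthonormal_basis_M n k b)"
  have b: "orthonormal_basis_M n k b" unfolding b_def by (rule someI_ex[OF orthonormal_basis_exists[OF n k]])
  have V: "Vol_M n k S = measure (completion (Leb (D_M n k))) (coord_set (D_M n k) b S)" for S
    by (simp add: Vol_M_def Let_def b_def coord_set_def lincomb_def)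
  have "measure (completion (Leb (D_M n k))) (uball (D_M n k)) = measure (Leb (D_M n k)) (uball (D_M n k))"
    by (rule measure_completion) simp
  then show ?thesis using that[OF b] by (simp add: vratio_def V coord_set_B_M[OF b n])
qed

lemma measure_uball_pos: "d \<ge> 1 \<Longrightarrow> measure (Leb d) (uball d) > 0"
  using emeasure_uball_pos[of d] emeasure_uball_finite[of d] by (simp add: measure_def enn2real_positive_iff)

lemma power_powr_inverse: "d \<ge> 1 \<Longrightarrow> x \<ge> 0 \<Longrightarrow> (x ^ d) powr (1 / real d) = (x :: real)"
  by (cases "x = 0") (auto simp: powr_realpow[symmetric] powr_powr)

lemma vratio_lower:
  assumes n: "n \<ge> 1" and k: "k \<ge> 1" and D: "D_M n k \<ge> 1"
  shows "1 / (4 * crep k) * real n powr (- real k + 1 / 2) \<le> vratio n k powr (1 / real (D_M n k))"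
proof -
  obtain b where b: "orthonormal_basis_M n k b" and
    V: "vratio n k = measure (completion (Leb (D_M n k))) (coord_set (D_M n k) b (Lf_tilde n k)) /
      measure (Leb (D_M n k)) (uball (D_M n k))" using vratio_eq[OF n k] .
  have "(inner_radius n k / 4) ^ D_M n k \<le> vratio n k"
    using Lf_tilde_volume_lower[OF n k D b] measure_uball_pos[OF D] unfolding V by (simp add: le_divide_eq)
  then have "((inner_radius n k / 4) ^ D_M n k) powr (1 / real (D_M n k)) \<le> vratio n k powr (1 / real (D_M n k))"
    using inner_radius_pos[OF n k] by (intro powr_mono2) auto
  then have "inner_radius n k / 4 \<le> vratio n k powr (1 / real (D_M n k))"
    using inner_radius_pos[OF n k] D by (simp add: power_powr_inverse)
  moreover have "inner_radius n k / 4 = 1 / (4 * crep k) * real n powr (- real k + 1 / 2)"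
  proof -
    have "sqrt (real n ^ (2 * k - 1)) = real n powr (real (2 * k - 1) * (1 / 2))"
      using n by (simp add: powr_half_sqrt[symmetric] powr_realpow[symmetric] powr_powr)
    also have "real (2 * k - 1) * (1 / 2) = - (- real k + 1 / 2)" using k by (simp add: of_nat_diff field_simps)
    finally have "sqrt (real n ^ (2 * k - 1)) = inverse (real n powr (- real k + 1 / 2))"
      by (simp only: powr_minus)
    moreover have "1 / (c * inverse s) / 4 = 1 / (4 * c) * s" for c s :: real
      by (cases "c = 0"; cases "s = 0") (auto simp: field_simps)
    ultimately show ?thesis by (simp only: inner_radius_def)
  qed
  ultimately show ?thesis by simp
qed

lemma vratio_upper:
  fixes m :: nat
  assumes n: "n \<ge> 1" and k: "k \<ge> 1" and D: "D_M n k \<ge> 1" and m: "m \<ge> 1"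
    and \<rho>: "\<rho> > 0" "2 * cg (2 * k) / m + 2 * (1 / real n ^ k)\<^sup>2 \<le> \<rho>\<^sup>2"
  shows "vratio n k powr (1 / real (D_M n k)) \<le>
    exp (real (n * m) * ln (real (2 * n * mesh n k + 1)) / real (D_M n k)) * (2 * \<rho>)"
proof -
  let ?D = "D_M n k" and ?L = "real (2 * n * mesh n k + 1)"
  obtain b where b: "orthonormal_basis_M n k b" and
    V: "vratio n k = measure (completion (Leb ?D)) (coord_set ?D b (Lf_tilde n k)) / measure (Leb ?D) (uball ?D)"
    using vratio_eq[OF n k] .
  have "vratio n k \<le> ?L ^ (n * m) * (2 * \<rho>) ^ ?D"
    using Lf_tilde_volume_upper[OF n k m b \<rho>] measure_uball_pos[OF D] unfolding V by (simp add: divide_le_eq)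
  moreover have "0 \<le> vratio n k" unfolding V by simp
  ultimately have "vratio n k powr (1 / real ?D) \<le> (?L ^ (n * m) * (2 * \<rho>) ^ ?D) powr (1 / real ?D)"
    by (intro powr_mono2) auto
  also have "\<dots> = (?L ^ (n * m)) powr (1 / real ?D) * ((2 * \<rho>) ^ ?D) powr (1 / real ?D)"
    by (rule powr_mult)
  also have "(?L ^ (n * m)) powr (1 / real ?D) = exp (real (n * m) * ln ?L / real ?D)"
    by (simp add: powr_def ln_realpow del: of_nat_add of_nat_mult)
  also have "((2 * \<rho>) ^ ?D) powr (1 / real ?D) = 2 * \<rho>"
    using \<rho>(1) by (intro power_powr_inverse D) auto
  finally show ?thesis .
qed

text \<open>A polynomial bound makes the logarithm of the grid size a multiple of ln n; the 16^k is
  the 2^(4k) contained in \<open>mesh\<close>.\<close>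

lemma mesh_eventually:
  assumes k: "k \<ge> 1" and n: "n \<ge> 4 * k * 16 ^ k + 1"
  shows "real (2 * n * mesh n k + 1) \<le> real n ^ (4 * k + 2)"
proof -
  have n1: "n \<ge> 1" using n by linarith
  have "(2 :: nat) ^ (4 * k) = 16 ^ k" by (simp add: power_mult)
  then have "2 * n * mesh n k = 4 * k * 16 ^ k * n ^ (4 * k + 1)"
    by (simp add: mesh_def power_mult_distrib mult_ac)
  moreover have "1 \<le> n ^ (4 * k + 1)" using n1 by simp
  ultimately have "2 * n * mesh n k + 1 \<le> (4 * k * 16 ^ k + 1) * n ^ (4 * k + 1)"
    by (simp only: distrib_right)
  also have "\<dots> \<le> n * n ^ (4 * k + 1)" using n by (intro mult_right_mono) auto
  also have "\<dots> = n ^ (4 * k + 2)" by simp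
  finally have "2 * n * mesh n k + 1 \<le> n ^ (4 * k + 2)" .
  then show ?thesis by (simp only: of_nat_le_iff flip: of_nat_power)
qed

text \<open>With about n^q samples, q = 2k - 1 - e, the logarithm of the number of balls divided by
  the dimension is of order ln n / n^e, which \<open>small\<close> bounds by 1. The radius is then
  of order n^(-q/2), that is, n^(-k + 1/2 + e/2).\<close>

lemma vratio_upper_asymptotic:
  fixes e :: real
  assumes k: "k \<ge> 1" and e: "0 < e" "e \<le> 1" and n: "n \<ge> 4 * k * 16 ^ k + 1" "n \<ge> 2 * k"
    and small: "2 * real (4 * k + 2) * real (2 * k) ^ (2 * k) * (ln n / n powr e) \<le> 1"
  shows "vratio n k powr (1 / real (D_M n k)) \<le>
    exp 1 * (2 * sqrt (2 * cg (2 * k) + 2)) * real n powr (- real k + 1 / 2 + e / 2)"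
proof -
  have n1: "n \<ge> 1" using n by linarith
  let ?D = "D_M n k" and ?C = "cg (2 * k)" and ?L = "real (2 * n * mesh n k + 1)"
  define q where "q = 2 * real k - 1 - e"
  have "1 \<le> real k" using k by simp
  then have q0: "q \<ge> 0" using e(2) unfolding q_def by linarith
  define m where "m = nat \<lceil>real n powr q\<rceil>"
  have nq: "1 \<le> real n powr q" using q0 n1 by (simp add: ge_one_powr_ge_zero)
  have m_ge: "real n powr q \<le> m" unfolding m_def by (rule real_nat_ceiling_ge)
  have m1: "m \<ge> 1" using m_ge nq by linarith
  have m_le: "m \<le> 2 * real n powr q"
    using nq ceiling_correct[of "real n powr q"] unfolding m_def by linarith
  have D_ge: "(real n / real (2 * k)) ^ (2 * k) \<le> ?D"
  proof -
    have "(real n / real (2 * k)) ^ (2 * k) \<le> real (n choose (2 * k))"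
      using binomial_ge_n_over_k_pow_k[OF n(2), where 'a = real] .
    also have "\<dots> \<le> ?D" using D_M_ge[OF n1 k] by simp
    finally show ?thesis .
  qed
  have nk: "(real n / real (2 * k)) ^ (2 * k) > 0" using n1 k by simp
  then have D1: "?D \<ge> 1" using D_ge by linarith
  have expo: "real (n * m) * ln ?L / ?D \<le> 1"
  proof -
    have "ln ?L \<le> ln (real n ^ (4 * k + 2))"
      by (intro ln_mono mesh_eventually[OF k n(1)] of_nat_0_less_iff[THEN iffD2]) simp
    also have "\<dots> = real (4 * k + 2) * ln n" by (rule ln_realpow)
    finally have lnL: "ln ?L \<le> real (4 * k + 2) * ln n" .
    have ln0: "ln (real n) \<ge> 0" using n1 by simp
    have "real (n * m) * ln ?L \<le> (real n * (2 * real n powr q)) * (real (4 * k + 2) * ln n)"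
      using m_le lnL by (intro mult_mono) (auto simp: mult_left_mono)
    then have "real (n * m) * ln ?L / ?D \<le> (real n * (2 * real n powr q)) * (real (4 * k + 2) * ln n) / (real n / real (2 * k)) ^ (2 * k)"
      using D_ge nk ln0 by (intro frac_le) auto
    also have "\<dots> = 2 * real (4 * k + 2) * real (2 * k) ^ (2 * k) * (real n * real n powr q / real n ^ (2 * k) * ln n)"
      by (simp add: power_divide)
    also have "real n * real n powr q / real n ^ (2 * k) = 1 / n powr e"
    proof -
      have "real n * real n powr q / real n ^ (2 * k) = real n powr (1 + q - real (2 * k))"
        using n1 by (simp add: powr_add powr_diff powr_realpow[symmetric])
      also have "1 + q - real (2 * k) = - e" by (simp add: q_def)
      finally show ?thesis by (simp add: powr_minus_divide)
    qed
    finally show ?thesis using small by simp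
  qed
  define \<rho> where "\<rho> = sqrt (2 * ?C + 2) * real n powr (- q / 2)"
  have C: "?C \<ge> 1" by (rule cg_ge_1)
  have \<rho>: "\<rho> > 0" using C n1 by (simp add: \<rho>_def)
  have \<rho>2: "\<rho>\<^sup>2 = (2 * ?C + 2) * real n powr (- q)"
    using C by (simp add: \<rho>_def power_mult_distrib power2_eq_square[of "_ powr _"] flip: powr_add)
  have bound: "2 * ?C / m + 2 * (1 / real n ^ k)\<^sup>2 \<le> \<rho>\<^sup>2"
  proof -
    have "2 * ?C / m \<le> 2 * ?C / real n powr q" using C m_ge m1 n1 by (intro divide_left_mono mult_pos_pos) auto
    \<comment> \<open>The rounding error has order n^(-2k) and \<open>q\<close> is below 2k, so the
      sampling error dominates.\<close>
    moreover have "(1 / real n ^ k)\<^sup>2 \<le> real n powr (- q)"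
    proof -
      have "(1 / real n ^ k)\<^sup>2 = real n powr (- real (2 * k))"
        using n1 by (simp add: power_divide powr_minus_divide powr_realpow[symmetric] powr_powr mult.commute
            flip: power_mult)
      also have "\<dots> \<le> real n powr (- q)" using n1 e(1) by (intro powr_mono) (auto simp: q_def)
      finally show ?thesis .
    qed
    ultimately show ?thesis unfolding \<rho>2 by (simp add: powr_minus_divide algebra_simps)
  qed
  have "vratio n k powr (1 / ?D) \<le> exp (real (n * m) * ln ?L / ?D) * (2 * \<rho>)"
    by (rule vratio_upper[OF n1 k D1 m1 \<rho> bound])
  also have "\<dots> \<le> exp 1 * (2 * \<rho>)" using expo \<rho> by (intro mult_right_mono) auto
  also have "- q / 2 = - real k + 1 / 2 + e / 2" by (simp add: q_def field_simps)
  then have "exp 1 * (2 * \<rho>) = exp 1 * (2 * sqrt (2 * ?C + 2)) * real n powr (- real k + 1 / 2 + e / 2)"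
    by (simp only: \<rho>_def mult.assoc)
  finally show ?thesis .
qed

theorem theorem2p3:
  fixes k :: nat
  assumes "k \<ge> 1"
  shows "\<exists>\<alpha>3>0. \<exists>\<beta>3>0. \<forall>\<epsilon>>0. \<exists>N. \<forall>n\<ge>N.
    \<beta>3 * real n powr (- real k + 1 / 2)
      \<le> (Vol_M n k (Lf_tilde n k) / Vol_M n k (B_M n k)) powr (1 / real (D_M n k)) \<and>
    (Vol_M n k (Lf_tilde n k) / Vol_M n k (B_M n k)) powr (1 / real (D_M n k))
      \<le> \<alpha>3 * real n powr (- real k + 1 / 2 + \<epsilon>)"
proof -
  let ?\<alpha> = "exp 1 * (2 * sqrt (2 * cg (2 * k) + 2))" and ?\<beta> = "1 / (4 * crep k)"
  have \<alpha>: "?\<alpha> > 0" using cg_ge_1[of "2 * k"] by simp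
  have \<beta>: "?\<beta> > 0" using crep_pos[OF assms] by simp
  have "\<exists>N. \<forall>n\<ge>N. ?\<beta> * real n powr (- real k + 1 / 2) \<le> vratio n k powr (1 / real (D_M n k)) \<and>
      vratio n k powr (1 / real (D_M n k)) \<le> ?\<alpha> * real n powr (- real k + 1 / 2 + \<epsilon>)"
    if \<epsilon>: "\<epsilon> > 0" for \<epsilon>
  proof -
    \<comment> \<open>The cap at 1 keeps the exponent 2k - 1 - e of the sample size nonnegative also
      for k = 1. The factor \<open>?\<alpha>\<close> does not involve \<open>e\<close>, as the order
      of the quantifiers demands.\<close>
    define e where "e = min \<epsilon> 1"
    have e: "0 < e" "e \<le> 1" "e \<le> \<epsilon>" using \<epsilon> by (auto simp: e_def)
    let ?K = "2 * real (4 * k + 2) * real (2 * k) ^ (2 * k)"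
    have "(\<lambda>n. ?K * (ln (real n) / real n powr e)) \<longlonglongrightarrow> ?K * 0"
      using e by (intro tendsto_mult tendsto_const lim_ln_over_power)
    then have "eventually (\<lambda>n. ?K * (ln (real n) / real n powr e) < 1) sequentially"
      by (rule order_tendstoD(2)) simp
    then obtain N where N: "\<And>n. n \<ge> N \<Longrightarrow> ?K * (ln (real n) / real n powr e) \<le> 1"
      by (auto simp: eventually_sequentially intro: less_imp_le)
    have "?\<beta> * real n powr (- real k + 1 / 2) \<le> vratio n k powr (1 / real (D_M n k)) \<and>
        vratio n k powr (1 / real (D_M n k)) \<le> ?\<alpha> * real n powr (- real k + 1 / 2 + \<epsilon>)"
      if n: "n \<ge> max N (max (4 * k * 16 ^ k + 1) (2 * k))" for n
    proof
      have n1: "n \<ge> 1" and n2: "4 * k * 16 ^ k + 1 \<le> n" "2 * k \<le> n" "N \<le> n" using n by auto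
      \<comment> \<open>A positive dimension is required for the D-th root: \<open>1 / 0 = 0\<close>
        would make the exponent of \<open>powr\<close> vanish.\<close>
      have "0 < n choose (2 * k)" using n2 by (simp add: zero_less_binomial_iff)
      then have D1: "D_M n k \<ge> 1" using D_M_ge[OF n1 assms] by linarith
      show "?\<beta> * real n powr (- real k + 1 / 2) \<le> vratio n k powr (1 / real (D_M n k))"
        by (rule vratio_lower[OF n1 assms D1])
      have "vratio n k powr (1 / real (D_M n k)) \<le> ?\<alpha> * real n powr (- real k + 1 / 2 + e / 2)"
        by (rule vratio_upper_asymptotic[OF assms e(1,2) n2(1,2) N[OF n2(3)]])
      also have "\<dots> \<le> ?\<alpha> * real n powr (- real k + 1 / 2 + \<epsilon>)"
        using n1 e \<alpha> by (intro mult_left_mono powr_mono) auto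
      finally show "vratio n k powr (1 / real (D_M n k)) \<le> ?\<alpha> * real n powr (- real k + 1 / 2 + \<epsilon>)" .
    qed
    then show ?thesis by blast
  qed
  then show ?thesis using \<alpha> \<beta> unfolding vratio_def by blast
qed

end
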